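(* Let $d \ge 7$ be an integer and let $(U_t(x))_{t\ge 0, x\in\mathbb{R}}$ be the stationary pinned string in $\mathbb{R}^d$. Then for every $\alpha > 0$, almost surely, $$\liminf_{t\to\infty} \frac{\inf_{x\in\mathbb{R}} |U_t(x)|}{t^{\alpha}} = \begin{cases} +\infty & \text{if } 0<\alpha<1/4,\\ 0 & \text{if } \alpha \ge 1/4.\end{cases}$$
   Context: Let $G_t(x) = (4\pi t)^{-1/2}\exp(-x^2/(4t))$ for $t>0$, $x\in\mathbb{R}$ (heat kernel of $\partial_t u=\partial_x^2 u$). Let $W$ and $\tilde W$ be independent $\mathbb{R}^d$-valued space-time white noises on $[0,\infty)\times\mathbb{R}$, each with independent components (each component is a centered Gaussian family indexed by $f\in L^2([0,\infty)\times\mathbb{R})$ with covariance $E[W^{(i)}(f)W^{(i)}(g)]=\int_0^\infty\int_{\mathbb{R}} f(r,z)g(r,z)\,dz\,dr$), $W$ being adapted to a filtration $(\mathcal F_t)$ on a probability space $(\Omega,\mathcal F,P)$, with $\mathcal F$ complete and $(\mathcal F_t)$ right continuous: $W(f)$ is $\mathcal F_t$-measurable whenever $f$ is supported in $[0,t]\times\mathbb{R}$. The stationary pinned string in $\mathbb{R}^d$ is the continuous $\mathbb{R}^d$-valued random field $(U_t(x))_{t\ge0,x\in\mathbb{R}}$, solving $\partial_t u_t(x) = \partial_x^2 u_t(x) + \dot W(x,t)$, with $$U_0(x) = \int_0^\infty\int_{\mathbb{R}} \big(G_r(x-z)-G_r(z)\big)\,\tilde W(dz\,dr)$$ and, for $t>0$,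 $U_t(x)$ a continuous version of $$\int_{\mathbb{R}} G_t(x-z)U_0(z)\,dz + \int_0^t\int_{\mathbb{R}} G_{t-r}(x-z)\,W(dz\,dr).$$ $|\cdot|$ denotes the Euclidean norm on $\mathbb{R}^d$. *)

theory Defs
  imports "HOL-Probability.Probability"
begin

definition heat_kernel :: "real \<Rightarrow> real \<Rightarrow> real" where
  "heat_kernel t x = 1 / sqrt (4 * pi * t) * exp (- x\<^sup>2 / (4 * t))"

text \<open>
  Space-time points are pairs \<open>(r, z)\<close> with time \<open>r\<close> first. Elements of
  \<open>L\<^sup>2([0,\<infinity>) \<times> \<real>)\<close> are represented by functions (not classes) on the whole plane;
  their values at negative times play no role.
\<close>

abbreviation half_plane :: "(real \<times> real) set" where
  "half_plane \<equiv> {0..} \<times> UNIV"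

definition L2_half_plane :: "(real \<times> real \<Rightarrow> real) set" where
  "L2_half_plane = {f. set_borel_measurable lborel half_plane f \<and>
                       set_integrable lborel half_plane (\<lambda>p. (f p)\<^sup>2)}"

text \<open>Point mass at 0 is admitted as the degenerate centered Gaussian law.\<close>

definition centered_gaussian :: "'w measure \<Rightarrow> ('w \<Rightarrow> real) \<Rightarrow> bool" where
  "centered_gaussian M X \<longleftrightarrow>
     X \<in> borel_measurable M \<and>
     ((AE \<omega> in M. X \<omega> = 0) \<or> (\<exists>\<sigma>>0. distributed M lborel X (normal_density 0 \<sigma>)))"

definition centered_gaussian_family :: "'w measure \<Rightarrow> 'i set \<Rightarrow> ('i \<Rightarrow> 'w \<Rightarrow> real) \<Rightarrow> bool" where
  "centered_gaussian_family M I X \<longleftrightarrow>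
     (\<forall>J c. finite J \<and> J \<subseteq> I \<longrightarrow> centered_gaussian M (\<lambda>\<omega>. \<Sum>j\<in>J. c j * X j \<omega>))"

type_synonym 'w noise = "(real \<times> real \<Rightarrow> real) \<Rightarrow> 'w \<Rightarrow> real"

definition white_noise :: "'w measure \<Rightarrow> 'w noise \<Rightarrow> bool" where
  "white_noise M W \<longleftrightarrow>
     centered_gaussian_family M L2_half_plane W \<and>
     (\<forall>f\<in>L2_half_plane. \<forall>g\<in>L2_half_plane.
        (\<integral>\<omega>. W f \<omega> * W g \<omega> \<partial>M) = (LINT p:half_plane|lborel. f p * g p))"

text \<open>
  An \<open>\<real>\<^sup>d\<close>-valued white noise is given by its components. A component is regarded as a
  random element of the product space over \<open>L2_half_plane\<close>, so that independence of
  components means independence of the \<open>\<sigma>\<close>-algebras they generate.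
\<close>

definition vector_white_noise :: "'w measure \<Rightarrow> ('d \<Rightarrow> 'w noise) \<Rightarrow> bool" where
  "vector_white_noise M W \<longleftrightarrow>
     (\<forall>i. white_noise M (W i)) \<and>
     prob_space.indep_vars M (\<lambda>_. Pi\<^sub>M L2_half_plane (\<lambda>_. borel))
       (\<lambda>i \<omega>. \<lambda>f\<in>L2_half_plane. W i f \<omega>) UNIV"

definition independent_noises :: "'w measure \<Rightarrow> ('d \<Rightarrow> 'w noise) \<Rightarrow> ('d \<Rightarrow> 'w noise) \<Rightarrow> bool" where
  "independent_noises M V W \<longleftrightarrow>
     prob_space.indep_var M
       (Pi\<^sub>M (UNIV \<times> L2_half_plane) (\<lambda>_. borel)) (\<lambda>\<omega>. \<lambda>(i, f)\<in>UNIV \<times> L2_half_plane. V i f \<omega>)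
       (Pi\<^sub>M (UNIV \<times> L2_half_plane) (\<lambda>_. borel)) (\<lambda>\<omega>. \<lambda>(i, f)\<in>UNIV \<times> L2_half_plane. W i f \<omega>)"

definition noise_integral :: "('d::finite \<Rightarrow> 'w noise) \<Rightarrow> (real \<times> real \<Rightarrow> real) \<Rightarrow> 'w \<Rightarrow> real ^ 'd" where
  "noise_integral W f \<omega> = (\<chi> i. W i f \<omega>)"

text \<open>
  Filtrations are indexed by \<open>[0,\<infinity>)\<close>. As the library locale takes the whole index type
  as index set, \<open>F\<close> is composed with \<open>max 0\<close>; nothing is assumed about \<open>F t\<close> for \<open>t < 0\<close>.
\<close>

locale noise_setup =
  prob_space M + complete_measure M + filtration "space M" "\<lambda>t. F (max 0 t)"
  for M :: "'w measure" and F :: "real \<Rightarrow> 'w measure" +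
  fixes W W' :: "'d::finite \<Rightarrow> 'w noise"
  assumes F_subset: "0 \<le> t \<Longrightarrow> sets (F t) \<subseteq> sets M"
    and F_right_continuous: "0 \<le> t \<Longrightarrow> sets (F t) = (\<Inter>s\<in>{t<..}. sets (F s))"
    and noise_W: "vector_white_noise M W"
    and noise_W': "vector_white_noise M W'"
    and indep_W_W': "independent_noises M W W'"
    and adapted_W: "\<lbrakk>0 \<le> t; f \<in> L2_half_plane; \<And>r z. t < r \<Longrightarrow> f (r, z) = 0\<rbrakk>
                      \<Longrightarrow> W i f \<in> borel_measurable (F t)"

text \<open>
  In \<open>U t x \<omega>\<close> time precedes space. The defining identities hold almost surely for each
  fixed \<open>(t, x)\<close>, while the paths of \<open>U\<close> are jointly continuous. The library conventions give
  \<open>heat_kernel 0 x = 0\<close>, which only affects the integrands on the null sets \<open>r = 0\<close> and \<open>r = t\<close>.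
\<close>

locale stationary_pinned_string = noise_setup M F W W'
  for M :: "'w measure" and F :: "real \<Rightarrow> 'w measure" and W W' :: "'d::finite \<Rightarrow> 'w noise" +
  fixes U :: "real \<Rightarrow> real \<Rightarrow> 'w \<Rightarrow> real ^ 'd"
  assumes U_measurable: "0 \<le> t \<Longrightarrow> U t x \<in> borel_measurable M"
    and U_continuous: "\<omega> \<in> space M \<Longrightarrow> continuous_on ({0..} \<times> UNIV) (\<lambda>(t, x). U t x \<omega>)"
    and U_initial:
      "AE \<omega> in M. U 0 x \<omega> =
         noise_integral W' (\<lambda>(r, z). heat_kernel r (x - z) - heat_kernel r z) \<omega>"
    and U_evolution:
      "0 < t \<Longrightarrow> AE \<omega> in M. U t x \<omega> =
         (\<integral>z. heat_kernel t (x - z) *\<^sub>R U 0 z \<omega> \<partial>lborel) +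
         noise_integral W (\<lambda>(r, z). indicator {0..t} r * heat_kernel (t - r) (x - z)) \<omega>"

end

(*
  Reversing the time of the initial noise merges the two noises into one on the whole time axis, so
  that each component of U has stationary increments whose variance, gap a x for a time lag a and a
  space lag x, is comparable to sqrt a + |x|, and U_0(0) = 0.

  alpha < 1/4: cover the shell 16^n <= t + x^2 <= 16^(n+1) by parabolic cells slightly smaller than
  the target radius. There are about (L/delta)^6 cells, with L = 2^n; a cell comes close to 0 with
  probability about (radius/L)^d, and d >= 7 beats the count. The oscillation inside a cell is
  controlled by chaining and high Gaussian moments; conclude by Borel-Cantelli.

  alpha >= 1/4: along t_n = 2^(4 n^2) the variables exp(-l |U_{t_n}(0)|^2 / (2 sqrt t_n)) have a common
  mean p(l) that decays only polynomially in l, and they are almost uncorrelated, so their averages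
  converge to p(l). If |U_{t_n}(0)| >= eps t_n^(1/4) for all large n, the averages would be at most
  exp(-l eps^2 / 2), which is less than p(l) for large l.
*)

theory Submission
  imports Defs "HOL-Real_Asymp.Real_Asymp"
begin

section \<open>Heat kernel computations\<close>

text \<open>For t > 0 the string is given by a pathwise integral of the continuous field U_0, so a
  stochastic Fubini theorem is needed before U_t(x) becomes a Gaussian integral of one explicit
  kernel. White noise comes only with Gaussian laws and covariances: linearity is derived from
  these, and small balls and decorrelation both rest on the expectation of exp (- l |U|^2 / 2),
  computed from characteristic functions without joint densities.

  Homogeneity dictates the geometry. U has the size of t^(1/4) or |x|^(1/2), so in units of U a cell
  measures \<delta>^4 by \<delta>^2, and cell counts carry the exponent 4 + 2 = 6; the dimension 7
  is the first to exceed it. Shells are taken in t + x^2 rather than in t, because the infimum runs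
  over all x, and a distant x at a given time belongs to a later shell. On the n-th shell radius and
  mesh are L times powers of r^n. Since r may be arbitrarily close to 1, the loss is an arbitrarily
  small power of t, and every \<alpha> < 1/4 is reached.\<close>

lemma heat_kernel_eq_normal_density: "0 < t \<Longrightarrow> heat_kernel t x = normal_density 0 (sqrt (2 * t)) x"
  by (simp add: heat_kernel_def normal_density_def)

lemma heat_kernel_nonneg: "0 \<le> t \<Longrightarrow> 0 \<le> heat_kernel t x"
  by (simp add: heat_kernel_def)

lemma heat_kernel_0 [simp]: "heat_kernel 0 x = 0"
  by (simp add: heat_kernel_def)

lemma heat_kernel_even: "heat_kernel t (x - y) = heat_kernel t (y - x)"
  by (simp add: heat_kernel_def power2_commute)

lemma heat_kernel_measurable [measurable (raw)]:
  assumes [measurable]: "f \<in> borel_measurable N" "g \<in> borel_measurable N"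
  shows "(\<lambda>x. heat_kernel (f x) (g x)) \<in> borel_measurable N"
  unfolding heat_kernel_def by measurable

text \<open>The semigroup property: centered normal densities of variances 2 a and 2 b convolve to
  one of variance 2 (a + b). Translating z by y brings the integral into convolution form.\<close>

lemma has_bochner_integral_heat_kernel_conv:
  assumes "0 < a" "0 < b"
  shows "has_bochner_integral lborel (\<lambda>z. heat_kernel a (x - z) * heat_kernel b (y - z))
           (heat_kernel (a + b) (x - y))"
proof (rule has_bochner_integral_nn_integral)
  have "(\<integral>\<^sup>+z. heat_kernel a (x - z) * heat_kernel b (y - z) \<partial>lborel)
      = (\<integral>\<^sup>+z. heat_kernel a (x - y - z) * heat_kernel b z \<partial>lborel)"
    by (subst nn_integral_real_affine[of _ 1 y])
       (auto simp: algebra_simps heat_kernel_def)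
  also have "\<dots> = (\<lambda>x. \<integral>\<^sup>+z. ennreal (normal_density 0 (sqrt (2 * a)) (x - z)
      * normal_density 0 (sqrt (2 * b)) z) \<partial>lborel) (x - y)"
    using assms by (simp add: heat_kernel_eq_normal_density)
  also have "\<dots> = ennreal (normal_density 0 (sqrt ((sqrt (2 * a))\<^sup>2 + (sqrt (2 * b))\<^sup>2)) (x - y))"
    using fun_cong[OF conv_normal_density_zero_mean[of "sqrt (2 * a)" "sqrt (2 * b)"], of "x - y"] assms
    by simp
  also have "normal_density 0 (sqrt ((sqrt (2 * a))\<^sup>2 + (sqrt (2 * b))\<^sup>2)) (x - y) = heat_kernel (a + b) (x - y)"
    using assms by (simp add: heat_kernel_eq_normal_density distrib_left)
  finally show "(\<integral>\<^sup>+z. heat_kernel a (x - z) * heat_kernel b (y - z) \<partial>lborel)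
      = heat_kernel (a + b) (x - y)" .
qed (use assms in \<open>auto simp: heat_kernel_nonneg\<close>)

lemma has_bochner_integral_heat_kernel:
  assumes "0 < t" shows "has_bochner_integral lborel (\<lambda>z. heat_kernel t (x - z)) 1"
proof -
  have "has_bochner_integral lborel (normal_density x (sqrt (2 * t))) 1"
    using assms by (simp add: has_bochner_integral_iff)
  then show ?thesis
    using assms by (simp add: heat_kernel_eq_normal_density normal_density_def[abs_def] power2_commute)
qed

lemma has_bochner_integral_heat_kernel_diff_sq:
  assumes "0 < a" "0 < b"
  shows "has_bochner_integral lborel (\<lambda>z. (heat_kernel a (x - z) - heat_kernel b (y - z))\<^sup>2)
           (heat_kernel (2 * a) 0 + heat_kernel (2 * b) 0 - 2 * heat_kernel (a + b) (x - y))"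
proof -
  have "has_bochner_integral lborel
     (\<lambda>z. heat_kernel a (x - z) * heat_kernel a (x - z) + heat_kernel b (y - z) * heat_kernel b (y - z)
          - 2 * (heat_kernel a (x - z) * heat_kernel b (y - z)))
     (heat_kernel (a + a) (x - x) + heat_kernel (b + b) (y - y) - 2 * heat_kernel (a + b) (x - y))"
    using assms by (intro has_bochner_integral_diff has_bochner_integral_add
      has_bochner_integral_mult_right has_bochner_integral_heat_kernel_conv) auto
  then show ?thesis by (simp add: power2_eq_square algebra_simps)
qed

lemma nn_integral_heat_kernel_sq:
  assumes "0 < a"
  shows "(\<integral>\<^sup>+z. ennreal ((heat_kernel a (x - z))\<^sup>2) \<partial>lborel) = heat_kernel (2 * a) 0"
proof -
  have "has_bochner_integral lborel (\<lambda>z. (heat_kernel a (x - z))\<^sup>2) (heat_kernel (2 * a) 0)"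
    using has_bochner_integral_heat_kernel_conv[OF assms assms, of x x] by (simp add: power2_eq_square)
  then show ?thesis
    by (subst nn_integral_eq_integral) (auto simp: has_bochner_integral_iff)
qed

text \<open>The squared L2 distance, over space, of heat kernels at times a + v and v with centers x
  apart, in the closed form that the semigroup property gives.\<close>

definition kernel_gap :: "real \<Rightarrow> real \<Rightarrow> real \<Rightarrow> real" where
  "kernel_gap a x v = heat_kernel (2 * (a + v)) 0 + heat_kernel (2 * v) 0 - 2 * heat_kernel (a + 2 * v) x"

lemma kernel_gap_measurable [measurable]: "kernel_gap a x \<in> borel_measurable borel"
  unfolding kernel_gap_def by measurable

lemma nn_integral_heat_kernel_diff_sq:
  assumes "0 < v" "0 \<le> a"
  shows "(\<integral>\<^sup>+z. ennreal ((heat_kernel (a + v) (x - z) - heat_kernel v (y - z))\<^sup>2) \<partial>lborel) = kernel_gap a (x - y) v"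
proof -
  have *: "2 * (a + v) = (a + v) + (a + v)" "a + 2 * v = a + v + v" by auto
  show ?thesis using has_bochner_integral_heat_kernel_diff_sq[of "a+v" v x y] assms
  by (subst nn_integral_eq_integral) (auto simp: kernel_gap_def has_bochner_integral_iff *(2))
qed

lemma kernel_gap_nonneg: assumes "0 < v" "0 \<le> a" shows "0 \<le> kernel_gap a x v"
proof -
  have "0 \<le> (LINT z|lborel. (heat_kernel (a + v) (x - z) - heat_kernel v (0 - z))\<^sup>2)"
    by (intro integral_nonneg_AE) auto
  also have "\<dots> = kernel_gap a x v"
    using has_bochner_integral_heat_kernel_diff_sq[of "a+v" v x 0] assms
    by (auto simp: kernel_gap_def has_bochner_integral_iff ac_simps)
  finally show ?thesis .
qed

text \<open>The kernel of the initial noise in U_t(x): heat flow for time t turns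
  \<open>heat_kernel r\<close> into \<open>heat_kernel (t + r)\<close>, while the pinning term,
  constant in x, is preserved. This is proved in \<open>initial_smoothed\<close>.\<close>

definition initial_kernel :: "real \<Rightarrow> real \<Rightarrow> real \<times> real \<Rightarrow> real" where
  "initial_kernel t x = (\<lambda>(r, z). heat_kernel (t + r) (x - z) - heat_kernel r z)"

definition evolution_kernel :: "real \<Rightarrow> real \<Rightarrow> real \<times> real \<Rightarrow> real" where
  "evolution_kernel t x = (\<lambda>(r, z). indicator {0..t} r * heat_kernel (t - r) (x - z))"

lemma initial_kernel_measurable [measurable]: "initial_kernel t x \<in> borel_measurable borel"
  unfolding initial_kernel_def borel_prod[symmetric] by measurable

lemma evolution_kernel_measurable [measurable]: "evolution_kernel t x \<in> borel_measurable borel"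
  unfolding evolution_kernel_def borel_prod[symmetric] by measurable

lemma initial_kernel_0_0 [simp]: "initial_kernel 0 0 = (\<lambda>_. 0)"
  by (auto simp: initial_kernel_def heat_kernel_def)

lemma evolution_kernel_0 [simp]: "evolution_kernel 0 x = (\<lambda>_. 0)"
  by (auto simp: evolution_kernel_def split: split_indicator)

section \<open>Variance of an increment as a one-dimensional integral\<close>

lemma half_plane_borel [measurable]: "half_plane \<in> sets borel"
  unfolding borel_prod[symmetric] by measurable

text \<open>Discarding the null line r = 0 leaves positive times only, the range where the semigroup
  identities apply.\<close>

lemma nn_integral_half_plane:
  assumes [measurable]: "f \<in> borel_measurable borel"
  shows "(\<integral>\<^sup>+p. f p * indicator half_plane p \<partial>lborel) = (\<integral>\<^sup>+r. (\<integral>\<^sup>+z. f (r, z) \<partial>lborel) * indicator {0<..} r \<partial>lborel)"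
proof -
  have "(\<integral>\<^sup>+p. f p * indicator half_plane p \<partial>lborel) = (\<integral>\<^sup>+r. (\<integral>\<^sup>+z. f (r, z) * indicator half_plane (r, z) \<partial>lborel) \<partial>lborel)"
    unfolding lborel_prod[symmetric]
    by (subst lborel.nn_integral_fst[symmetric]) (auto simp: borel_prod lborel_prod)
  also have "\<dots> = (\<integral>\<^sup>+r. (\<integral>\<^sup>+z. f (r, z) \<partial>lborel) * indicator {0<..} r \<partial>lborel)"
  proof (rule nn_integral_cong_AE)
    show "AE r in lborel. (\<integral>\<^sup>+z. f (r, z) * indicator half_plane (r, z) \<partial>lborel) = (\<integral>\<^sup>+z. f (r, z) \<partial>lborel) * indicator {0<..} r"
      using AE_lborel_singleton[of "0::real"] by eventually_elim (auto split: split_indicator)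
  qed
  finally show ?thesis .
qed

text \<open>The pinning term is the same for both points and cancels. The substitution v = s + r
  measures the age of the initial noise at the earlier time s, so this noise supplies the ages v >
  s.\<close>

lemma nn_integral_initial_kernel_diff:
  assumes "0 \<le> s" "s \<le> t"
  shows "(\<integral>\<^sup>+p. ennreal ((initial_kernel t x p - initial_kernel s y p)\<^sup>2) * indicator half_plane p \<partial>lborel)
     = (\<integral>\<^sup>+v. ennreal (kernel_gap (t - s) (x - y) v) * indicator {s<..} v \<partial>lborel)"
proof -
  have "(\<integral>\<^sup>+p. ennreal ((initial_kernel t x p - initial_kernel s y p)\<^sup>2) * indicator half_plane p \<partial>lborel)
     = (\<integral>\<^sup>+r. ennreal (kernel_gap (t - s) (x - y) (s + r)) * indicator {0<..} r \<partial>lborel)"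
    apply (subst nn_integral_half_plane, measurable)
    apply (intro nn_integral_cong)
    subgoal for r
      using nn_integral_heat_kernel_diff_sq[of "s + r" "t - s" x y] assms
      by (auto split: split_indicator simp: initial_kernel_def algebra_simps)
    done
  also have "\<dots> = (\<integral>\<^sup>+v. ennreal (kernel_gap (t - s) (x - y) v) * indicator {s<..} v \<partial>lborel)"
    by (subst (2) nn_integral_real_affine[of _ 1 s]) (auto intro!: nn_integral_cong split: split_indicator)
  finally show ?thesis .
qed

text \<open>Noise before s reaches both points, at age v = s - r for the earlier and t - r for the
  later one, and supplies the ages v \<le> s; noise in (s, t) reaches the later point only.\<close>

lemma nn_integral_evolution_kernel_diff:
  assumes "0 \<le> s" "s \<le> t"
  shows "(\<integral>\<^sup>+p. ennreal ((evolution_kernel t x p - evolution_kernel s y p)\<^sup>2) * indicator half_plane p \<partial>lborel)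
     = (\<integral>\<^sup>+v. ennreal (kernel_gap (t - s) (x - y) v) * indicator {0<..s} v \<partial>lborel)
     + (\<integral>\<^sup>+v. ennreal (heat_kernel (2 * v) 0) * indicator {0<..<t - s} v \<partial>lborel)"
proof -
  have "(\<integral>\<^sup>+p. ennreal ((evolution_kernel t x p - evolution_kernel s y p)\<^sup>2) * indicator half_plane p \<partial>lborel)
     = (\<integral>\<^sup>+r. ennreal (kernel_gap (t - s) (x - y) (s - r)) * indicator {0..<s} r
            + ennreal (heat_kernel (2 * (t - r)) 0) * indicator {s<..<t} r \<partial>lborel)"
    apply (subst nn_integral_half_plane, measurable)
    apply (intro nn_integral_cong_AE)
    using AE_lborel_singleton[of "0::real"] AE_lborel_singleton[of s] AE_lborel_singleton[of t]
  proof eventually_elim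
    case (elim r)
    then consider "r < 0" | "0 < r" "r < s" | "r > s" "0 < r" "r < t" | "r > t" "r > 0"
      by linarith
    then show ?case
    proof cases
      case 2
      then show ?thesis
        using nn_integral_heat_kernel_diff_sq[of "s - r" "t - s" x y] assms
        by (auto split: split_indicator simp: evolution_kernel_def algebra_simps)
    next
      case 3
      then show ?thesis
        using nn_integral_heat_kernel_sq[of "t - r" x] assms
        by (auto split: split_indicator simp: evolution_kernel_def algebra_simps)
    qed (use assms in \<open>auto simp: evolution_kernel_def\<close>)
  qed
  also have "\<dots> = (\<integral>\<^sup>+r. ennreal (kernel_gap (t - s) (x - y) (s - r)) * indicator {0..<s} r \<partial>lborel)
            + (\<integral>\<^sup>+r. ennreal (heat_kernel (2 * (t - r)) 0) * indicator {s<..<t} r \<partial>lborel)"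
    by (intro nn_integral_add) auto
  also have "(\<integral>\<^sup>+r. ennreal (kernel_gap (t - s) (x - y) (s - r)) * indicator {0..<s} r \<partial>lborel)
      = (\<integral>\<^sup>+v. ennreal (kernel_gap (t - s) (x - y) v) * indicator {0<..s} v \<partial>lborel)"
    by (subst (2) nn_integral_real_affine[of _ "-1" s]) (auto intro!: nn_integral_cong split: split_indicator)
  also have "(\<integral>\<^sup>+r. ennreal (heat_kernel (2 * (t - r)) 0) * indicator {s<..<t} r \<partial>lborel)
      = (\<integral>\<^sup>+v. ennreal (heat_kernel (2 * v) 0) * indicator {0<..<t - s} v \<partial>lborel)"
    by (subst (2) nn_integral_real_affine[of _ "-1" t]) (auto intro!: nn_integral_cong split: split_indicator)
  finally show ?thesis .
qed

text \<open>The variance of one component of an increment with time lag a and space lag x, kept in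
  \<open>ennreal\<close> until it is known to be finite. The first integral collects the noise older
  than the earlier point, the second the noise of the a time units in between.\<close>

definition gap_total :: "real \<Rightarrow> real \<Rightarrow> ennreal" where
  "gap_total a x = (\<integral>\<^sup>+v. ennreal (kernel_gap a x v) * indicator {0<..} v \<partial>lborel)
     + (\<integral>\<^sup>+v. ennreal (heat_kernel (2 * v) 0) * indicator {0<..<a} v \<partial>lborel)"

text \<open>The increments are stationary: the two parts of the noise recombine to a noise on the whole
  time axis.\<close>

lemma nn_integral_kernel_diff:
  assumes "0 \<le> s" "s \<le> t"
  shows "(\<integral>\<^sup>+p. ennreal ((initial_kernel t x p - initial_kernel s y p)\<^sup>2) * indicator half_plane p \<partial>lborel)
       + (\<integral>\<^sup>+p. ennreal ((evolution_kernel t x p - evolution_kernel s y p)\<^sup>2) * indicator half_plane p \<partial>lborel)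
     = gap_total (t - s) (x - y)"
proof -
  have "(\<integral>\<^sup>+v. ennreal (kernel_gap (t - s) (x - y) v) * indicator {0<..} v \<partial>lborel)
    = (\<integral>\<^sup>+v. ennreal (kernel_gap (t - s) (x - y) v) * indicator {s<..} v +
         ennreal (kernel_gap (t - s) (x - y) v) * indicator {0<..s} v \<partial>lborel)"
    using assms by (intro nn_integral_cong) (auto split: split_indicator)
  also have "\<dots> = (\<integral>\<^sup>+v. ennreal (kernel_gap (t - s) (x - y) v) * indicator {s<..} v \<partial>lborel)
    + (\<integral>\<^sup>+v. ennreal (kernel_gap (t - s) (x - y) v) * indicator {0<..s} v \<partial>lborel)"
    by (intro nn_integral_add) auto
  finally show ?thesis
    using assms by (simp add: nn_integral_initial_kernel_diff nn_integral_evolution_kernel_diff gap_total_def add.assoc)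
qed

section \<open>Exact value and two-sided bounds of the variance\<close>

lemma nn_integral_FTC_einterval:
  fixes f F :: "real \<Rightarrow> real" and a b :: ereal
  assumes [measurable]: "f \<in> borel_measurable borel" and "a < b"
    and F: "\<And>x. a < ereal x \<Longrightarrow> ereal x < b \<Longrightarrow> (F has_real_derivative f x) (at x)"
    and cont: "\<And>x. a < ereal x \<Longrightarrow> ereal x < b \<Longrightarrow> isCont f x"
    and nonneg: "\<And>x. a < ereal x \<Longrightarrow> ereal x < b \<Longrightarrow> 0 \<le> f x"
    and A: "((F \<circ> real_of_ereal) \<longlongrightarrow> A) (at_right a)"
    and B: "((F \<circ> real_of_ereal) \<longlongrightarrow> B) (at_left b)"
  shows "(\<integral>\<^sup>+x. ennreal (f x) * indicator (einterval a b) x \<partial>lborel) = ennreal (B - A)"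
proof -
  have int: "set_integrable lborel (einterval a b) f" "(LBINT x=a..b. f x) = B - A"
    by (rule interval_integral_FTC_nonneg[OF _ _ _ _ A B]; use assms in auto)+
  have "(\<integral>\<^sup>+x. ennreal (f x) * indicator (einterval a b) x \<partial>lborel)
      = (\<integral>\<^sup>+x. ennreal (indicator (einterval a b) x *\<^sub>R f x) \<partial>lborel)"
    by (intro nn_integral_cong) (auto split: split_indicator)
  also have "\<dots> = ennreal (LINT x|lborel. indicator (einterval a b) x *\<^sub>R f x)"
    using int(1) nonneg
    by (intro nn_integral_eq_integral) (auto simp: einterval_def set_integrable_def split: split_indicator)
  also have "(LINT x|lborel. indicator (einterval a b) x *\<^sub>R f x) = B - A"
    using int(2) less_imp_le[OF \<open>a < b\<close>] by (simp add: interval_lebesgue_integral_def set_lebesgue_integral_def)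
  finally show ?thesis .
qed

text \<open>End values are one-sided limits, because integrands such as
  \<open>kernel_gap a 0\<close> blow up like 1 / sqrt v at 0.\<close>

lemma nn_integral_FTC_greaterThan:
  fixes f F :: "real \<Rightarrow> real"
  assumes [measurable]: "f \<in> borel_measurable borel"
    and F: "\<And>x. a < x \<Longrightarrow> (F has_real_derivative f x) (at x)"
    and cont: "\<And>x. a < x \<Longrightarrow> isCont f x"
    and nonneg: "\<And>x. a < x \<Longrightarrow> 0 \<le> f x"
    and A: "(F \<longlongrightarrow> A) (at_right a)"
    and B: "(F \<longlongrightarrow> B) at_top"
  shows "(\<integral>\<^sup>+x. ennreal (f x) * indicator {a<..} x \<partial>lborel) = ennreal (B - A)"
proof -
  have "einterval (ereal a) \<infinity> = {a<..}" by (auto simp: einterval_def)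
  then show ?thesis
    using nn_integral_FTC_einterval[of f a \<infinity> F A B] assms by (simp add: ereal_tendsto_simps)
qed

lemma nn_integral_FTC_greaterThanLessThan:
  fixes f F :: "real \<Rightarrow> real"
  assumes [measurable]: "f \<in> borel_measurable borel" and "a < b"
    and F: "\<And>x. a < x \<Longrightarrow> x < b \<Longrightarrow> (F has_real_derivative f x) (at x)"
    and cont: "\<And>x. a < x \<Longrightarrow> x < b \<Longrightarrow> isCont f x"
    and nonneg: "\<And>x. a < x \<Longrightarrow> x < b \<Longrightarrow> 0 \<le> f x"
    and A: "(F \<longlongrightarrow> A) (at_right a)"
    and B: "(F \<longlongrightarrow> B) (at_left b)"
  shows "(\<integral>\<^sup>+x. ennreal (f x) * indicator {a<..<b} x \<partial>lborel) = ennreal (B - A)"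
proof -
  have "einterval (ereal a) (ereal b) = {a<..<b}" by (auto simp: einterval_def)
  then show ?thesis
    using nn_integral_FTC_einterval[of f a "ereal b" F A B] assms by (simp add: ereal_tendsto_simps)
qed

lemma heat_kernel_alt: "heat_kernel (2 * w) x = 1 / sqrt (8 * pi) / sqrt w * exp (- (x\<^sup>2 / (8 * w)))"
  by (simp add: heat_kernel_def real_sqrt_mult[symmetric] mult_ac)

text \<open>Splits off the effect of the space lag: for a \<ge> 0 and v > 0 the second summand is
  nonnegative, and it vanishes at x = 0, so each lag can be estimated on its own.\<close>

lemma kernel_gap_decomp:
  "kernel_gap a x v = kernel_gap a 0 v
     + 2 / sqrt (8 * pi) / sqrt (a / 2 + v) * (1 - exp (- (x\<^sup>2 / (8 * (a / 2 + v)))))"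
proof -
  have *: "heat_kernel (a + 2 * v) y = 1 / sqrt (8 * pi) / sqrt (a / 2 + v) * exp (- (y\<^sup>2 / (8 * (a / 2 + v))))" for y
    using heat_kernel_alt[of "a / 2 + v" y] by simp
  show ?thesis
    unfolding kernel_gap_def * by (simp add: right_diff_distrib)
qed

lemma kernel_gap_0_eq:
  "kernel_gap a 0 v = 1 / sqrt (8 * pi) * (1 / sqrt (a + v) + 1 / sqrt v - 2 / sqrt (a / 2 + v))"
proof -
  have *: "a + 2 * v = 2 * (a / 2 + v)" by simp
  show ?thesis
    unfolding kernel_gap_def * heat_kernel_alt by (simp add: algebra_simps)
qed

lemma nn_integral_kernel_gap_0:
  assumes "0 \<le> a"
  shows "(\<integral>\<^sup>+v. ennreal (kernel_gap a 0 v) * indicator {0<..} v \<partial>lborel)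
    = ennreal (2 / sqrt (8 * pi) * (sqrt 2 - 1) * sqrt a)"
proof -
  define F where "F v = 2 / sqrt (8 * pi) * (sqrt (a + v) + sqrt v - 2 * sqrt (a / 2 + v))" for v
  have "(\<integral>\<^sup>+v. ennreal (kernel_gap a 0 v) * indicator {0<..} v \<partial>lborel)
     = ennreal (0 - 2 / sqrt (8 * pi) * (sqrt a - 2 * sqrt (a / 2)))"
  proof (rule nn_integral_FTC_greaterThan[where F = F])
    show "(F has_real_derivative kernel_gap a 0 x) (at x)" if "0 < x" for x
      using that assms unfolding F_def kernel_gap_0_eq
      by (auto intro!: derivative_eq_intros simp: field_simps)
    show "isCont (kernel_gap a 0) x" if "0 < x" for x
      using that assms unfolding kernel_gap_0_eq[abs_def]
      by (auto intro!: continuous_intros)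
    have "isCont F 0" unfolding F_def by (auto intro!: continuous_intros)
    then have "(F \<longlongrightarrow> F 0) (at_right 0)"
      by (simp add: isCont_def filterlim_at_split)
    then show "(F \<longlongrightarrow> 2 / sqrt (8 * pi) * (sqrt a - 2 * sqrt (a / 2))) (at_right 0)"
      by (simp add: F_def)
    \<comment> \<open>A second difference of the square root, so the divergent terms cancel at
      infinity.\<close>
    have "((\<lambda>v. sqrt (a + v) + sqrt v - 2 * sqrt (a / 2 + v)) \<longlongrightarrow> 0) at_top"
      by real_asymp
    from tendsto_mult_left[OF this, of "2 / sqrt (8 * pi)"] show "(F \<longlongrightarrow> 0) at_top"
      by (simp add: F_def[abs_def])
  qed (use assms kernel_gap_nonneg in auto)
  also have "0 - 2 / sqrt (8 * pi) * (sqrt a - 2 * sqrt (a / 2)) = 2 / sqrt (8 * pi) * (sqrt 2 - 1) * sqrt a"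
    by (simp add: real_sqrt_divide field_simps)
  finally show ?thesis .
qed

lemma nn_integral_heat_kernel_0:
  assumes "0 \<le> a"
  shows "(\<integral>\<^sup>+v. ennreal (heat_kernel (2 * v) 0) * indicator {0<..<a} v \<partial>lborel)
    = ennreal (2 / sqrt (8 * pi) * sqrt a)"
proof (cases "a = 0")
  case False
  define F where "F v = 2 / sqrt (8 * pi) * sqrt v" for v
  have cont: "isCont F v" for v unfolding F_def by (auto intro!: continuous_intros)
  have "(\<integral>\<^sup>+v. ennreal (heat_kernel (2 * v) 0) * indicator {0<..<a} v \<partial>lborel) = ennreal (F a - F 0)"
  proof (rule nn_integral_FTC_greaterThanLessThan[where F = F])
    show "(F has_real_derivative heat_kernel (2 * x) 0) (at x)" if "0 < x" for x
      using that unfolding F_def heat_kernel_alt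
      by (auto intro!: derivative_eq_intros simp: field_simps)
    show "isCont (\<lambda>v. heat_kernel (2 * v) 0) x" if "0 < x" for x
      using that unfolding heat_kernel_alt by (auto intro!: continuous_intros)
  qed (use assms False cont heat_kernel_nonneg in \<open>auto simp: isCont_def filterlim_at_split\<close>)
  then show ?thesis by (simp add: F_def)
qed simp

text \<open>The factors sqrt 2 - 1 and 1 of the two integrals add up to sqrt 2. The exact value is
  needed, not only its order: it gives the rescaled variables at the times t_n the same
  mean.\<close>

lemma gap_total_0:
  assumes "0 \<le> a" shows "gap_total a 0 = ennreal (sqrt (a / pi))"
proof -
  have "gap_total a 0 = ennreal (2 / sqrt (8 * pi) * (sqrt 2 - 1) * sqrt a + 2 / sqrt (8 * pi) * sqrt a)"
    unfolding gap_total_def nn_integral_kernel_gap_0[OF assms] nn_integral_heat_kernel_0[OF assms]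
    using assms by (subst ennreal_plus[symmetric]) auto
  also have "2 / sqrt (8 * pi) * (sqrt 2 - 1) * sqrt a + 2 / sqrt (8 * pi) * sqrt a = 2 * sqrt 2 / sqrt (8 * pi) * sqrt a"
    by (simp add: field_simps)
  also have "sqrt (8 * pi) = sqrt (2 * 2 * (2 * pi))" by simp
  also have "\<dots> = 2 * sqrt (2 * pi)" unfolding real_sqrt_mult[of "2 * 2"] by simp
  also have "2 * sqrt 2 / (2 * sqrt (2 * pi)) * sqrt a = sqrt (a / pi)"
    by (simp add: real_sqrt_mult real_sqrt_divide)
  finally show ?thesis .
qed

text \<open>A rational majorant, chosen because the integrand that results from it has an arctangent
  as antiderivative; \<open>one_minus_exp_ge\<close> shows that only a factor 2 is lost.\<close>

lemma one_minus_exp_le: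
  fixes y :: real assumes "0 \<le> y" shows "1 - exp (- y) \<le> 2 * y / (1 + y)"
proof -
  have "1 - y \<le> exp (- y)" using exp_ge_add_one_self[of "-y"] by simp
  moreover have "0 < exp (- y)" by simp
  moreover have "min 1 y \<le> 2 * y / (1 + y)"
    using assms by (auto simp: min_def field_simps mult_left_le)
  ultimately show ?thesis by linarith
qed

lemma one_minus_exp_ge:
  fixes y :: real assumes "0 \<le> y" shows "y / (1 + y) \<le> 1 - exp (- y)"
proof -
  have "1 + y \<le> exp y" by (rule exp_ge_add_one_self)
  then have "exp (- y) \<le> inverse (1 + y)" using assms by (simp add: exp_minus le_imp_inverse_le)
  then show ?thesis using assms by (simp add: field_simps)
qed

text \<open>The part without space lag is exactly sqrt (a / pi). In the other part a / 2 is dropped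
  from the denominators, and the integral of the rational majorant evaluates to |x| sqrt pi /
  2.\<close>

lemma gap_total_upper:
  assumes "0 \<le> a" shows "gap_total a x \<le> ennreal (sqrt a + \<bar>x\<bar>)"
proof -
  have "a / pi \<le> a / 1" using assms pi_gt3 by (intro divide_left_mono) auto
  then have sqrt_le: "sqrt (a / pi) \<le> sqrt a" by simp
  show ?thesis
  proof (cases "x = 0")
    case True
    then show ?thesis using sqrt_le assms by (simp add: gap_total_0 ennreal_leI)
  next
    case False
    define c X where "c = 1 / sqrt (8 * pi)" and "X = x\<^sup>2 / 8"
    have c: "c > 0" by (simp add: c_def)
    have X: "X > 0" using False by (simp add: X_def)
    define h where "h v = 4 * c * (X / ((v + X) * sqrt v))" for v
    define F where "F v = 8 * c * sqrt X * arctan (sqrt v / sqrt X)" for v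
    have [measurable]: "h \<in> borel_measurable borel" unfolding h_def by measurable
    have "kernel_gap a x v \<le> kernel_gap a 0 v + h v" if "0 < v" for v
    proof -
      \<comment> \<open>Both 1 / sqrt w and 1 - exp (- X / w) decrease in w, so w = a / 2 + v may be
        replaced by v.\<close>
      have "2 * c / sqrt (a / 2 + v) * (1 - exp (- (X / (a / 2 + v)))) \<le> 2 * c / sqrt v * (1 - exp (- (X / v)))"
        using that assms X c
        by (intro mult_mono divide_left_mono diff_left_mono) (auto simp: divide_left_mono)
      also have "\<dots> \<le> 2 * c / sqrt v * (2 * (X / v) / (1 + X / v))"
        using that X c by (intro mult_left_mono one_minus_exp_le) auto
      also have "\<dots> = h v" using that X by (simp add: h_def field_simps)
      finally show ?thesis using kernel_gap_decomp[of a x v] by (simp add: c_def X_def)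
    qed
    then have "(\<integral>\<^sup>+v. ennreal (kernel_gap a x v) * indicator {0<..} v \<partial>lborel)
        \<le> (\<integral>\<^sup>+v. ennreal (kernel_gap a 0 v) * indicator {0<..} v + ennreal (h v) * indicator {0<..} v \<partial>lborel)"
      using assms kernel_gap_nonneg X c
      by (intro nn_integral_mono) (auto split: split_indicator simp: ennreal_plus[symmetric] h_def intro!: ennreal_leI simp del: ennreal_plus)
    also have "\<dots> = (\<integral>\<^sup>+v. ennreal (kernel_gap a 0 v) * indicator {0<..} v \<partial>lborel) + (\<integral>\<^sup>+v. ennreal (h v) * indicator {0<..} v \<partial>lborel)"
      by (intro nn_integral_add) auto
    also have "(\<integral>\<^sup>+v. ennreal (h v) * indicator {0<..} v \<partial>lborel) = ennreal (8 * c * sqrt X * (pi / 2) - 0)"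
    proof (rule nn_integral_FTC_greaterThan[where F = F])
      show "(F has_real_derivative h v) (at v)" if "0 < v" for v
      proof -
        have "((\<lambda>v. sqrt v / sqrt X) has_real_derivative 1 / (2 * sqrt v) / sqrt X) (at v)"
          using that X by (auto intro!: derivative_eq_intros simp: field_simps)
        from DERIV_cmult[OF DERIV_chain2[OF DERIV_arctan this], of "8 * c * sqrt X"]
        have "(F has_real_derivative 8 * c * sqrt X * (inverse (1 + (sqrt v / sqrt X)\<^sup>2) * (1 / (2 * sqrt v) / sqrt X))) (at v)"
          unfolding F_def .
        also have "8 * c * sqrt X * (inverse (1 + (sqrt v / sqrt X)\<^sup>2) * (1 / (2 * sqrt v) / sqrt X)) = 4 * c * (1 / (1 + v / X)) / sqrt v"
          using that X by (simp add: power_divide inverse_eq_divide)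
        also have "\<dots> = h v" using that X by (simp add: h_def field_simps)
        finally show ?thesis .
      qed
      show "isCont h x" if "0 < x" for x
        using that X unfolding h_def by (auto intro!: continuous_intros)
      show "h x \<ge> 0" if "0 < x" for x
        using that X c unfolding h_def by simp
      have "isCont F 0" using X unfolding F_def by (auto intro!: continuous_intros)
      then have "(F \<longlongrightarrow> F 0) (at_right 0)"
        by (simp add: isCont_def filterlim_at_split)
      then show "(F \<longlongrightarrow> 0) (at_right 0)" by (simp add: F_def)
      have "filterlim (\<lambda>v. sqrt v / sqrt X) at_top at_top"
        using X by (intro filterlim_tendsto_pos_mult_at_top[OF tendsto_const _ sqrt_at_top, of "1 / sqrt X", simplified]) auto
      from filterlim_compose[OF tendsto_arctan_at_top this]
      show "(F \<longlongrightarrow> 8 * c * sqrt X * (pi / 2)) at_top" unfolding F_def by (intro tendsto_mult_left)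
    qed simp
    also have "8 * c * sqrt X * (pi / 2) - 0 \<le> \<bar>x\<bar>"
    proof -
      have "8 * c * sqrt X * (pi / 2) = 4 * \<bar>x\<bar> * pi / sqrt (8 * pi * 8)"
        by (simp add: c_def X_def real_sqrt_divide real_sqrt_mult)
      also have "8 * pi * 8 = 8\<^sup>2 * pi" by (simp add: power2_eq_square)
      also have "4 * \<bar>x\<bar> * pi / sqrt (8\<^sup>2 * pi) = \<bar>x\<bar> * (pi / (2 * sqrt pi))" by (simp add: real_sqrt_mult)
      also have "pi / (2 * sqrt pi) = sqrt pi / 2" by (simp add: field_simps)
      also have "sqrt pi \<le> sqrt (2\<^sup>2)" using pi_less_4 by (subst real_sqrt_le_iff) auto
      hence "\<bar>x\<bar> * (sqrt pi / 2) \<le> \<bar>x\<bar> * 1" by (intro mult_left_mono) auto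
      finally show ?thesis by simp
    qed
    finally have "gap_total a x \<le> gap_total a 0 + ennreal \<bar>x\<bar>"
      unfolding gap_total_def by (simp add: ennreal_leI add_mono ac_simps add_left_mono)
    also have "gap_total a 0 \<le> ennreal (sqrt a)"
      using assms sqrt_le by (simp only: gap_total_0 ennreal_leI)
    finally show ?thesis using assms by (simp add: add_mono)
  qed
qed

text \<open>If x^2 \<le> a, the recent noise alone gives a multiple of sqrt a. Otherwise the space
  part of the kernel gap is at least a multiple of 1 / |x| for v < x^2 / 2, an interval long enough
  to give a multiple of |x|.\<close>

lemma gap_total_lower:
  assumes "0 \<le> a" shows "ennreal ((sqrt a + \<bar>x\<bar>) / 100) \<le> gap_total a x"
proof (cases "x\<^sup>2 \<le> a")
  case True
  then have "\<bar>x\<bar> \<le> sqrt a" by (simp add: real_le_rsqrt)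
  have "sqrt (8 * pi) \<le> sqrt (8\<^sup>2)" using pi_less_4 by (subst real_sqrt_le_iff) (auto simp: power2_eq_square)
  then have "1 / 50 \<le> 2 / sqrt (8 * pi)" by (simp add: field_simps)
  from mult_right_mono[OF this, of "sqrt a"] \<open>\<bar>x\<bar> \<le> sqrt a\<close> assms
  have "(sqrt a + \<bar>x\<bar>) / 100 \<le> 2 / sqrt (8 * pi) * sqrt a" by simp
  then have "ennreal ((sqrt a + \<bar>x\<bar>) / 100) \<le> ennreal (2 / sqrt (8 * pi) * sqrt a)" by (rule ennreal_leI)
  also have "\<dots> \<le> gap_total a x" unfolding gap_total_def nn_integral_heat_kernel_0[OF assms] by simp
  finally show ?thesis .
next
  case False
  then have x: "\<bar>x\<bar> > 0" "a < x\<^sup>2" using assms by auto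
  then have sx: "sqrt a \<le> \<bar>x\<bar>" by (metis less_eq_real_def real_sqrt_abs real_sqrt_less_mono)
  \<comment> \<open>The value 5.5 is small enough for 9 * sqrt (8 * pi) \<le> 50.\<close>
  have s8: "sqrt (8 * pi) \<le> 5.5" using pi_less_4 pi_approx by (intro real_le_lsqrt) (auto simp: power2_eq_square)
  define K where "K = 2 / sqrt (8 * pi) / \<bar>x\<bar> * (1 / 9)"
  have K: "K > 0" using x by (simp add: K_def)
  have kg: "K \<le> kernel_gap a x v" if v: "0 < v" "v < x\<^sup>2 / 2" for v
  proof -
    define w where "w = a / 2 + v"
    have w: "0 < w" "w \<le> x\<^sup>2" using v x assms by (auto simp: w_def)
    \<comment> \<open>Since w \<le> x^2, the exponent x^2 / (8 w) is at least 1/8; this is the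
      origin of the factor 1/9 in \<open>K\<close>.\<close>
    have "(1/8) / (1 + 1/8) \<le> 1 - exp (- (1/8::real))" by (rule one_minus_exp_ge) simp
    also have "\<dots> \<le> 1 - exp (- (x\<^sup>2 / (8 * w)))" using w by (simp add: field_simps)
    finally have 1: "1 / 9 \<le> 1 - exp (- (x\<^sup>2 / (8 * w)))" by simp
    have "sqrt w \<le> \<bar>x\<bar>" using w by (metis real_sqrt_abs real_sqrt_le_mono)
    then have "K \<le> 2 / sqrt (8 * pi) / sqrt w * (1 - exp (- (x\<^sup>2 / (8 * w))))"
      unfolding K_def using 1 w x by (intro mult_mono divide_left_mono) auto
    then show ?thesis
      using kernel_gap_decomp[of a x v] kernel_gap_nonneg[of v a 0] v assms by (simp add: w_def)
  qed
  have "(sqrt a + \<bar>x\<bar>) / 100 \<le> \<bar>x\<bar> / 50" using sx by simp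
  also have "\<bar>x\<bar> / 50 \<le> \<bar>x\<bar> * (1 / (9 * sqrt (8 * pi)))"
  proof -
    have "1 / 50 \<le> 1 / (9 * sqrt (8 * pi))" using s8 by (intro divide_left_mono) auto
    from mult_left_mono[OF this, of "\<bar>x\<bar>"] show ?thesis by simp
  qed
  also have "\<dots> = K * (x\<^sup>2 / 2)"
    unfolding K_def power2_abs[of x, symmetric] using x by (simp add: power2_eq_square field_simps)
  finally have "ennreal ((sqrt a + \<bar>x\<bar>) / 100) \<le> ennreal (K * (x\<^sup>2 / 2))" by (rule ennreal_leI)
  also have "\<dots> = (\<integral>\<^sup>+v. ennreal K * indicator {0<..<x\<^sup>2 / 2} v \<partial>lborel)"
    using K by (subst nn_integral_cmult_indicator) (auto simp flip: ennreal_mult)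
  also have "\<dots> \<le> (\<integral>\<^sup>+v. ennreal (kernel_gap a x v) * indicator {0<..} v \<partial>lborel)"
    using kg by (intro nn_integral_mono) (auto split: split_indicator intro!: ennreal_leI)
  also have "\<dots> \<le> gap_total a x" unfolding gap_total_def by simp
  finally show ?thesis .
qed

section \<open>Gaussian variables and white noise\<close>

lemma integrable_mult_of_squares:
  fixes f g :: "'a \<Rightarrow> real"
  assumes [measurable]: "f \<in> borel_measurable M" "g \<in> borel_measurable M"
    and "integrable M (\<lambda>x. (f x)\<^sup>2)" "integrable M (\<lambda>x. (g x)\<^sup>2)"
  shows "integrable M (\<lambda>x. f x * g x)"
proof (rule Bochner_Integration.integrable_bound)
  show "integrable M (\<lambda>x. (f x)\<^sup>2 + (g x)\<^sup>2)" using assms by simp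
  have "\<bar>a * b\<bar> \<le> a\<^sup>2 + b\<^sup>2" for a b :: real
    using sum_squares_bound[of "\<bar>a\<bar>" "\<bar>b\<bar>"] by (auto simp: abs_mult zero_le_mult_iff intro: order_trans[rotated])
  then show "AE x in M. norm (f x * g x) \<le> norm ((f x)\<^sup>2 + (g x)\<^sup>2)"
    by auto
qed measurable

context prob_space
begin

text \<open>Replaces the density by an image of the standard normal law, whose moments and
  characteristic function are known; the point mass has to be kept apart.\<close>

lemma centered_gaussian_cases:
  assumes "centered_gaussian M X"
  obtains "AE \<omega> in M. X \<omega> = 0" | \<sigma> where "\<sigma> > 0" "distr M borel X = distr std_normal_distribution borel (\<lambda>x. \<sigma> * x)"
proof -
  have [measurable]: "X \<in> borel_measurable M" using assms by (simp add: centered_gaussian_def)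
  have "distr M borel X = distr std_normal_distribution borel (\<lambda>x. \<sigma> * x)"
    if \<sigma>: "\<sigma> > 0" and d: "distributed M lborel X (normal_density 0 \<sigma>)" for \<sigma>
  proof -
    have "distributed M lborel (\<lambda>\<omega>. (X \<omega> - 0) / \<sigma>) std_normal_density"
      using normal_standard_normal_convert[OF \<sigma>] d by blast
    then have eq: "density lborel std_normal_density = distr M lborel (\<lambda>\<omega>. (X \<omega> - 0) / \<sigma>)"
      by (rule distributed_distr_eq_density[symmetric])
    have "distr M borel X = distr M borel ((\<lambda>x. \<sigma> * x) \<circ> (\<lambda>\<omega>. (X \<omega> - 0) / \<sigma>))"
      using \<sigma> by (intro distr_cong) auto
    also have "\<dots> = distr (distr M lborel (\<lambda>\<omega>. (X \<omega> - 0) / \<sigma>)) borel (\<lambda>x. \<sigma> * x)"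
      by (intro distr_distr[symmetric]) auto
    finally show ?thesis by (simp add: eq)
  qed
  then show ?thesis using that assms unfolding centered_gaussian_def by blast
qed

text \<open>Everything is expressed by the variance, so that the degenerate law, with variance 0,
  obeys the same formulas.\<close>

lemma centered_gaussian_even_moment:
  assumes "centered_gaussian M X"
  shows "integrable M (\<lambda>\<omega>. X \<omega> ^ (2 * k))" (is ?int)
    and "(LINT \<omega>|M. X \<omega> ^ (2 * k)) = fact (2 * k) / (2 ^ k * fact k) * (LINT \<omega>|M. (X \<omega>)\<^sup>2) ^ k" (is ?eq)
    and "char (distr M borel X) t = exp (- (LINT \<omega>|M. (X \<omega>)\<^sup>2) * t\<^sup>2 / 2)" (is ?char)
proof -
  have [measurable]: "X \<in> borel_measurable M" using assms by (simp add: centered_gaussian_def)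
  have "?int \<and> ?eq \<and> ?char"
    using assms
  proof (cases rule: centered_gaussian_cases)
    case 1
    have eq: "AE \<omega> in M. X \<omega> ^ j = (if j = 0 then 1 else 0)" for j
      using 1 by eventually_elim auto
    have 2: "integrable M (\<lambda>\<omega>. X \<omega> ^ j)" "(LINT \<omega>|M. X \<omega> ^ j) = (if j = 0 then 1 else 0)" for j
      using integrable_cong_AE[OF _ _ eq[of j]] integral_cong_AE[OF _ _ eq[of j]] by (auto simp: prob_space)
    have "char (distr M borel X) t = (CLINT \<omega>|M. iexp (t * X \<omega>))"
      unfolding char_def by (subst integral_distr) auto
    also have "\<dots> = (CLINT \<omega>|M. 1)"
      using 1 by (intro integral_cong_AE) auto
    finally have "char (distr M borel X) t = 1" by (simp add: prob_space)
    then show ?thesis using 2 by (auto simp: power_0_left)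
  next
    case (2 \<sigma>)
    let ?S = "std_normal_distribution"
    have int: "integrable M (\<lambda>\<omega>. X \<omega> ^ j)" for j
    proof -
      have "integrable (distr M borel X) (\<lambda>x. x ^ j)"
        unfolding 2(2) by (subst integrable_distr_eq) (auto simp: power_mult_distrib intro!: integrable_std_normal_distribution_moment)
      then show ?thesis by (subst (asm) integrable_distr_eq) auto
    qed
    have mom: "(LINT \<omega>|M. X \<omega> ^ (2 * j)) = fact (2 * j) / (2 ^ j * fact j) * \<sigma> ^ (2 * j)" for j
    proof -
      have "(LINT \<omega>|M. X \<omega> ^ (2 * j)) = (LINT x|distr M borel X. x ^ (2 * j))"
        by (subst integral_distr) auto
      also have "\<dots> = \<sigma> ^ (2 * j) * (LINT x|?S. x ^ (2 * j))"
        unfolding 2(2) by (subst integral_distr) (auto simp: power_mult_distrib)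
      finally show ?thesis using std_normal_distribution_even_moments[of j] by (simp add: mult_ac)
    qed
    have var: "(LINT \<omega>|M. (X \<omega>)\<^sup>2) = \<sigma>\<^sup>2"
      using mom[of 1] by (simp add: fact_2)
    have "char (distr M borel X) t = char ?S (t * \<sigma>)"
      unfolding char_def 2(2) by (subst integral_distr) (auto simp: mult_ac)
    also have "\<dots> = exp (- (LINT \<omega>|M. (X \<omega>)\<^sup>2) * t\<^sup>2 / 2)"
      by (simp add: char_std_normal_distribution var power_mult_distrib mult_ac)
    finally have ?char .
    moreover have ?eq using mom[of k] by (simp only: var power_mult[of \<sigma> 2 k])
    ultimately show ?thesis using int[of "2 * k"] by blast
  qed
  then show ?int ?eq ?char by auto
qed

text \<open>Markov's inequality for the moment of order 2 k. The order stays free, because the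
  chaining later needs a high one.\<close>

lemma centered_gaussian_tail:
  assumes X: "centered_gaussian M X" and "l > 0"
  shows "prob {\<omega> \<in> space M. l \<le> \<bar>X \<omega>\<bar>} \<le> fact (2 * k) / (2 ^ k * fact k) * ((LINT \<omega>|M. (X \<omega>)\<^sup>2) / l\<^sup>2) ^ k"
proof -
  have [measurable]: "X \<in> borel_measurable M" using X by (simp add: centered_gaussian_def)
  have "prob {\<omega> \<in> space M. l \<le> \<bar>X \<omega>\<bar>} \<le> prob {\<omega> \<in> space M. l ^ (2 * k) \<le> X \<omega> ^ (2 * k)}"
  proof (intro finite_measure_mono subsetI CollectI conjI)
    fix \<omega> assume "\<omega> \<in> {\<omega> \<in> space M. l \<le> \<bar>X \<omega>\<bar>}"
    then have "l ^ (2 * k) \<le> \<bar>X \<omega>\<bar> ^ (2 * k)" using assms by (intro power_mono) auto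
    then show "l ^ (2 * k) \<le> X \<omega> ^ (2 * k)" by (simp add: power_even_abs)
  qed auto
  also have "\<dots> \<le> (LINT \<omega>|M. X \<omega> ^ (2 * k)) / l ^ (2 * k)"
    using assms centered_gaussian_even_moment(1)[OF X]
    by (intro integral_Markov_inequality_measure[where A = "space M"]) auto
  finally show ?thesis
    unfolding centered_gaussian_even_moment(2)[OF X] by (simp add: power_divide power_mult)
qed

end

definition hp_inner :: "(real \<times> real \<Rightarrow> real) \<Rightarrow> (real \<times> real \<Rightarrow> real) \<Rightarrow> real" where
  "hp_inner f g = (LINT p:half_plane|lborel. f p * g p)"

lemma hp_inner_commute: "hp_inner f g = hp_inner g f"
  by (simp add: hp_inner_def mult.commute)

text \<open>Only the truncation to the half plane is known to be measurable, so all integrals are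
  treated through the truncated function.\<close>

lemma L2_half_plane_iff:
  "f \<in> L2_half_plane \<longleftrightarrow> (\<lambda>p. indicator half_plane p * f p) \<in> borel_measurable lborel \<and>
     integrable lborel (\<lambda>p. (indicator half_plane p * f p)\<^sup>2)"
proof -
  have "(\<lambda>p. (indicator half_plane p * f p)\<^sup>2) = (\<lambda>p. indicator half_plane p *\<^sub>R (f p)\<^sup>2)"
    by (auto split: split_indicator)
  then show ?thesis
    by (simp add: L2_half_plane_def set_borel_measurable_def set_integrable_def)
qed

lemma set_integrable_L2_mult:
  assumes "f \<in> L2_half_plane" "g \<in> L2_half_plane"
  shows "set_integrable lborel half_plane (\<lambda>p. f p * g p)"
proof -
  have "(\<lambda>p. indicator half_plane p *\<^sub>R (f p * g p)) = (\<lambda>p. (indicator half_plane p * f p) * (indicator half_plane p * g p))"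
    by (auto split: split_indicator)
  moreover have "integrable lborel (\<lambda>p. (indicator half_plane p * f p) * (indicator half_plane p * g p))"
    using assms unfolding L2_half_plane_iff by (intro integrable_mult_of_squares) auto
  ultimately show ?thesis unfolding set_integrable_def by simp
qed

lemma L2_half_plane_lin:
  assumes "f \<in> L2_half_plane" "g \<in> L2_half_plane"
  shows "(\<lambda>p. a * f p + b * g p) \<in> L2_half_plane"
proof -
  have eq: "(\<lambda>p. indicator half_plane p * (a * f p + b * g p)) = (\<lambda>p. a * (indicator half_plane p * f p) + b * (indicator half_plane p * g p))"
    by (auto split: split_indicator)
  have eq2: "(\<lambda>p. (indicator half_plane p * (a * f p + b * g p))\<^sup>2) = (\<lambda>p. a\<^sup>2 * (indicator half_plane p * f p)\<^sup>2 + 2 * a * b * ((indicator half_plane p * f p) * (indicator half_plane p * g p)) + b\<^sup>2 * (indicator half_plane p * g p)\<^sup>2)"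
    by (auto split: split_indicator simp: power2_eq_square algebra_simps)
  have 1: "integrable lborel (\<lambda>p. (indicator half_plane p * f p) * (indicator half_plane p * g p))"
    using assms unfolding L2_half_plane_iff by (intro integrable_mult_of_squares) auto
  note fg = assms[unfolded L2_half_plane_iff]
  have "integrable lborel (\<lambda>p. (indicator half_plane p * (a * f p + b * g p))\<^sup>2)"
    unfolding eq2 by (intro Bochner_Integration.integrable_add integrable_mult_right 1 fg[THEN conjunct2])
  moreover have "(\<lambda>p. indicator half_plane p * (a * f p + b * g p)) \<in> borel_measurable lborel"
    unfolding eq by (intro borel_measurable_add borel_measurable_times borel_measurable_const fg[THEN conjunct1])
  ultimately show ?thesis unfolding L2_half_plane_iff by (intro conjI)
qed

lemma zero_in_L2_half_plane [simp]: "(\<lambda>_. 0) \<in> L2_half_plane"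
  by (simp add: L2_half_plane_iff)

lemma hp_inner_lin:
  assumes "f \<in> L2_half_plane" "g \<in> L2_half_plane" "h \<in> L2_half_plane"
  shows "hp_inner (\<lambda>p. a * f p + b * g p) h = a * hp_inner f h + b * hp_inner g h"
proof -
  have "hp_inner (\<lambda>p. a * f p + b * g p) h = (LINT p:half_plane|lborel. a * (f p * h p) + b * (g p * h p))"
    unfolding hp_inner_def by (simp add: algebra_simps)
  also have "\<dots> = a * hp_inner f h + b * hp_inner g h"
    unfolding hp_inner_def using assms
    by (subst set_integral_add) (auto intro!: set_integrable_mult_right set_integrable_L2_mult)
  finally show ?thesis .
qed

lemma hp_inner_lin_self:
  assumes "f \<in> L2_half_plane" "g \<in> L2_half_plane"
  shows "hp_inner (\<lambda>p. a * f p + b * g p) (\<lambda>p. a * f p + b * g p)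
    = a\<^sup>2 * hp_inner f f + 2 * a * b * hp_inner f g + b\<^sup>2 * hp_inner g g"
proof -
  have h: "(\<lambda>p. a * f p + b * g p) \<in> L2_half_plane" by (intro L2_half_plane_lin assms)
  have "hp_inner (\<lambda>p. a * f p + b * g p) (\<lambda>p. a * f p + b * g p)
    = a * hp_inner (\<lambda>p. a * f p + b * g p) f + b * hp_inner (\<lambda>p. a * f p + b * g p) g"
    using assms h by (subst hp_inner_lin) (auto simp: hp_inner_commute)
  also have "\<dots> = a * (a * hp_inner f f + b * hp_inner g f) + b * (a * hp_inner f g + b * hp_inner g g)"
    using assms by (simp only: hp_inner_lin)
  finally show ?thesis
    by (simp add: hp_inner_commute[of g f] power2_eq_square algebra_simps)
qed

lemma hp_inner_self_nonneg: "0 \<le> hp_inner f f"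
  unfolding hp_inner_def set_lebesgue_integral_def by (intro integral_nonneg_AE) auto

text \<open>One real-valued component on its own; it is instantiated below for every component of
  both noises.\<close>

locale gaussian_noise = prob_space M for M :: "'w measure" +
  fixes W :: "'w noise"
  assumes white: "white_noise M W"
begin

lemma noise_gaussian:
  assumes "f \<in> L2_half_plane" shows "centered_gaussian M (W f)"
proof -
  have "centered_gaussian M (\<lambda>\<omega>. \<Sum>j\<in>{f}. (\<lambda>_. 1) j * W j \<omega>)"
    using white[unfolded white_noise_def centered_gaussian_family_def, THEN conjunct1, rule_format, of "{f}" "\<lambda>_. 1"] assms
    by simp
  then show ?thesis by simp
qed

lemma noise_measurable [measurable (raw)]: "f \<in> L2_half_plane \<Longrightarrow> W f \<in> borel_measurable M"
  using noise_gaussian by (auto simp: centered_gaussian_def)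

lemma noise_cov: "f \<in> L2_half_plane \<Longrightarrow> g \<in> L2_half_plane \<Longrightarrow> (LINT \<omega>|M. W f \<omega> * W g \<omega>) = hp_inner f g"
  using white by (simp add: white_noise_def hp_inner_def)

lemma noise_var: "f \<in> L2_half_plane \<Longrightarrow> (LINT \<omega>|M. (W f \<omega>)\<^sup>2) = hp_inner f f"
  using noise_cov[of f f] by (simp add: power2_eq_square)

lemma noise_square_integrable: "f \<in> L2_half_plane \<Longrightarrow> integrable M (\<lambda>\<omega>. (W f \<omega>)\<^sup>2)"
  by (drule centered_gaussian_even_moment(1)[OF noise_gaussian, of _ 1]) simp

lemma noise_mult_integrable:
  "f \<in> L2_half_plane \<Longrightarrow> g \<in> L2_half_plane \<Longrightarrow> integrable M (\<lambda>\<omega>. W f \<omega> * W g \<omega>)"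
  by (intro integrable_mult_of_squares noise_square_integrable noise_measurable)

lemma noise_char:
  assumes "f \<in> L2_half_plane"
  shows "char (distr M borel (W f)) t = exp (- hp_inner f f * t\<^sup>2 / 2)"
  unfolding centered_gaussian_even_moment(3)[OF noise_gaussian[OF assms]] noise_var[OF assms] ..

lemma noise_tail:
  assumes "f \<in> L2_half_plane" "l > 0"
  shows "prob {\<omega> \<in> space M. l \<le> \<bar>W f \<omega>\<bar>} \<le> fact (2 * k) / (2 ^ k * fact k) * (hp_inner f f / l\<^sup>2) ^ k"
  using centered_gaussian_tail[OF noise_gaussian[OF assms(1)] assms(2)] unfolding noise_var[OF assms(1)] .

text \<open>Linearity is no part of the definition of white noise. It follows from the covariance:
  the second moment of the difference of the two sides expands to 0.\<close>

lemma noise_lin: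
  assumes [simp]: "f \<in> L2_half_plane" "g \<in> L2_half_plane"
  shows "AE \<omega> in M. W (\<lambda>p. a * f p + b * g p) \<omega> = a * W f \<omega> + b * W g \<omega>"
proof -
  define h where "h = (\<lambda>p. a * f p + b * g p)"
  have h [simp]: "h \<in> L2_half_plane" unfolding h_def by (intro L2_half_plane_lin assms)
  note [simp] = noise_mult_integrable
  let ?D = "\<lambda>\<omega>. W h \<omega> - a * W f \<omega> - b * W g \<omega>"
  have sq: "(?D \<omega>)\<^sup>2 = W h \<omega> * W h \<omega> + a\<^sup>2 * (W f \<omega> * W f \<omega>) + b\<^sup>2 * (W g \<omega> * W g \<omega>)
       - 2 * a * (W h \<omega> * W f \<omega>) - 2 * b * (W h \<omega> * W g \<omega>) + 2 * a * b * (W f \<omega> * W g \<omega>)" for \<omega>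
    by (simp add: power2_eq_square algebra_simps)
  have int: "integrable M (\<lambda>\<omega>. (?D \<omega>)\<^sup>2)"
    unfolding sq by simp
  have "(LINT \<omega>|M. (?D \<omega>)\<^sup>2) = hp_inner h h + a\<^sup>2 * hp_inner f f + b\<^sup>2 * hp_inner g g - 2 * a * hp_inner h f - 2 * b * hp_inner h g + 2 * a * b * hp_inner f g"
    unfolding sq by (simp add: noise_cov)
  also have "\<dots> = 0"
    unfolding h_def
    by (simp add: hp_inner_lin hp_inner_lin_self hp_inner_commute[of g f] power2_eq_square algebra_simps)
  finally have "AE \<omega> in M. (?D \<omega>)\<^sup>2 = 0"
    using integral_nonneg_eq_0_iff_AE[OF int] by simp
  then show ?thesis unfolding h_def[symmetric] by eventually_elim simp
qed

end

section \<open>Gaussian expectations by Fourier inversion\<close>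

lemma prob_space_gauss: "prob_space std_normal_distribution"
  using real_dist_normal_dist by (simp add: real_distribution_def)

lemma (in prob_space) integral_cos_char:
  assumes [measurable]: "X \<in> borel_measurable M"
  shows "(LINT \<omega>|M. cos (a * X \<omega>)) = Re (char (distr M borel X) a)"
proof -
  have "char (distr M borel X) a = (CLINT \<omega>|M. iexp (a * X \<omega>))"
    unfolding char_def by (subst integral_distr) auto
  also have "Re \<dots> = (LINT \<omega>|M. Re (iexp (a * X \<omega>)))"
    by (rule integral_Re[symmetric], rule integrable_iexp) auto
  finally show ?thesis by (simp add: Re_exp)
qed

text \<open>The normal density is, up to scaling, its own Fourier transform. The square in the
  exponent becomes linear inside a cosine, so for random x a characteristic function is all that has
  to be known.\<close>

lemma exp_sq_eq_integral_cos:
  assumes "0 \<le> l"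
  shows "exp (- (l * x\<^sup>2 / 2)) = (LINT \<xi>|std_normal_distribution. cos (sqrt l * x * \<xi>))"
proof -
  interpret N: prob_space std_normal_distribution by (rule prob_space_gauss)
  have "(LINT \<xi>|std_normal_distribution. cos (sqrt l * x * \<xi>)) = Re (char (distr std_normal_distribution borel (\<lambda>x. x)) (sqrt l * x))"
    by (rule N.integral_cos_char) simp
  also have "distr std_normal_distribution borel (\<lambda>x. x) = std_normal_distribution"
    by (rule distr_id2) simp
  finally show ?thesis
    using assms by (simp add: char_std_normal_distribution power_mult_distrib Re_exp flip: of_real_exp)
qed

text \<open>The exponents add up to that of a normal density of variance 1 / (1 + u), and the
  quotient of the normalizations is 1 / sqrt (1 + u).\<close>

lemma integral_gauss_exp_sq:
  assumes "0 \<le> u"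
  shows "(LINT \<xi>|std_normal_distribution. exp (- (u * \<xi>\<^sup>2 / 2))) = 1 / sqrt (1 + u)"
proof -
  have pw: "std_normal_density \<xi> * exp (- (u * \<xi>\<^sup>2 / 2)) = 1 / sqrt (1 + u) * normal_density 0 (1 / sqrt (1 + u)) \<xi>" for \<xi>
  proof -
    have "- \<xi>\<^sup>2 / 2 + - (u * \<xi>\<^sup>2 / 2) = - (\<xi> - 0)\<^sup>2 / (2 * (1 / sqrt (1 + u))\<^sup>2)"
      using assms by (simp add: power_divide field_simps)
    moreover have "1 / sqrt (2 * pi) = 1 / sqrt (1 + u) * (1 / sqrt (2 * pi * (1 / sqrt (1 + u))\<^sup>2))"
      using assms by (simp add: power_divide real_sqrt_divide)
    moreover have "std_normal_density \<xi> * exp (- (u * \<xi>\<^sup>2 / 2)) = 1 / sqrt (2 * pi) * exp (- \<xi>\<^sup>2 / 2 + - (u * \<xi>\<^sup>2 / 2))"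
      by (simp add: std_normal_density_def flip: exp_add)
    ultimately show ?thesis
      unfolding normal_density_def[of 0 "1 / sqrt (1 + u)"] by (simp only: mult.assoc)
  qed
  have "(LINT \<xi>|std_normal_distribution. exp (- (u * \<xi>\<^sup>2 / 2))) = (LINT \<xi>|lborel. std_normal_density \<xi> * exp (- (u * \<xi>\<^sup>2 / 2)))"
    by (subst integral_density) auto
  also have "\<dots> = 1 / sqrt (1 + u)"
    unfolding pw using assms by simp
  finally show ?thesis .
qed

lemma integral_gauss_abs_le: "integrable std_normal_distribution (\<lambda>x. \<bar>x\<bar>)" "(LINT \<xi>|std_normal_distribution. \<bar>\<xi>\<bar>) \<le> 1"
proof -
  interpret N: prob_space std_normal_distribution by (rule prob_space_gauss)
  show 1: "integrable std_normal_distribution (\<lambda>x. \<bar>x\<bar>)"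
    using integrable_std_normal_distribution_moment[of 1] by simp
  have 2: "integrable std_normal_distribution (\<lambda>x. x\<^sup>2)"
    by (rule integrable_std_normal_distribution_moment)
  have "2 * \<bar>x\<bar> \<le> 1 + x\<^sup>2" for x :: real
    using sum_squares_bound[of 1 "\<bar>x\<bar>"] by simp
  then have "\<bar>x\<bar> \<le> (1 + x\<^sup>2) / 2" for x :: real
    by (simp add: field_simps)
  then have "(LINT \<xi>|std_normal_distribution. \<bar>\<xi>\<bar>) \<le> (LINT \<xi>|std_normal_distribution. (1 + \<xi>\<^sup>2) / 2)"
    using 1 2 by (intro integral_mono) auto
  also have "\<dots> = (1 + 1) / 2"
    using 2 std_normal_distribution_even_moments[of 1] N.prob_space by (simp add: fact_2)
  finally show "(LINT \<xi>|std_normal_distribution. \<bar>\<xi>\<bar>) \<le> 1" by simp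
qed

context prob_space
begin

lemma integral_cos_gaussian:
  assumes "X \<in> borel_measurable M" "char (distr M borel X) a = exp (- v * a\<^sup>2 / 2)"
  shows "(LINT \<omega>|M. cos (a * X \<omega>)) = exp (- v * a\<^sup>2 / 2)"
  using assms by (simp add: integral_cos_char Re_exp flip: of_real_exp)

lemma swap_gauss_integral:
  fixes f :: "'a \<Rightarrow> real \<Rightarrow> real"
  assumes [measurable]: "case_prod f \<in> borel_measurable (M \<Otimes>\<^sub>M std_normal_distribution)" and "\<And>\<omega> \<xi>. \<bar>f \<omega> \<xi>\<bar> \<le> 1"
  shows "(LINT \<omega>|M. LINT \<xi>|std_normal_distribution. f \<omega> \<xi>) = (LINT \<xi>|std_normal_distribution. LINT \<omega>|M. f \<omega> \<xi>)"
proof -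
  interpret N: prob_space std_normal_distribution by (rule prob_space_gauss)
  interpret P: pair_prob_space M std_normal_distribution by unfold_locales
  have "integrable (M \<Otimes>\<^sub>M std_normal_distribution) (case_prod f)"
    using assms by (intro P.integrable_const_bound[where B = 1]) auto
  then show ?thesis by (rule P.Fubini_integral[symmetric])
qed

text \<open>Inserting the cosine representation and exchanging the integrals leaves a Gaussian
  integral with u = l v. Only the characteristic function of X is used, which also covers v =
  0.\<close>

lemma integral_exp_sq_gaussian:
  assumes [measurable]: "X \<in> borel_measurable M" and ch: "\<And>t. char (distr M borel X) t = exp (- v * t\<^sup>2 / 2)"
    and "0 \<le> l" "0 \<le> v"
  shows "(LINT \<omega>|M. exp (- (l * (X \<omega>)\<^sup>2 / 2))) = 1 / sqrt (1 + l * v)"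
proof -
  have "(LINT \<omega>|M. exp (- (l * (X \<omega>)\<^sup>2 / 2))) = (LINT \<omega>|M. LINT \<xi>|std_normal_distribution. cos (sqrt l * X \<omega> * \<xi>))"
    using assms by (simp only: exp_sq_eq_integral_cos)
  also have "\<dots> = (LINT \<xi>|std_normal_distribution. LINT \<omega>|M. cos (sqrt l * X \<omega> * \<xi>))"
    by (intro swap_gauss_integral) auto
  also have "\<dots> = (LINT \<xi>|std_normal_distribution. exp (- ((l * v) * \<xi>\<^sup>2 / 2)))"
  proof (intro Bochner_Integration.integral_cong refl)
    fix \<xi>
    show "(LINT \<omega>|M. cos (sqrt l * X \<omega> * \<xi>)) = exp (- ((l * v) * \<xi>\<^sup>2 / 2))"
      using integral_cos_gaussian[of X "sqrt l * \<xi>" v] ch assms by (simp add: mult_ac power_mult_distrib)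
  qed
  also have "\<dots> = 1 / sqrt (1 + l * v)"
    using assms by (intro integral_gauss_exp_sq) simp
  finally show ?thesis .
qed

lemma abs_exp_diff_le:
  fixes a b :: real assumes "0 \<le> a" "0 \<le> b" shows "\<bar>exp (- a) - exp (- b)\<bar> \<le> \<bar>a - b\<bar>"
proof -
  have *: "exp (- a) - exp (- b) \<le> b - a" if "0 \<le> a" "a \<le> b" for a b :: real
  proof -
    have "exp (- a) - exp (- b) = exp (- a) * (1 - exp (- (b - a)))"
      by (simp add: algebra_simps flip: exp_add)
    also have "\<dots> \<le> 1 * (b - a)"
    proof (intro mult_mono)
      show "1 - exp (- (b - a)) \<le> b - a" using exp_ge_add_one_self[of "- (b - a)"] by linarith
    qed (use that in auto)
    finally show ?thesis by simp
  qed
  show ?thesis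
    using *[of a b] *[of b a] assms by (cases "a \<le> b") auto
qed

text \<open>Two cosine representations turn the mixed expectation into a Gaussian double integral of
  \<open>J\<close>, in which c occurs only in the cross terms. For c = 0 the integral is the product
  of the two means, so the error is controlled by the Lipschitz dependence on c, integrated against
  |\<xi>| |\<zeta>|.\<close>

lemma covariance_exp_sq_gaussian:
  assumes [measurable]: "X \<in> borel_measurable M" "Y \<in> borel_measurable M"
    and ch: "\<And>a b. char (distr M borel (\<lambda>\<omega>. a * X \<omega> + b * Y \<omega>)) 1 = exp (- (a\<^sup>2 * v + 2 * a * b * c + b\<^sup>2 * w) / 2)"
    and nonneg: "\<And>a b. 0 \<le> a\<^sup>2 * v + 2 * a * b * c + b\<^sup>2 * w"
    and l: "0 \<le> l" "0 \<le> m"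
  shows "\<bar>(LINT \<omega>|M. exp (- (l * (X \<omega>)\<^sup>2 / 2)) * exp (- (m * (Y \<omega>)\<^sup>2 / 2)))
      - 1 / sqrt (1 + l * v) * (1 / sqrt (1 + m * w))\<bar> \<le> sqrt l * sqrt m * \<bar>c\<bar>"
proof -
  let ?N = std_normal_distribution
  interpret N: prob_space ?N by (rule prob_space_gauss)
  have vw: "0 \<le> v" "0 \<le> w" using nonneg[of 1 0] nonneg[of 0 1] by auto
  \<comment> \<open>A product of two cosines is the mean of the cosines of sum and difference;
    \<open>ch\<close> gives the expectation of each.\<close>
  define J where "J \<xi> \<zeta> = (exp (- ((l * v * \<xi>\<^sup>2 + 2 * (sqrt l * sqrt m) * \<xi> * \<zeta> * c + m * w * \<zeta>\<^sup>2) / 2))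
        + exp (- ((l * v * \<xi>\<^sup>2 - 2 * (sqrt l * sqrt m) * \<xi> * \<zeta> * c + m * w * \<zeta>\<^sup>2) / 2))) / 2" for \<xi> \<zeta>
  \<comment> \<open>The exponents in \<open>J\<close> are values of the covariance form, hence
    nonnegative; on that range exp (- _) is 1-Lipschitz, which yields \<open>JP\<close>.\<close>
  have nn: "0 \<le> l * v * \<xi>\<^sup>2 + 2 * (sqrt l * sqrt m) * \<xi> * \<zeta> * c + m * w * \<zeta>\<^sup>2" for \<xi> \<zeta>
    using nonneg[of "sqrt l * \<xi>" "sqrt m * \<zeta>"] l by (simp add: power_mult_distrib mult_ac)
  have nn': "0 \<le> l * v * \<xi>\<^sup>2 - 2 * (sqrt l * sqrt m) * \<xi> * \<zeta> * c + m * w * \<zeta>\<^sup>2" for \<xi> \<zeta>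
    using nn[of \<xi> "- \<zeta>"] by simp
  have J01: "0 \<le> J \<xi> \<zeta>" "J \<xi> \<zeta> \<le> 1" for \<xi> \<zeta>
  proof -
    show "0 \<le> J \<xi> \<zeta>" by (simp add: J_def add_nonneg_nonneg)
    have "exp (- (x / 2)) \<le> 1" if "0 \<le> x" for x :: real using that by simp
    from add_mono[OF this[OF nn[of \<xi> \<zeta>]] this[OF nn'[of \<xi> \<zeta>]]]
    have le: "2 * J \<xi> \<zeta> \<le> 1 + 1" unfolding J_def times_divide_eq_right nonzero_mult_div_cancel_left[OF zero_neq_numeral[symmetric]] .
    then show "J \<xi> \<zeta> \<le> 1" by linarith
  qed
  have EJ: "(LINT \<omega>|M. cos (sqrt l * X \<omega> * \<xi>) * cos (sqrt m * Y \<omega> * \<zeta>)) = J \<xi> \<zeta>" for \<xi> \<zeta>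
  proof -
    have E: "(LINT \<omega>|M. cos (a * X \<omega> + b * Y \<omega>)) = exp (- (a\<^sup>2 * v + 2 * a * b * c + b\<^sup>2 * w) / 2)" for a b
      using integral_cos_gaussian[of "\<lambda>\<omega>. a * X \<omega> + b * Y \<omega>" 1 "a\<^sup>2 * v + 2 * a * b * c + b\<^sup>2 * w"] ch[of a b] by simp
    have int: "integrable M (\<lambda>\<omega>. cos (a * X \<omega> + b * Y \<omega>))" for a b
      by (intro integrable_const_bound[where B = 1]) auto
    have "(LINT \<omega>|M. cos (sqrt l * X \<omega> * \<xi>) * cos (sqrt m * Y \<omega> * \<zeta>))
       = (LINT \<omega>|M. (cos ((sqrt l * \<xi>) * X \<omega> + (- sqrt m * \<zeta>) * Y \<omega>) + cos ((sqrt l * \<xi>) * X \<omega> + (sqrt m * \<zeta>) * Y \<omega>)) / 2)"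
      by (intro Bochner_Integration.integral_cong) (auto simp: cos_times_cos algebra_simps)
    also have "\<dots> = ((LINT \<omega>|M. cos ((sqrt l * \<xi>) * X \<omega> + (- sqrt m * \<zeta>) * Y \<omega>))
        + (LINT \<omega>|M. cos ((sqrt l * \<xi>) * X \<omega> + (sqrt m * \<zeta>) * Y \<omega>))) / 2"
      by (simp only: integral_divide_zero Bochner_Integration.integral_add[OF int int])
    also have "\<dots> = J \<xi> \<zeta>"
    proof -
      have "- ((sqrt l * \<xi>)\<^sup>2 * v + 2 * (sqrt l * \<xi>) * (sqrt m * \<zeta>) * c + (sqrt m * \<zeta>)\<^sup>2 * w) / 2
          = - ((l * v * \<xi>\<^sup>2 + 2 * (sqrt l * sqrt m) * \<xi> * \<zeta> * c + m * w * \<zeta>\<^sup>2) / 2)"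
        "- ((sqrt l * \<xi>)\<^sup>2 * v + 2 * (sqrt l * \<xi>) * (- sqrt m * \<zeta>) * c + (- sqrt m * \<zeta>)\<^sup>2 * w) / 2
          = - ((l * v * \<xi>\<^sup>2 - 2 * (sqrt l * sqrt m) * \<xi> * \<zeta> * c + m * w * \<zeta>\<^sup>2) / 2)"
        using l by (simp_all add: power_mult_distrib field_simps)
      then show ?thesis unfolding E J_def by (simp only: add.commute)
    qed
    finally show ?thesis .
  qed
  have J_meas [measurable]: "case_prod J \<in> borel_measurable (borel \<Otimes>\<^sub>M borel)"
    unfolding J_def by measurable
  have J_meas' [measurable]: "J \<xi> \<in> borel_measurable borel" for \<xi>
    unfolding J_def by measurable
  have "(LINT \<omega>|M. exp (- (l * (X \<omega>)\<^sup>2 / 2)) * exp (- (m * (Y \<omega>)\<^sup>2 / 2)))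
      = (LINT \<omega>|M. LINT \<xi>|?N. cos (sqrt l * X \<omega> * \<xi>) * exp (- (m * (Y \<omega>)\<^sup>2 / 2)))"
    using l by (simp add: exp_sq_eq_integral_cos[of l])
  also have "\<dots> = (LINT \<xi>|?N. LINT \<omega>|M. cos (sqrt l * X \<omega> * \<xi>) * exp (- (m * (Y \<omega>)\<^sup>2 / 2)))"
    using l by (intro swap_gauss_integral) (auto simp: abs_mult intro!: mult_le_one)
  also have "\<dots> = (LINT \<xi>|?N. LINT \<omega>|M. LINT \<zeta>|?N. cos (sqrt l * X \<omega> * \<xi>) * cos (sqrt m * Y \<omega> * \<zeta>))"
    using l by (simp add: exp_sq_eq_integral_cos[of m])
  also have "\<dots> = (LINT \<xi>|?N. LINT \<zeta>|?N. LINT \<omega>|M. cos (sqrt l * X \<omega> * \<xi>) * cos (sqrt m * Y \<omega> * \<zeta>))"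
    by (intro Bochner_Integration.integral_cong refl swap_gauss_integral) (auto simp: abs_mult intro!: mult_le_one)
  finally have 1: "(LINT \<omega>|M. exp (- (l * (X \<omega>)\<^sup>2 / 2)) * exp (- (m * (Y \<omega>)\<^sup>2 / 2))) = (LINT \<xi>|?N. LINT \<zeta>|?N. J \<xi> \<zeta>)"
    by (simp add: EJ)
  define P where "P \<xi> \<zeta> = exp (- (l * v * \<xi>\<^sup>2 / 2)) * exp (- (m * w * \<zeta>\<^sup>2 / 2))" for \<xi> \<zeta> :: real
  have P01: "0 \<le> P \<xi> \<zeta>" "P \<xi> \<zeta> \<le> 1" for \<xi> \<zeta>
    using l vw by (auto simp: P_def intro!: mult_le_one)
  have P_meas [measurable]: "case_prod P \<in> borel_measurable (borel \<Otimes>\<^sub>M borel)"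
    unfolding P_def by measurable
  have P_meas' [measurable]: "P \<xi> \<in> borel_measurable borel" for \<xi>
    unfolding P_def by measurable
  have 2: "1 / sqrt (1 + l * v) * (1 / sqrt (1 + m * w)) = (LINT \<xi>|?N. LINT \<zeta>|?N. P \<xi> \<zeta>)"
    using l vw by (simp add: P_def integral_gauss_exp_sq mult.assoc[symmetric])
  have JP: "\<bar>J \<xi> \<zeta> - P \<xi> \<zeta>\<bar> \<le> sqrt l * sqrt m * \<bar>c\<bar> * (\<bar>\<xi>\<bar> * \<bar>\<zeta>\<bar>)" for \<xi> \<zeta>
  proof -
    define p where "p = (l * v * \<xi>\<^sup>2 + m * w * \<zeta>\<^sup>2) / 2"
    define s where "s = sqrt l * sqrt m * \<xi> * \<zeta> * c"
    have "0 \<le> p" using l vw by (simp add: p_def)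
    have P: "P \<xi> \<zeta> = exp (- p)" by (simp add: P_def p_def add_divide_distrib flip: exp_add)
    have J: "J \<xi> \<zeta> = (exp (- (p + s)) + exp (- (p - s))) / 2"
      unfolding J_def p_def s_def by (simp add: field_simps)
    have "p + s = (l * v * \<xi>\<^sup>2 + 2 * (sqrt l * sqrt m) * \<xi> * \<zeta> * c + m * w * \<zeta>\<^sup>2) / 2"
      "p - s = (l * v * \<xi>\<^sup>2 - 2 * (sqrt l * sqrt m) * \<xi> * \<zeta> * c + m * w * \<zeta>\<^sup>2) / 2"
      by (simp_all add: p_def s_def field_simps)
    then have "0 \<le> p + s" "0 \<le> p - s" using nn[of \<xi> \<zeta>] nn'[of \<xi> \<zeta>] by simp_all
    from abs_exp_diff_le[OF this(1) \<open>0 \<le> p\<close>] abs_exp_diff_le[OF this(2) \<open>0 \<le> p\<close>]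
    have d: "\<bar>exp (- (p + s)) - exp (- p)\<bar> \<le> \<bar>s\<bar>" "\<bar>exp (- (p - s)) - exp (- p)\<bar> \<le> \<bar>s\<bar>" by simp_all
    have "\<bar>(A + B) / 2 - C\<bar> \<le> r" if "\<bar>A - C\<bar> \<le> r" "\<bar>B - C\<bar> \<le> r" for A B C r :: real
      using that unfolding abs_le_iff by (auto simp: field_simps)
    from this[OF d] have "\<bar>J \<xi> \<zeta> - P \<xi> \<zeta>\<bar> \<le> \<bar>s\<bar>" unfolding J P .
    then show ?thesis using l by (simp add: s_def abs_mult mult_ac)
  qed
  have int1: "integrable ?N (J \<xi>)" "integrable ?N (P \<xi>)" for \<xi>
    using J01 P01 by (auto intro!: N.integrable_const_bound[where B = 1])
  have LJ01: "\<bar>LINT \<zeta>|?N. J \<xi> \<zeta>\<bar> \<le> 1" "\<bar>LINT \<zeta>|?N. P \<xi> \<zeta>\<bar> \<le> 1" for \<xi>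
    using N.integral_le_const[OF int1(1)[of \<xi>], of 1] N.integral_le_const[OF int1(2)[of \<xi>], of 1] J01 P01
      integral_nonneg_AE[where M = ?N and f = "J \<xi>"] integral_nonneg_AE[where M = ?N and f = "P \<xi>"] by auto
  have int2: "integrable ?N (\<lambda>\<xi>. LINT \<zeta>|?N. J \<xi> \<zeta>)" "integrable ?N (\<lambda>\<xi>. LINT \<zeta>|?N. P \<xi> \<zeta>)"
    using LJ01 by (auto intro!: N.integrable_const_bound[where B = 1])
  have "\<bar>(LINT \<xi>|?N. LINT \<zeta>|?N. J \<xi> \<zeta>) - (LINT \<xi>|?N. LINT \<zeta>|?N. P \<xi> \<zeta>)\<bar>
     = \<bar>LINT \<xi>|?N. LINT \<zeta>|?N. (J \<xi> \<zeta> - P \<xi> \<zeta>)\<bar>"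
    using int1 int2 by simp
  also have "\<dots> \<le> (LINT \<xi>|?N. LINT \<zeta>|?N. sqrt l * sqrt m * \<bar>c\<bar> * (\<bar>\<xi>\<bar> * \<bar>\<zeta>\<bar>))"
  proof (rule order_trans[OF integral_abs_bound], rule integral_mono)
    have "\<bar>LINT \<zeta>|?N. J \<xi> \<zeta> - P \<xi> \<zeta>\<bar> \<le> (LINT \<zeta>|?N. \<bar>J \<xi> \<zeta> - P \<xi> \<zeta>\<bar>)" for \<xi>
      by (rule integral_abs_bound)
    also have "(LINT \<zeta>|?N. \<bar>J \<xi> \<zeta> - P \<xi> \<zeta>\<bar>) \<le> (LINT \<zeta>|?N. sqrt l * sqrt m * \<bar>c\<bar> * (\<bar>\<xi>\<bar> * \<bar>\<zeta>\<bar>))" for \<xi>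
      using int1 integral_gauss_abs_le(1) JP by (intro integral_mono) auto
    finally show "\<bar>LINT \<zeta>|?N. J \<xi> \<zeta> - P \<xi> \<zeta>\<bar> \<le> (LINT \<zeta>|?N. sqrt l * sqrt m * \<bar>c\<bar> * (\<bar>\<xi>\<bar> * \<bar>\<zeta>\<bar>))" for \<xi> .
  qed (use int1 int2 integral_gauss_abs_le in auto)
  also have "\<dots> = sqrt l * sqrt m * \<bar>c\<bar> * ((LINT \<xi>|?N. \<bar>\<xi>\<bar>) * (LINT \<zeta>|?N. \<bar>\<zeta>\<bar>))"
    by simp
  also have "\<dots> \<le> sqrt l * sqrt m * \<bar>c\<bar> * (1 * 1)"
    using integral_gauss_abs_le(2) l by (intro mult_left_mono mult_mono integral_nonneg_AE) auto
  finally show ?thesis unfolding 1 2 by simp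
qed

end

section \<open>Independence of the components\<close>

text \<open>Preimages of rectangles S x T form an intersection-stable generator of the sigma-algebra
  of a pair. On them the probability factorizes first over the two families by \<open>AB\<close>,
  then over the indices by \<open>A\<close> and \<open>B\<close>.\<close>

lemma (in prob_space) indep_vars_Pair:
  assumes A: "indep_vars (\<lambda>_. N) A I" and B: "indep_vars (\<lambda>_. N') B I"
    and AB: "indep_var (Pi\<^sub>M I (\<lambda>_. N)) (\<lambda>\<omega>. \<lambda>i\<in>I. A i \<omega>) (Pi\<^sub>M I (\<lambda>_. N')) (\<lambda>\<omega>. \<lambda>i\<in>I. B i \<omega>)"
  shows "indep_vars (\<lambda>_. N \<Otimes>\<^sub>M N') (\<lambda>i \<omega>. (A i \<omega>, B i \<omega>)) I"
proof -
  have mA [measurable]: "A i \<in> measurable M N" if "i \<in> I" for i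
    using A that by (simp add: indep_vars_def)
  have mB [measurable]: "B i \<in> measurable M N'" if "i \<in> I" for i
    using B that by (simp add: indep_vars_def)
  define E where "E i = {A i -` S \<inter> B i -` T \<inter> space M | S T. S \<in> sets N \<and> T \<in> sets N'}" for i
  have prod: "prob ((\<Inter>j\<in>J. A j -` S j \<inter> space M) \<inter> (\<Inter>j\<in>J. B j -` T j \<inter> space M))
      = (\<Prod>j\<in>J. prob (A j -` S j \<inter> space M)) * (\<Prod>j\<in>J. prob (B j -` T j \<inter> space M))"
    if J: "J \<noteq> {}" "J \<subseteq> I" "finite J" and S: "\<And>j. j \<in> J \<Longrightarrow> S j \<in> sets N" and T: "\<And>j. j \<in> J \<Longrightarrow> T j \<in> sets N'" for J S T
  proof -
    let ?a = "\<lambda>\<omega>. \<lambda>i\<in>I. A i \<omega>" and ?b = "\<lambda>\<omega>. \<lambda>i\<in>I. B i \<omega>"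
    \<comment> \<open>Conditions on finitely many indices are cylinder sets of the product space,
      and to these \<open>AB\<close> applies.\<close>
    let ?S = "prod_emb I (\<lambda>_. N) J (Pi\<^sub>E J S)" and ?T = "prod_emb I (\<lambda>_. N') J (Pi\<^sub>E J T)"
    have 1: "?a -` ?S \<inter> space M = (\<Inter>j\<in>J. A j -` S j \<inter> space M)"
      using J measurable_space[OF mA] by (auto simp: prod_emb_def PiE_iff subset_iff)
    have 2: "?b -` ?T \<inter> space M = (\<Inter>j\<in>J. B j -` T j \<inter> space M)"
      using J measurable_space[OF mB] by (auto simp: prod_emb_def PiE_iff subset_iff)
    have "prob ((\<lambda>\<omega>. (?a \<omega>, ?b \<omega>)) -` (?S \<times> ?T) \<inter> space M) = prob (?a -` ?S \<inter> space M) * prob (?b -` ?T \<inter> space M)"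
      using J S T by (intro indep_varD[OF AB] sets_PiM_I) auto
    moreover have "(\<lambda>\<omega>. (?a \<omega>, ?b \<omega>)) -` (?S \<times> ?T) \<inter> space M = (?a -` ?S \<inter> space M) \<inter> (?b -` ?T \<inter> space M)"
      by auto
    ultimately show ?thesis
      unfolding 1 2 using indep_varsD[OF A J(1,3,2)] indep_varsD[OF B J(1,3,2)] S T by simp
  qed
  have "indep_sets E I"
  proof (rule indep_setsI)
    show "E i \<subseteq> events" if "i \<in> I" for i
    proof
      fix X assume "X \<in> E i"
      then obtain S T where X: "X = A i -` S \<inter> B i -` T \<inter> space M" "S \<in> sets N" "T \<in> sets N'"
        unfolding E_def by auto
      have "X = (A i -` S \<inter> space M) \<inter> (B i -` T \<inter> space M)" unfolding X by auto
      then show "X \<in> events" using X that by (auto intro!: sets.Int measurable_sets[OF mA] measurable_sets[OF mB])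
    qed
    fix X J assume J: "J \<noteq> {}" "J \<subseteq> I" "finite J" and "\<forall>j\<in>J. X j \<in> E j"
    then have "\<forall>j\<in>J. \<exists>S T. X j = A j -` S \<inter> B j -` T \<inter> space M \<and> S \<in> sets N \<and> T \<in> sets N'"
      unfolding E_def by blast
    then obtain S T where X: "\<And>j. j \<in> J \<Longrightarrow> X j = A j -` S j \<inter> B j -` T j \<inter> space M"
       "\<And>j. j \<in> J \<Longrightarrow> S j \<in> sets N" "\<And>j. j \<in> J \<Longrightarrow> T j \<in> sets N'"
      by metis
    have "(\<Inter>j\<in>J. X j) = (\<Inter>j\<in>J. A j -` S j \<inter> space M) \<inter> (\<Inter>j\<in>J. B j -` T j \<inter> space M)"
      using X(1) J by auto
    then have "prob (\<Inter>j\<in>J. X j) = (\<Prod>j\<in>J. prob (A j -` S j \<inter> space M)) * (\<Prod>j\<in>J. prob (B j -` T j \<inter> space M))"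
      using prod[OF J] X by simp
    also have "\<dots> = (\<Prod>j\<in>J. prob (X j))"
      unfolding prod.distrib[symmetric]
    proof (rule prod.cong[OF refl])
      fix j assume "j \<in> J"
      \<comment> \<open>The product formula for a one-element index set recovers the probability of
        a single event.\<close>
      moreover have "X j = (\<Inter>j\<in>{j}. A j -` S j \<inter> space M) \<inter> (\<Inter>j\<in>{j}. B j -` T j \<inter> space M)"
        using X(1) \<open>j \<in> J\<close> by auto
      ultimately show "prob (A j -` S j \<inter> space M) * prob (B j -` T j \<inter> space M) = prob (X j)"
        using prod[of "{j}" S T] X J by auto
    qed
    finally show "prob (\<Inter>j\<in>J. X j) = (\<Prod>j\<in>J. prob (X j))" .
  qed
  then have "indep_sets (\<lambda>i. sigma_sets (space M) (E i)) I"
  proof (rule indep_sets_sigma)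
    fix i
    show "Int_stable (E i)"
    proof (rule Int_stableI)
      fix X Y assume "X \<in> E i" "Y \<in> E i"
      then obtain S T S' T' where "X = A i -` S \<inter> B i -` T \<inter> space M" "S \<in> sets N" "T \<in> sets N'"
        "Y = A i -` S' \<inter> B i -` T' \<inter> space M" "S' \<in> sets N" "T' \<in> sets N'" unfolding E_def by auto
      moreover from this have "X \<inter> Y = A i -` (S \<inter> S') \<inter> B i -` (T \<inter> T') \<inter> space M" by auto
      ultimately show "X \<inter> Y \<in> E i" unfolding E_def by blast
    qed
  qed
  then have "indep_sets (\<lambda>i. {(\<lambda>\<omega>. (A i \<omega>, B i \<omega>)) -` C \<inter> space M | C. C \<in> sets (N \<Otimes>\<^sub>M N')}) I"
  proof (rule indep_sets_mono_sets)
    fix i assume i: "i \<in> I"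
    have E_Pow: "E i \<subseteq> Pow (space M)" by (auto simp: E_def)
    let ?G = "sigma (space M) (E i)"
    have "A i \<in> measurable ?G N"
    proof (rule measurableI)
      show "A i x \<in> space N" if "x \<in> space ?G" for x
        using that measurable_space[OF mA[OF i]] by (simp add: space_measure_of[OF E_Pow])
      fix S assume "S \<in> sets N"
      moreover have "A i -` S \<inter> space M = A i -` S \<inter> B i -` space N' \<inter> space M"
        using measurable_space[OF mB[OF i]] by auto
      ultimately have "A i -` S \<inter> space M \<in> E i" unfolding E_def by blast
      then show "A i -` S \<inter> space ?G \<in> sets ?G" by (simp add: space_measure_of[OF E_Pow] sets_measure_of[OF E_Pow])
    qed
    moreover have "B i \<in> measurable ?G N'"
    proof (rule measurableI)
      show "B i x \<in> space N'" if "x \<in> space ?G" for x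
        using that measurable_space[OF mB[OF i]] by (simp add: space_measure_of[OF E_Pow])
      fix T assume "T \<in> sets N'"
      moreover have "B i -` T \<inter> space M = A i -` space N \<inter> B i -` T \<inter> space M"
        using measurable_space[OF mA[OF i]] by auto
      ultimately have "B i -` T \<inter> space M \<in> E i" unfolding E_def by blast
      then show "B i -` T \<inter> space ?G \<in> sets ?G" by (simp add: space_measure_of[OF E_Pow] sets_measure_of[OF E_Pow])
    qed
    ultimately have "(\<lambda>\<omega>. (A i \<omega>, B i \<omega>)) \<in> measurable ?G (N \<Otimes>\<^sub>M N')" by measurable
    from measurable_sets[OF this]
    show "{(\<lambda>\<omega>. (A i \<omega>, B i \<omega>)) -` C \<inter> space M | C. C \<in> sets (N \<Otimes>\<^sub>M N')} \<subseteq> sigma_sets (space M) (E i)"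
      by (auto simp: space_measure_of[OF E_Pow] sets_measure_of[OF E_Pow])
  qed
  then show ?thesis unfolding indep_vars_def2 by auto
qed

section \<open>The two noises as one Gaussian family indexed by pairs of kernels\<close>

sublocale noise_setup \<subseteq> evolution: gaussian_noise M "W i" for i
  using noise_W by unfold_locales (simp add: vector_white_noise_def)

sublocale noise_setup \<subseteq> initial: gaussian_noise M "W' i" for i
  using noise_W' by unfold_locales (simp add: vector_white_noise_def)

text \<open>The first entry is integrated against the initial noise \<open>W'\<close>, the second
  against \<open>W\<close>.\<close>

type_synonym kernel_pair = "(real \<times> real \<Rightarrow> real) \<times> (real \<times> real \<Rightarrow> real)"

definition pair_inner :: "kernel_pair \<Rightarrow> kernel_pair \<Rightarrow> real" where
  "pair_inner H K = hp_inner (fst H) (fst K) + hp_inner (snd H) (snd K)"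

definition pair_lin :: "real \<Rightarrow> kernel_pair \<Rightarrow> real \<Rightarrow> kernel_pair \<Rightarrow> kernel_pair" where
  "pair_lin a H b K = (\<lambda>p. a * fst H p + b * fst K p, \<lambda>p. a * snd H p + b * snd K p)"

abbreviation L2_pairs :: "kernel_pair set" where
  "L2_pairs \<equiv> L2_half_plane \<times> L2_half_plane"

lemma pair_lin_L2: "H \<in> L2_pairs \<Longrightarrow> K \<in> L2_pairs \<Longrightarrow> pair_lin a H b K \<in> L2_pairs"
  by (auto simp: pair_lin_def intro!: L2_half_plane_lin)

lemma pair_inner_self_nonneg: "0 \<le> pair_inner H H"
  by (simp add: pair_inner_def hp_inner_self_nonneg add_nonneg_nonneg)

lemma pair_inner_lin_self:
  assumes "H \<in> L2_pairs" "K \<in> L2_pairs"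
  shows "pair_inner (pair_lin a H b K) (pair_lin a H b K) = a\<^sup>2 * pair_inner H H + 2 * a * b * pair_inner H K + b\<^sup>2 * pair_inner K K"
  using assms by (auto simp: pair_inner_def pair_lin_def hp_inner_lin_self algebra_simps)

context noise_setup
begin

definition pair_noise :: "'d \<Rightarrow> kernel_pair \<Rightarrow> 'w \<Rightarrow> real" where
  "pair_noise i H \<omega> = W' i (fst H) \<omega> + W i (snd H) \<omega>"

lemma pair_noise_measurable [measurable (raw)]: "H \<in> L2_pairs \<Longrightarrow> pair_noise i H \<in> borel_measurable M"
  unfolding pair_noise_def by (auto intro!: borel_measurable_add initial.noise_measurable evolution.noise_measurable)

lemma pair_noise_lin:
  assumes "H \<in> L2_pairs" "K \<in> L2_pairs"
  shows "AE \<omega> in M. pair_noise i (pair_lin a H b K) \<omega> = a * pair_noise i H \<omega> + b * pair_noise i K \<omega>"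
proof -
  have "fst H \<in> L2_half_plane" "snd H \<in> L2_half_plane" "fst K \<in> L2_half_plane" "snd K \<in> L2_half_plane"
    using assms by auto
  from initial.noise_lin[OF this(1,3), of i a b] evolution.noise_lin[OF this(2,4), of i a b]
  show ?thesis
    unfolding pair_noise_def pair_lin_def by eventually_elim (simp add: algebra_simps)
qed

lemma indep_noise_components:
  assumes hk: "k \<in> L2_half_plane" "k' \<in> L2_half_plane" "h \<in> L2_half_plane" "h' \<in> L2_half_plane"
  shows "indep_var (Pi\<^sub>M UNIV (\<lambda>_. borel \<Otimes>\<^sub>M borel)) (\<lambda>\<omega>. \<lambda>i\<in>UNIV. (W i k \<omega>, W i k' \<omega>))
           (Pi\<^sub>M UNIV (\<lambda>_. borel \<Otimes>\<^sub>M borel)) (\<lambda>\<omega>. \<lambda>i\<in>UNIV. (W' i h \<omega>, W' i h' \<omega>))"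
proof -
  have m: "(\<lambda>y. \<lambda>i\<in>UNIV. (y (i, f), y (i, f'))) \<in> measurable (Pi\<^sub>M (UNIV \<times> L2_half_plane) (\<lambda>_. borel)) (Pi\<^sub>M UNIV (\<lambda>_. borel \<Otimes>\<^sub>M borel))"
    if "f \<in> L2_half_plane" "f' \<in> L2_half_plane" for f f' :: "real \<times> real \<Rightarrow> real"
    using that by (intro measurable_restrict measurable_Pair measurable_component_singleton) auto
  from indep_var_compose[OF indep_W_W'[unfolded independent_noises_def] m[OF hk(1,2)] m[OF hk(3,4)]]
  show ?thesis using hk by (simp add: comp_def)
qed

text \<open>Two pairs of kernels are carried along, because the decorrelation estimate concerns two
  space-time points at once.\<close>

lemma indep_pair_noise:
  assumes "H \<in> L2_pairs" "K \<in> L2_pairs"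
  shows "indep_vars (\<lambda>_. borel \<Otimes>\<^sub>M borel) (\<lambda>i \<omega>. (pair_noise i H \<omega>, pair_noise i K \<omega>)) UNIV"
proof -
  obtain h k h' k' where HK: "H = (h, k)" "K = (h', k')" "k \<in> L2_half_plane" "k' \<in> L2_half_plane" "h \<in> L2_half_plane" "h' \<in> L2_half_plane"
    using assms by auto
  have m: "(\<lambda>y. (y f, y f')) \<in> measurable (Pi\<^sub>M L2_half_plane (\<lambda>_. borel)) (borel \<Otimes>\<^sub>M borel)"
    if "f \<in> L2_half_plane" "f' \<in> L2_half_plane" for f f' :: "real \<times> real \<Rightarrow> real"
    using that by (intro measurable_Pair measurable_component_singleton)
  have 1: "indep_vars (\<lambda>_. borel \<Otimes>\<^sub>M borel) (\<lambda>i \<omega>. (W i k \<omega>, W i k' \<omega>)) UNIV"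
    using indep_vars_compose2[OF noise_W[unfolded vector_white_noise_def, THEN conjunct2], where Y = "\<lambda>_ y. (y k, y k')" and N = "\<lambda>_. borel \<Otimes>\<^sub>M borel"] m HK
    by simp
  have 2: "indep_vars (\<lambda>_. borel \<Otimes>\<^sub>M borel) (\<lambda>i \<omega>. (W' i h \<omega>, W' i h' \<omega>)) UNIV"
    using indep_vars_compose2[OF noise_W'[unfolded vector_white_noise_def, THEN conjunct2], where Y = "\<lambda>_ y. (y h, y h')" and N = "\<lambda>_. borel \<Otimes>\<^sub>M borel"] m HK
    by simp
  note indep = indep_vars_Pair[OF 1 2 indep_noise_components[OF HK(3-)]]
  have "(\<lambda>z. (fst (snd z) + fst (fst z), snd (snd z) + snd (fst z))) \<in> measurable ((borel \<Otimes>\<^sub>M borel) \<Otimes>\<^sub>M (borel \<Otimes>\<^sub>M borel)) ((borel :: real measure) \<Otimes>\<^sub>M (borel :: real measure))"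
    by measurable
  from indep_vars_compose2[OF indep, where Y = "\<lambda>_. (\<lambda>z. (fst (snd z) + fst (fst z), snd (snd z) + snd (fst z)))", OF this]
  show ?thesis by (simp add: pair_noise_def HK)
qed

text \<open>The two noises are independent, so the characteristic functions multiply and the
  variances add.\<close>

lemma pair_noise_char:
  assumes "H \<in> L2_pairs"
  shows "char (distr M borel (pair_noise i H)) t = exp (- pair_inner H H * t\<^sup>2 / 2)"
proof -
  obtain h k where H: "H = (h, k)" "h \<in> L2_half_plane" "k \<in> L2_half_plane" using assms by auto
  have m: "(\<lambda>y. fst (y i)) \<in> measurable (Pi\<^sub>M UNIV (\<lambda>_. borel \<Otimes>\<^sub>M borel)) (borel :: real measure)"
    by (rule measurable_compose[OF _ measurable_fst], rule measurable_component_singleton) simp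
  have "indep_var borel (W i k) borel (W' i h)"
    using indep_var_compose[OF indep_noise_components[OF H(3) H(3) H(2) H(2)] m m] by (simp add: comp_def)
  from char_distr_add[OF this, of t]
  have "char (distr M borel (\<lambda>\<omega>. W i k \<omega> + W' i h \<omega>)) t
      = complex_of_real (exp (- hp_inner k k * t\<^sup>2 / 2) * exp (- hp_inner h h * t\<^sup>2 / 2))"
    using H by (simp only: evolution.noise_char initial.noise_char of_real_mult)
  moreover have "- hp_inner k k * t\<^sup>2 / 2 + - hp_inner h h * t\<^sup>2 / 2 = - pair_inner H H * t\<^sup>2 / 2"
    by (simp add: H pair_inner_def field_simps)
  moreover have "pair_noise i H = (\<lambda>\<omega>. W i k \<omega> + W' i h \<omega>)"
    by (auto simp: pair_noise_def H)
  ultimately show ?thesis by (simp only: exp_add[symmetric])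
qed

text \<open>A union bound over the two noises at level l / 2, which explains the factors 2 and 4;
  only the moments of each noise on its own enter.\<close>

lemma pair_noise_tail:
  assumes "H \<in> L2_pairs" "l > 0"
  shows "prob {\<omega> \<in> space M. l \<le> \<bar>pair_noise i H \<omega>\<bar>} \<le> 2 * (fact (2 * k) / (2 ^ k * fact k)) * (4 * pair_inner H H / l\<^sup>2) ^ k"
proof -
  obtain f g where H: "H = (f, g)" "f \<in> L2_half_plane" "g \<in> L2_half_plane" using assms by auto
  note [measurable] = initial.noise_measurable[OF H(2), of i] evolution.noise_measurable[OF H(3), of i]
  let ?c = "fact (2 * k) / (2 ^ k * fact k) :: real"
  have "prob {\<omega> \<in> space M. l \<le> \<bar>pair_noise i H \<omega>\<bar>}
     \<le> prob ({\<omega> \<in> space M. l / 2 \<le> \<bar>W' i f \<omega>\<bar>} \<union> {\<omega> \<in> space M. l / 2 \<le> \<bar>W i g \<omega>\<bar>})"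
    by (intro finite_measure_mono) (auto simp: pair_noise_def H)
  also have "\<dots> \<le> prob {\<omega> \<in> space M. l / 2 \<le> \<bar>W' i f \<omega>\<bar>} + prob {\<omega> \<in> space M. l / 2 \<le> \<bar>W i g \<omega>\<bar>}"
    by (intro measure_Un_le) auto
  also have "\<dots> \<le> ?c * (hp_inner f f / (l / 2)\<^sup>2) ^ k + ?c * (hp_inner g g / (l / 2)\<^sup>2) ^ k"
    using assms H by (intro add_mono initial.noise_tail evolution.noise_tail) auto
  also have "\<dots> \<le> ?c * (4 * pair_inner H H / l\<^sup>2) ^ k + ?c * (4 * pair_inner H H / l\<^sup>2) ^ k"
    using hp_inner_self_nonneg[of f] hp_inner_self_nonneg[of g] assms
    by (intro add_mono mult_left_mono power_mono) (auto simp: H pair_inner_def power_divide field_simps)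
  finally show ?thesis by (simp only: mult_2 distrib_right)
qed

end

section \<open>Square integrability and variances of the string kernels\<close>

lemma ennreal_hp_inner:
  assumes [measurable]: "f \<in> borel_measurable borel"
    and fin: "(\<integral>\<^sup>+p. ennreal ((f p)\<^sup>2) * indicator half_plane p \<partial>lborel) < \<infinity>"
  shows "f \<in> L2_half_plane" "ennreal (hp_inner f f) = (\<integral>\<^sup>+p. ennreal ((f p)\<^sup>2) * indicator half_plane p \<partial>lborel)"
proof -
  have eq: "(\<integral>\<^sup>+p. ennreal ((f p)\<^sup>2) * indicator half_plane p \<partial>lborel) = (\<integral>\<^sup>+p. ennreal (indicator half_plane p *\<^sub>R (f p)\<^sup>2) \<partial>lborel)"
    by (intro nn_integral_cong) (auto split: split_indicator)
  have int: "integrable lborel (\<lambda>p. indicator half_plane p *\<^sub>R (f p)\<^sup>2)"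
    using fin unfolding eq by (intro integrableI_nonneg) auto
  then show "f \<in> L2_half_plane" unfolding L2_half_plane_def set_borel_measurable_def set_integrable_def by auto
  show "ennreal (hp_inner f f) = (\<integral>\<^sup>+p. ennreal ((f p)\<^sup>2) * indicator half_plane p \<partial>lborel)"
    unfolding eq hp_inner_def set_lebesgue_integral_def using int
    by (subst nn_integral_eq_integral) (auto simp: power2_eq_square)
qed

definition string_kernel :: "real \<Rightarrow> real \<Rightarrow> kernel_pair" where
  "string_kernel t x = (initial_kernel t x, evolution_kernel t x)"

abbreviation string_increment :: "real \<Rightarrow> real \<Rightarrow> real \<Rightarrow> real \<Rightarrow> kernel_pair" where
  "string_increment t x s y \<equiv> pair_lin 1 (string_kernel t x) (-1) (string_kernel s y)"

lemma string_kernel_diff: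
  assumes "0 \<le> s" "s \<le> t"
  shows "string_increment t x s y \<in> L2_pairs"
    and "ennreal (pair_inner (string_increment t x s y) (string_increment t x s y))
      = gap_total (t - s) (x - y)"
proof -
  let ?f = "\<lambda>p. initial_kernel t x p - initial_kernel s y p" and ?g = "\<lambda>p. evolution_kernel t x p - evolution_kernel s y p"
  have eq: "string_increment t x s y = (?f, ?g)"
    by (simp add: pair_lin_def string_kernel_def)
  have fin: "gap_total (t - s) (x - y) < \<infinity>"
    using gap_total_upper[of "t - s" "x - y"] assms by (simp add: le_less_trans)
  note tot = nn_integral_kernel_diff[OF assms, of x y]
  have f: "?f \<in> L2_half_plane" "ennreal (hp_inner ?f ?f) = (\<integral>\<^sup>+p. ennreal ((?f p)\<^sup>2) * indicator half_plane p \<partial>lborel)"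
    by (rule ennreal_hp_inner; use fin in \<open>simp flip: tot\<close>)+
  have g: "?g \<in> L2_half_plane" "ennreal (hp_inner ?g ?g) = (\<integral>\<^sup>+p. ennreal ((?g p)\<^sup>2) * indicator half_plane p \<partial>lborel)"
    by (rule ennreal_hp_inner; use fin in \<open>simp flip: tot\<close>)+
  show "string_increment t x s y \<in> L2_pairs" using f g by (simp add: eq)
  show "ennreal (pair_inner (string_increment t x s y) (string_increment t x s y))
      = gap_total (t - s) (x - y)"
    unfolding eq pair_inner_def using tot f g by (simp add: hp_inner_self_nonneg)
qed

text \<open>At (0, 0) both kernels vanish, since the string is pinned there; a single value is
  therefore the increment from that point.\<close>

lemma string_kernel_L2: "0 \<le> t \<Longrightarrow> string_kernel t x \<in> L2_pairs"
  using string_kernel_diff(1)[of 0 t x 0] by (simp add: pair_lin_def string_kernel_def)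

definition gap :: "real \<Rightarrow> real \<Rightarrow> real" where "gap a x = enn2real (gap_total a x)"

lemma ennreal_gap: "0 \<le> a \<Longrightarrow> ennreal (gap a x) = gap_total a x"
  using gap_total_upper[of a x] by (simp add: gap_def le_less_trans ennreal_enn2real)

lemma gap_nonneg: "0 \<le> gap a x"
  by (simp add: gap_def)

lemma gap_upper: "0 \<le> a \<Longrightarrow> gap a x \<le> sqrt a + \<bar>x\<bar>"
  using gap_total_upper[of a x] by (simp add: ennreal_le_iff flip: ennreal_gap ennreal_plus)

lemma gap_lower: "0 \<le> a \<Longrightarrow> (sqrt a + \<bar>x\<bar>) / 100 \<le> gap a x"
  using gap_total_lower[of a x] by (simp add: ennreal_le_iff gap_nonneg flip: ennreal_gap)

lemma gap_0: "0 \<le> a \<Longrightarrow> gap a 0 = sqrt (a / pi)"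
  by (simp add: gap_def gap_total_0)

lemma pair_inner_string_kernel_diff:
  assumes "0 \<le> s" "s \<le> t"
  shows "pair_inner (string_increment t x s y) (string_increment t x s y)
      = gap (t - s) (x - y)"
  using string_kernel_diff(2)[OF assms, of x y, symmetric] by (simp add: gap_def pair_inner_self_nonneg)

lemma pair_inner_string_kernel:
  assumes "0 \<le> t"
  shows "pair_inner (string_kernel t x) (string_kernel t x) = gap t x"
  using pair_inner_string_kernel_diff[of 0 t x 0] assms by (simp add: pair_lin_def string_kernel_def)

section \<open>Stochastic Fubini theorem\<close>

text \<open>Rounding z down to multiples of 1 / (n + 1) leaves countably many measurable sections,
  and continuity of the paths gives the limit.\<close>

lemma measurable_continuous_paths:
  fixes u :: "real \<Rightarrow> 'w \<Rightarrow> real"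
  assumes meas: "\<And>z. u z \<in> borel_measurable M"
    and cont: "\<And>\<omega>. \<omega> \<in> space M \<Longrightarrow> continuous_on UNIV (\<lambda>z. u z \<omega>)"
  shows "(\<lambda>(z, \<omega>). u z \<omega>) \<in> borel_measurable (borel \<Otimes>\<^sub>M M)"
proof (rule borel_measurable_LIMSEQ_real)
  fix n :: nat
  define g where "g p = \<lfloor>real (Suc n) * fst p\<rfloor>" for p :: "real \<times> 'w"
  have "g \<in> measurable (borel \<Otimes>\<^sub>M M) (count_space UNIV)"
    unfolding g_def by measurable
  moreover have "(\<lambda>p. u (of_int k / real (Suc n)) (snd p)) \<in> borel_measurable (borel \<Otimes>\<^sub>M M)" for k :: int
    by (rule measurable_compose[OF measurable_snd meas])
  ultimately show "(\<lambda>p. u (of_int (g p) / real (Suc n)) (snd p)) \<in> borel_measurable (borel \<Otimes>\<^sub>M M)"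
    by (rule measurable_compose_countable[rotated])
next
  fix p :: "real \<times> 'w" assume "p \<in> space (borel \<Otimes>\<^sub>M M)"
  then obtain z \<omega> where p: "p = (z, \<omega>)" "\<omega> \<in> space M" by (auto simp: space_pair_measure)
  have "(\<lambda>n. of_int \<lfloor>real (Suc n) * z\<rfloor> / real (Suc n)) \<longlonglongrightarrow> z"
  proof (rule LIMSEQ_I)
    fix e :: real assume "e > 0"
    then obtain n0 where n0: "1 / real (Suc n0) < e" using nat_approx_posE by blast
    show "\<exists>n0. \<forall>n\<ge>n0. norm (of_int \<lfloor>real (Suc n) * z\<rfloor> / real (Suc n) - z) < e"
    proof (intro exI allI impI)
      fix n assume "n0 \<le> n"
      have "\<bar>of_int \<lfloor>real (Suc n) * z\<rfloor> - real (Suc n) * z\<bar> \<le> 1" by linarith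
      then have "\<bar>of_int \<lfloor>real (Suc n) * z\<rfloor> - real (Suc n) * z\<bar> / real (Suc n) \<le> 1 / real (Suc n)"
        by (intro divide_right_mono) auto
      also have "\<bar>of_int \<lfloor>real (Suc n) * z\<rfloor> - real (Suc n) * z\<bar> / real (Suc n) = \<bar>(of_int \<lfloor>real (Suc n) * z\<rfloor> - real (Suc n) * z) / real (Suc n)\<bar>"
        by (simp add: abs_divide)
      also have "(of_int \<lfloor>real (Suc n) * z\<rfloor> - real (Suc n) * z) / real (Suc n) = of_int \<lfloor>real (Suc n) * z\<rfloor> / real (Suc n) - z"
        by (simp add: field_simps)
      also have "1 / real (Suc n) \<le> 1 / real (Suc n0)"
        using \<open>n0 \<le> n\<close> by (intro divide_left_mono) auto
      finally show "norm (of_int \<lfloor>real (Suc n) * z\<rfloor> / real (Suc n) - z) < e" using n0 by simp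
    qed
  qed
  moreover have "isCont (\<lambda>z. u z \<omega>) z"
    using cont[OF p(2)] by (simp add: continuous_on_eq_continuous_at)
  ultimately have "(\<lambda>n. u (of_int \<lfloor>real (Suc n) * z\<rfloor> / real (Suc n)) \<omega>) \<longlonglongrightarrow> u z \<omega>"
    by (rule isCont_tendsto_compose[rotated])
  then show "(\<lambda>n. u (of_int \<lfloor>real (Suc n) * fst p\<rfloor> / real (Suc n)) (snd p)) \<longlonglongrightarrow> (case p of (z, \<omega>) \<Rightarrow> u z \<omega>)"
    by (simp add: p)
qed

lemma integrable_pair_snd:
  fixes f :: "'b \<Rightarrow> real"
  assumes "prob_space N" "sigma_finite_measure M" "integrable M f"
  shows "integrable (N \<Otimes>\<^sub>M M) (\<lambda>(z, \<omega>). f \<omega>)"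
proof -
  interpret N: prob_space N by fact
  interpret M: sigma_finite_measure M by fact
  interpret P: pair_sigma_finite N M ..
  have [measurable]: "f \<in> borel_measurable M" using assms by auto
  show ?thesis
    using assms N.emeasure_space_1 by (intro P.Fubini_integrable) auto
qed

lemma (in prob_space) integral_sq_le:
  fixes f :: "'a \<Rightarrow> real"
  assumes "integrable M f" "integrable M (\<lambda>x. (f x)\<^sup>2)"
  shows "(LINT x|M. f x)\<^sup>2 \<le> (LINT x|M. (f x)\<^sup>2)"
  using variance_positive[of f] variance_eq[OF assms] by simp

context gaussian_noise
begin

text \<open>The difference of the two sides is square integrable and orthogonal to every \<open>W h\<close>, hence
  also to itself, because each \<open>u z\<close> is almost surely equal to \<open>W (g z)\<close>.\<close>

lemma noise_Fubini:
  fixes N :: "'z measure" and u :: "'z \<Rightarrow> 'w \<Rightarrow> real"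
  assumes N: "prob_space N"
    and g_meas [measurable]: "(\<lambda>(z, p). g z p) \<in> borel_measurable (N \<Otimes>\<^sub>M lborel)"
    and g: "\<And>z. g z \<in> L2_half_plane"
    and g_int: "(\<integral>\<^sup>+z. ennreal (hp_inner (g z) (g z)) \<partial>N) < \<infinity>"
    and gbar: "gbar \<in> L2_half_plane" "AE p in lborel. p \<in> half_plane \<longrightarrow> gbar p = (LINT z|N. g z p)"
    and u_meas [measurable]: "(\<lambda>(z, \<omega>). u z \<omega>) \<in> borel_measurable (N \<Otimes>\<^sub>M M)"
    and u: "\<And>z. AE \<omega> in M. u z \<omega> = W (g z) \<omega>"
  shows "AE \<omega> in M. integrable N (\<lambda>z. u z \<omega>) \<and> (LINT z|N. u z \<omega>) = W gbar \<omega>"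
proof -
  interpret N: prob_space N by fact
  interpret P: pair_prob_space N M by unfold_locales
  interpret Q: pair_sigma_finite N "lborel :: (real \<times> real) measure" by unfold_locales
  let ?hp = "\<lambda>z. hp_inner (g z) (g z)"
  let ?X = "\<lambda>p. indicator half_plane p :: real"
  have [measurable]: "half_plane \<in> sets borel" by (rule half_plane_borel)
  have hp_meas: "?hp \<in> borel_measurable N"
    unfolding hp_inner_def set_lebesgue_integral_def by measurable
  have hp_int: "integrable N ?hp"
    using g_int hp_meas by (intro integrableI_nonneg) (auto simp: hp_inner_self_nonneg)
  have uz_meas: "u z \<in> borel_measurable M" if "z \<in> space N" for z
    using measurable_compose[OF measurable_Pair1'[OF that] u_meas] by simp
  have u_sq: "(\<integral>\<^sup>+\<omega>. ennreal ((u z \<omega>)\<^sup>2) \<partial>M) = ennreal (?hp z)" if "z \<in> space N" for z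
  proof -
    have "(\<integral>\<^sup>+\<omega>. ennreal ((u z \<omega>)\<^sup>2) \<partial>M) = (\<integral>\<^sup>+\<omega>. ennreal ((W (g z) \<omega>)\<^sup>2) \<partial>M)"
      using u[of z] by (intro nn_integral_cong_AE) auto
    also have "\<dots> = ennreal (?hp z)"
      using noise_square_integrable[OF g] by (subst nn_integral_eq_integral) (auto simp: noise_var[OF g])
    finally show ?thesis .
  qed
  have u2: "integrable (N \<Otimes>\<^sub>M M) (\<lambda>(z, \<omega>). (u z \<omega>)\<^sup>2)"
  proof (rule integrableI_nonneg)
    have "(\<integral>\<^sup>+x. ennreal (case x of (z, \<omega>) \<Rightarrow> (u z \<omega>)\<^sup>2) \<partial>(N \<Otimes>\<^sub>M M)) = (\<integral>\<^sup>+z. (\<integral>\<^sup>+\<omega>. ennreal ((u z \<omega>)\<^sup>2) \<partial>M) \<partial>N)"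
      by (subst nn_integral_fst[symmetric]) auto
    also have "\<dots> = (\<integral>\<^sup>+z. ennreal (?hp z) \<partial>N)"
      by (intro nn_integral_cong u_sq)
    finally show "(\<integral>\<^sup>+x. ennreal (case x of (z, \<omega>) \<Rightarrow> (u z \<omega>)\<^sup>2) \<partial>(N \<Otimes>\<^sub>M M)) < \<infinity>"
      using g_int by simp
  qed auto
  have u2': "integrable (N \<Otimes>\<^sub>M M) (\<lambda>x. (case x of (z, \<omega>) \<Rightarrow> u z \<omega>)\<^sup>2)"
    using u2 by (simp add: case_prod_unfold)
  have u1: "integrable (N \<Otimes>\<^sub>M M) (\<lambda>(z, \<omega>). u z \<omega>)"
    by (rule P.square_integrable_imp_integrable[OF u_meas u2'])
  have AE1: "AE \<omega> in M. integrable N (\<lambda>z. u z \<omega>)"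
    using P.AE_integrable_snd[of u] u1 by simp
  have AE2: "AE \<omega> in M. integrable N (\<lambda>z. (u z \<omega>)\<^sup>2)"
    using P.AE_integrable_snd[of "\<lambda>z \<omega>. (u z \<omega>)\<^sup>2"] u2 by simp
  define I where "I \<omega> = (LINT z|N. u z \<omega>)" for \<omega>
  have [measurable]: "I \<in> borel_measurable M"
    unfolding I_def by measurable
  \<comment> \<open>Jensen's inequality for the probability measure \<open>N\<close>.\<close>
  have I2: "integrable M (\<lambda>\<omega>. (I \<omega>)\<^sup>2)"
  proof (rule Bochner_Integration.integrable_bound)
    show "integrable M (\<lambda>\<omega>. LINT z|N. (u z \<omega>)\<^sup>2)"
      using P.integrable_snd[of "\<lambda>z \<omega>. (u z \<omega>)\<^sup>2"] u2 by simp
    show "AE \<omega> in M. norm ((I \<omega>)\<^sup>2) \<le> norm (LINT z|N. (u z \<omega>)\<^sup>2)"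
      using AE1 AE2
    proof eventually_elim
      case (elim \<omega>)
      then show ?case using N.integral_sq_le[of "\<lambda>z. u z \<omega>"] by (simp add: I_def)
    qed
  qed measurable
  have swap: "(LINT \<omega>|M. I \<omega> * Y \<omega>) = (LINT z|N. LINT \<omega>|M. u z \<omega> * Y \<omega>)"
    if [measurable]: "Y \<in> borel_measurable M" and Y: "integrable M (\<lambda>\<omega>. (Y \<omega>)\<^sup>2)" for Y
  proof -
    have "integrable (N \<Otimes>\<^sub>M M) (\<lambda>p. (case p of (z, \<omega>) \<Rightarrow> u z \<omega>) * (case p of (z, \<omega>) \<Rightarrow> Y \<omega>))"
    proof (rule integrable_mult_of_squares[OF u_meas _ u2'])
      show "integrable (N \<Otimes>\<^sub>M M) (\<lambda>x. (case x of (z, \<omega>) \<Rightarrow> Y \<omega>)\<^sup>2)"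
        using integrable_pair_snd[OF N sigma_finite_measure_axioms Y] by (simp add: case_prod_unfold)
    qed measurable
    then have "integrable (N \<Otimes>\<^sub>M M) (case_prod (\<lambda>z \<omega>. u z \<omega> * Y \<omega>))"
      by (simp add: case_prod_unfold)
    from P.Fubini_integral[OF this] show ?thesis by (simp add: I_def)
  qed
  \<comment> \<open>The same exchange for the kernels, with space-time in place of the probability
    space. Together the two exchanges show that \<open>I\<close> and \<open>W gbar\<close> have the
    same covariance with every \<open>W h\<close>.\<close>
  have swap2: "(LINT z|N. hp_inner (g z) h) = hp_inner gbar h" if h: "h \<in> L2_half_plane" for h
  proof -
    have [measurable]: "(\<lambda>p. ?X p * h p) \<in> borel_measurable lborel" and h2: "integrable lborel (\<lambda>p. (?X p * h p)\<^sup>2)"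
      using h by (auto simp: L2_half_plane_iff)
    have "integrable (N \<Otimes>\<^sub>M lborel) (\<lambda>(z, p). (?X p * g z p)\<^sup>2)"
    proof (rule integrableI_nonneg)
      have "(\<integral>\<^sup>+x. ennreal (case x of (z, p) \<Rightarrow> (?X p * g z p)\<^sup>2) \<partial>(N \<Otimes>\<^sub>M lborel)) = (\<integral>\<^sup>+z. (\<integral>\<^sup>+p. ennreal ((?X p * g z p)\<^sup>2) \<partial>lborel) \<partial>N)"
        by (subst lborel.nn_integral_fst[symmetric]) auto
      also have "\<dots> = (\<integral>\<^sup>+z. ennreal (?hp z) \<partial>N)"
      proof (intro nn_integral_cong)
        fix z
        have "(\<integral>\<^sup>+p. ennreal ((?X p * g z p)\<^sup>2) \<partial>lborel) = ennreal (LINT p|lborel. (?X p * g z p)\<^sup>2)"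
          using g[of z] unfolding L2_half_plane_iff by (intro nn_integral_eq_integral) auto
        also have "(LINT p|lborel. (?X p * g z p)\<^sup>2) = ?hp z"
          unfolding hp_inner_def set_lebesgue_integral_def
          by (intro Bochner_Integration.integral_cong) (auto simp: power2_eq_square split: split_indicator)
        finally show "(\<integral>\<^sup>+p. ennreal ((?X p * g z p)\<^sup>2) \<partial>lborel) = ennreal (?hp z)" .
      qed
      finally show "(\<integral>\<^sup>+x. ennreal (case x of (z, p) \<Rightarrow> (?X p * g z p)\<^sup>2) \<partial>(N \<Otimes>\<^sub>M lborel)) < \<infinity>"
        using g_int by simp
    qed auto
    then have g2: "integrable (N \<Otimes>\<^sub>M lborel) (\<lambda>x. (case x of (z, p) \<Rightarrow> ?X p * g z p)\<^sup>2)"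
      by (simp add: case_prod_unfold)
    have "integrable (N \<Otimes>\<^sub>M lborel) (\<lambda>q. (case q of (z, p) \<Rightarrow> ?X p * g z p) * (case q of (z, p) \<Rightarrow> ?X p * h p))"
    proof (rule integrable_mult_of_squares[OF _ _ g2])
      show "integrable (N \<Otimes>\<^sub>M lborel) (\<lambda>x. (case x of (z, p) \<Rightarrow> ?X p * h p)\<^sup>2)"
        using integrable_pair_snd[OF N lborel.sigma_finite_measure_axioms h2] by (simp add: case_prod_unfold)
    qed measurable
    then have "integrable (N \<Otimes>\<^sub>M lborel) (case_prod (\<lambda>z p. (?X p * g z p) * (?X p * h p)))"
      by (simp add: case_prod_unfold)
    from Q.Fubini_integral[OF this]
    have "(LINT z|N. LINT p|lborel. (?X p * g z p) * (?X p * h p)) = (LINT p|lborel. LINT z|N. (?X p * g z p) * (?X p * h p))"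
      by simp
    also have "(LINT z|N. LINT p|lborel. (?X p * g z p) * (?X p * h p)) = (LINT z|N. hp_inner (g z) h)"
      unfolding hp_inner_def set_lebesgue_integral_def
      by (intro Bochner_Integration.integral_cong) (auto split: split_indicator)
    also have "(LINT p|lborel. LINT z|N. (?X p * g z p) * (?X p * h p)) = (LINT p|lborel. (LINT z|N. g z p) * (?X p * h p))"
      by (intro Bochner_Integration.integral_cong) (auto split: split_indicator)
    also have "\<dots> = (LINT p|lborel. (?X p * gbar p) * (?X p * h p))"
    proof (intro integral_cong_AE)
      show "(\<lambda>p. ?X p * gbar p * (?X p * h p)) \<in> borel_measurable lborel"
        using gbar(1) h unfolding L2_half_plane_iff by (elim conjE, intro borel_measurable_times[of _ _ "\<lambda>p. ?X p * h p"])
      show "AE p in lborel. (LINT z|N. g z p) * (?X p * h p) = ?X p * gbar p * (?X p * h p)"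
        using gbar(2) by eventually_elim (auto split: split_indicator)
    qed measurable
    also have "\<dots> = hp_inner gbar h"
      unfolding hp_inner_def set_lebesgue_integral_def
      by (intro Bochner_Integration.integral_cong) (auto split: split_indicator)
    finally show ?thesis .
  qed
  let ?D = "\<lambda>\<omega>. I \<omega> - W gbar \<omega>"
  note [measurable] = noise_measurable[OF gbar(1)]
  have IW: "integrable M (\<lambda>\<omega>. I \<omega> * W h \<omega>)" if "h \<in> L2_half_plane" for h
    by (intro integrable_mult_of_squares I2 noise_square_integrable that) (use noise_measurable[OF that] in auto)
  have D2: "integrable M (\<lambda>\<omega>. (?D \<omega>)\<^sup>2)"
    unfolding power2_diff using I2 IW[OF gbar(1)] noise_square_integrable[OF gbar(1)] by (simp add: mult.assoc)
  have ortho: "(LINT \<omega>|M. ?D \<omega> * W h \<omega>) = 0" if h: "h \<in> L2_half_plane" for h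
  proof -
    have "(LINT \<omega>|M. ?D \<omega> * W h \<omega>) = (LINT \<omega>|M. I \<omega> * W h \<omega>) - (LINT \<omega>|M. W gbar \<omega> * W h \<omega>)"
      unfolding left_diff_distrib using IW[OF h] noise_mult_integrable[OF gbar(1) h] by simp
    also have "(LINT \<omega>|M. I \<omega> * W h \<omega>) = (LINT z|N. LINT \<omega>|M. u z \<omega> * W h \<omega>)"
      using noise_measurable[OF h] noise_square_integrable[OF h] by (rule swap)
    also have "\<dots> = (LINT z|N. hp_inner (g z) h)"
    proof (intro Bochner_Integration.integral_cong refl)
      fix z assume "z \<in> space N"
      then have "(LINT \<omega>|M. u z \<omega> * W h \<omega>) = (LINT \<omega>|M. W (g z) \<omega> * W h \<omega>)"
        using u[of z] uz_meas noise_measurable[OF h] noise_measurable[OF g] by (intro integral_cong_AE) auto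
      then show "(LINT \<omega>|M. u z \<omega> * W h \<omega>) = hp_inner (g z) h" by (simp add: noise_cov[OF g h])
    qed
    finally show ?thesis by (simp add: swap2[OF h] noise_cov[OF gbar(1) h])
  qed
  have DI: "integrable M (\<lambda>\<omega>. ?D \<omega> * I \<omega>)" "integrable M (\<lambda>\<omega>. ?D \<omega> * W gbar \<omega>)"
    by (intro integrable_mult_of_squares D2 I2 noise_square_integrable gbar; measurable)+
  have "(LINT \<omega>|M. (?D \<omega>)\<^sup>2) = (LINT \<omega>|M. ?D \<omega> * I \<omega> - ?D \<omega> * W gbar \<omega>)"
    by (intro Bochner_Integration.integral_cong) (auto simp: power2_eq_square algebra_simps)
  also have "\<dots> = (LINT \<omega>|M. I \<omega> * ?D \<omega>)"
    using DI ortho[OF gbar(1)] by (simp add: mult.commute)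
  also have "\<dots> = (LINT z|N. LINT \<omega>|M. u z \<omega> * ?D \<omega>)"
    using D2 by (intro swap) auto
  also have "\<dots> = (LINT z|N. 0)"
  proof (intro Bochner_Integration.integral_cong refl)
    fix z assume "z \<in> space N"
    then have "(LINT \<omega>|M. u z \<omega> * ?D \<omega>) = (LINT \<omega>|M. ?D \<omega> * W (g z) \<omega>)"
      using u[of z] uz_meas noise_measurable[OF g] by (intro integral_cong_AE) auto
    then show "(LINT \<omega>|M. u z \<omega> * ?D \<omega>) = 0" by (simp add: ortho[OF g])
  qed
  finally have "(LINT \<omega>|M. (?D \<omega>)\<^sup>2) = 0" by simp
  then have "AE \<omega> in M. (?D \<omega>)\<^sup>2 = 0"
    using integral_nonneg_eq_0_iff_AE[OF D2] by simp
  with AE1 show ?thesis by eventually_elim (simp add: I_def)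
qed

lemma noise_zero: "AE \<omega> in M. W (\<lambda>_. 0) \<omega> = 0"
  using noise_lin[OF zero_in_L2_half_plane zero_in_L2_half_plane, of 0 0] by simp

end

section \<open>The string as a Gaussian integral of its kernel\<close>

lemma integrable_vec:
  fixes f :: "'a \<Rightarrow> real ^ 'n"
  assumes "\<And>i. integrable M (\<lambda>x. f x $ i)" shows "integrable M f"
proof -
  have "integrable M (\<lambda>x. \<Sum>i\<in>UNIV. (f x $ i) *\<^sub>R axis i 1)"
    using assms by (intro Bochner_Integration.integrable_sum integrable_scaleR_left) auto
  moreover have "(\<lambda>x. \<Sum>i\<in>UNIV. (f x $ i) *\<^sub>R axis i 1) = f"
  proof
    fix x show "(\<Sum>i\<in>UNIV. (f x $ i) *\<^sub>R axis i 1) = f x"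
      using basis_expansion[of "f x"] by (simp add: scalar_mult_eq_scaleR)
  qed
  ultimately show ?thesis by (rule back_subst[where P = "integrable M"])
qed

context stationary_pinned_string
begin

lemma initial_repr: "AE \<omega> in M. U 0 z \<omega> $ i = W' i (initial_kernel 0 z) \<omega>"
  using U_initial[of z] by eventually_elim (simp add: noise_integral_def initial_kernel_def)

text \<open>Smoothing is an expectation over z with density \<open>heat_kernel t (x - z)\<close>, so
  \<open>noise_Fubini\<close> applies. Averaging the initial kernel gives
  \<open>heat_kernel (t + r)\<close> by the semigroup property and keeps the pinning term because
  the density has mass 1.\<close>

lemma initial_smoothed:
  assumes t: "0 < t"
  shows "AE \<omega> in M. integrable lborel (\<lambda>z. heat_kernel t (x - z) * U 0 z \<omega> $ i)
    \<and> (LINT z|lborel. heat_kernel t (x - z) * U 0 z \<omega> $ i) = W' i (initial_kernel t x) \<omega>"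
proof -
  let ?N = "density lborel (\<lambda>z. heat_kernel t (x - z))"
  have N: "prob_space ?N"
    using prob_space_normal_density[of "sqrt (2 * t)" x] t
    by (simp add: heat_kernel_eq_normal_density normal_density_def power2_commute)
  have int_N: "integrable ?N f \<longleftrightarrow> integrable lborel (\<lambda>z. heat_kernel t (x - z) * f z)"
    "(LINT z|?N. f z) = (LINT z|lborel. heat_kernel t (x - z) * f z)"
    if "f \<in> borel_measurable borel" for f :: "real \<Rightarrow> real"
    using that t by (auto simp: integrable_density integral_density heat_kernel_nonneg)
  have cont: "continuous_on UNIV (\<lambda>z. U 0 z \<omega> $ i)" if "\<omega> \<in> space M" for \<omega>
    by (intro continuous_on_component continuous_on_compose2[OF U_continuous[OF that, unfolded case_prod_unfold], of UNIV "\<lambda>z. (0, z)", simplified] continuous_intros) auto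
  have joint: "(\<lambda>(z, \<omega>). U 0 z \<omega> $ i) \<in> borel_measurable (borel \<Otimes>\<^sub>M M)"
    using measurable_compose[OF U_measurable[of 0] borel_measurable_nth] cont
    by (intro measurable_continuous_paths) auto
  have "AE \<omega> in M. integrable ?N (\<lambda>z. U 0 z \<omega> $ i) \<and> (LINT z|?N. U 0 z \<omega> $ i) = W' i (initial_kernel t x) \<omega>"
  proof (rule initial.noise_Fubini[OF N, where g = "initial_kernel 0"])
    show "(\<lambda>(z, p). initial_kernel 0 z p) \<in> borel_measurable (?N \<Otimes>\<^sub>M lborel)"
      unfolding initial_kernel_def borel_prod[symmetric] lborel_prod[symmetric] by measurable
    show L2: "initial_kernel 0 z \<in> L2_half_plane" for z
      using string_kernel_L2[of 0 z] by (simp add: string_kernel_def)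
    show "initial_kernel t x \<in> L2_half_plane"
      using string_kernel_L2[of t x] t by (simp add: string_kernel_def)
    \<comment> \<open>The variance of U_0(z) grows at most like |z|, and the normal law centered at
      x has a finite first absolute moment.\<close>
    have hp: "hp_inner (initial_kernel 0 z) (initial_kernel 0 z) \<le> \<bar>z - x\<bar> + \<bar>x\<bar>" for z
      using pair_inner_string_kernel[of 0 z] gap_upper[of 0 z] abs_triangle_ineq[of "z - x" x]
      by (simp add: pair_inner_def string_kernel_def hp_inner_def[of "\<lambda>_. 0"])
    have int: "integrable ?N (\<lambda>z. \<bar>z - x\<bar> + \<bar>x\<bar>)"
    proof (intro Bochner_Integration.integrable_add)
      have "integrable lborel (\<lambda>z. normal_density x (sqrt (2 * t)) z * \<bar>z - x\<bar> ^ 1)"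
        using t by (intro integrable_normal_moment_abs) simp
      then show "integrable ?N (\<lambda>z. \<bar>z - x\<bar>)"
        using t by (subst int_N) (auto simp: heat_kernel_eq_normal_density normal_density_def power2_commute)
      show "integrable ?N (\<lambda>z. \<bar>x\<bar>)"
        using N by (simp add: prob_space.finite_measure finite_measure.integrable_const)
    qed
    have "(\<integral>\<^sup>+z. ennreal (hp_inner (initial_kernel 0 z) (initial_kernel 0 z)) \<partial>?N) \<le> (\<integral>\<^sup>+z. ennreal (\<bar>z - x\<bar> + \<bar>x\<bar>) \<partial>?N)"
      by (intro nn_integral_mono ennreal_leI hp)
    also have "\<dots> < \<infinity>" using int by (subst nn_integral_eq_integral) auto
    finally show "(\<integral>\<^sup>+z. ennreal (hp_inner (initial_kernel 0 z) (initial_kernel 0 z)) \<partial>?N) < \<infinity>" .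
    have gbar: "initial_kernel t x (r, w) = (LINT z|?N. initial_kernel 0 z (r, w))" if "0 < r" for r w
    proof -
      have "has_bochner_integral lborel
         (\<lambda>z. heat_kernel t (x - z) * heat_kernel r (w - z) - heat_kernel t (x - z) * heat_kernel r w)
         (heat_kernel (t + r) (x - w) - 1 * heat_kernel r w)"
        using t that by (intro has_bochner_integral_diff has_bochner_integral_heat_kernel_conv has_bochner_integral_mult_left has_bochner_integral_heat_kernel)
      then have "(LINT z|lborel. heat_kernel t (x - z) * (heat_kernel r (z - w) - heat_kernel r w)) = initial_kernel t x (r, w)"
        by (simp add: has_bochner_integral_iff initial_kernel_def right_diff_distrib heat_kernel_even[of r w])
      then show ?thesis
        by (subst int_N) (auto simp: initial_kernel_def)
    qed
    \<comment> \<open>The identity \<open>gbar\<close> is restricted to r > 0, since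
      \<open>heat_kernel 0\<close> is 0 instead of a point mass; the line r = 0 is a null
      set.\<close>
    have "AE p in lborel \<Otimes>\<^sub>M lborel. fst p \<noteq> (0::real)"
    proof (rule lborel_pair.AE_pair_measure)
      show "{p \<in> space (lborel \<Otimes>\<^sub>M lborel). fst p \<noteq> (0::real)} \<in> sets (lborel \<Otimes>\<^sub>M lborel)"
        by measurable
      show "AE r in lborel. AE w in lborel. fst (r, w) \<noteq> (0::real)"
        using AE_lborel_singleton[of "0::real"] by eventually_elim simp
    qed
    then have "AE p in lborel. fst p \<noteq> (0::real)" by (simp only: lborel_prod)
    then show "AE p in lborel. p \<in> half_plane \<longrightarrow> initial_kernel t x p = (LINT z|?N. initial_kernel 0 z p)"
      by eventually_elim (auto simp: gbar)
    show "(\<lambda>(z, \<omega>). U 0 z \<omega> $ i) \<in> borel_measurable (?N \<Otimes>\<^sub>M M)"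
    proof -
      have "sets (?N \<Otimes>\<^sub>M M) = sets (borel \<Otimes>\<^sub>M M)" by (intro sets_pair_measure_cong) simp_all
      from measurable_cong_sets[OF this refl] joint show ?thesis by blast
    qed
    show "AE \<omega> in M. U 0 z \<omega> $ i = W' i (initial_kernel 0 z) \<omega>" for z
      by (rule initial_repr)
  qed
  with AE_space show ?thesis
  proof eventually_elim
    case (elim \<omega>)
    have "(\<lambda>z. U 0 z \<omega> $ i) \<in> borel_measurable borel"
      using cont[OF elim(1)] by (rule borel_measurable_continuous_onI)
    then show ?case using elim(2) by (simp add: int_N)
  qed
qed

lemma string_repr:
  assumes "0 \<le> t"
  shows "AE \<omega> in M. U t x \<omega> $ i = pair_noise i (string_kernel t x) \<omega>"
proof (cases "t = 0")
  case True
  show ?thesis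
    using initial_repr[of x i] evolution.noise_zero[of i]
    unfolding True pair_noise_def string_kernel_def by eventually_elim simp
next
  case False
  with assms have t: "0 < t" by simp
  \<comment> \<open>All components are treated at once: a component may be taken inside the
    vector-valued integral when the whole integrand is integrable.\<close>
  have "AE \<omega> in M. \<forall>j\<in>UNIV. integrable lborel (\<lambda>z. heat_kernel t (x - z) * U 0 z \<omega> $ j)
    \<and> (LINT z|lborel. heat_kernel t (x - z) * U 0 z \<omega> $ j) = W' j (initial_kernel t x) \<omega>"
    using initial_smoothed[OF t, of x] by (intro AE_finite_allI) auto
  with U_evolution[OF t, of x] show ?thesis
  proof eventually_elim
    case (elim \<omega>)
    have int: "integrable lborel (\<lambda>z. heat_kernel t (x - z) *\<^sub>R U 0 z \<omega>)"
      using elim(2) by (intro integrable_vec) auto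
    have "(LINT z|lborel. heat_kernel t (x - z) *\<^sub>R U 0 z \<omega>) $ i = (LINT z|lborel. (heat_kernel t (x - z) *\<^sub>R U 0 z \<omega>) $ i)"
      by (rule integral_bounded_linear[OF bounded_linear_vec_nth int, symmetric])
    then show ?case
      using elim by (simp add: noise_integral_def pair_noise_def string_kernel_def evolution_kernel_def)
  qed
qed

end

section \<open>Distribution of the string\<close>

context stationary_pinned_string
begin

lemma increment_component_tail:
  assumes "0 \<le> s" "s \<le> t" "0 < l"
  shows "prob {\<omega> \<in> space M. l \<le> \<bar>U t x \<omega> $ i - U s y \<omega> $ i\<bar>}
    \<le> 2 * (fact (2 * k) / (2 ^ k * fact k)) * (4 * gap (t - s) (x - y) / l\<^sup>2) ^ k"
proof -
  let ?H = "string_increment t x s y"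
  have L2: "string_kernel t x \<in> L2_pairs" "string_kernel s y \<in> L2_pairs"
    using assms by (auto intro!: string_kernel_L2)
  note H = pair_lin_L2[OF L2, of 1 "-1"]
  note [measurable] = measurable_compose[OF U_measurable[OF order_trans[OF assms(1,2)]] borel_measurable_nth]
    measurable_compose[OF U_measurable[OF assms(1)] borel_measurable_nth] pair_noise_measurable[OF H]
  have "prob {\<omega> \<in> space M. l \<le> \<bar>U t x \<omega> $ i - U s y \<omega> $ i\<bar>} = prob {\<omega> \<in> space M. l \<le> \<bar>pair_noise i ?H \<omega>\<bar>}"
  proof (rule measure_eq_AE)
    show "AE \<omega> in M. \<omega> \<in> {\<omega> \<in> space M. l \<le> \<bar>U t x \<omega> $ i - U s y \<omega> $ i\<bar>} \<longleftrightarrow> \<omega> \<in> {\<omega> \<in> space M. l \<le> \<bar>pair_noise i ?H \<omega>\<bar>}"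
      using string_repr[OF order_trans[OF assms(1,2)], of x i] string_repr[OF assms(1), of y i] pair_noise_lin[OF L2, of i 1 "-1"]
      by eventually_elim simp
  qed measurable
  also have "\<dots> \<le> 2 * (fact (2 * k) / (2 ^ k * fact k)) * (4 * pair_inner ?H ?H / l\<^sup>2) ^ k"
    using H assms(3) by (rule pair_noise_tail)
  finally show ?thesis using assms by (simp only: pair_inner_string_kernel_diff)
qed

text \<open>If all components stayed below l / d in modulus, the norm would be below l. The level l
  / d is the origin of the factor d^2.\<close>

lemma increment_tail:
  assumes "0 \<le> s" "s \<le> t" "0 < l"
  shows "prob {\<omega> \<in> space M. l \<le> norm (U t x \<omega> - U s y \<omega>)}
    \<le> real (CARD('d)) * (2 * (fact (2 * k) / (2 ^ k * fact k)) * (4 * (real (CARD('d)))\<^sup>2 * gap (t - s) (x - y) / l\<^sup>2) ^ k)"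
proof -
  let ?d = "real (CARD('d))"
  have d: "0 < ?d" by simp
  note [measurable] = measurable_compose[OF U_measurable[OF order_trans[OF assms(1,2)]] borel_measurable_nth]
    measurable_compose[OF U_measurable[OF assms(1)] borel_measurable_nth]
  have "{\<omega> \<in> space M. l \<le> norm (U t x \<omega> - U s y \<omega>)} \<subseteq> (\<Union>i. {\<omega> \<in> space M. l / ?d \<le> \<bar>U t x \<omega> $ i - U s y \<omega> $ i\<bar>})"
  proof safe
    fix \<omega> assume \<omega>: "\<omega> \<in> space M" "l \<le> norm (U t x \<omega> - U s y \<omega>)"
    show "\<omega> \<in> (\<Union>i. {\<omega> \<in> space M. l / ?d \<le> \<bar>U t x \<omega> $ i - U s y \<omega> $ i\<bar>})"
    proof (rule ccontr)
      assume "\<not> ?thesis"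
      then have less: "\<bar>(U t x \<omega> - U s y \<omega>) $ i\<bar> < l / ?d" for i using \<omega>(1) by (auto simp: not_le)
      have "norm (U t x \<omega> - U s y \<omega>) \<le> (\<Sum>i\<in>UNIV. \<bar>(U t x \<omega> - U s y \<omega>) $ i\<bar>)" by (rule norm_le_l1_cart)
      also have "\<dots> < (\<Sum>i\<in>(UNIV :: 'd set). l / ?d)" using less by (intro sum_strict_mono) auto
      finally show False using \<omega>(2) by simp
    qed
  qed
  then have "prob {\<omega> \<in> space M. l \<le> norm (U t x \<omega> - U s y \<omega>)} \<le> prob (\<Union>i. {\<omega> \<in> space M. l / ?d \<le> \<bar>U t x \<omega> $ i - U s y \<omega> $ i\<bar>})"
    using assms by (intro finite_measure_mono) measurable
  also have "\<dots> \<le> (\<Sum>i\<in>UNIV. prob {\<omega> \<in> space M. l / ?d \<le> \<bar>U t x \<omega> $ i - U s y \<omega> $ i\<bar>})"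
    using assms by (intro finite_measure_subadditive_finite) auto
  also have "\<dots> \<le> (\<Sum>i\<in>(UNIV :: 'd set). 2 * (fact (2 * k) / (2 ^ k * fact k)) * (4 * gap (t - s) (x - y) / (l / ?d)\<^sup>2) ^ k)"
    using assms d by (intro sum_mono increment_component_tail) (auto intro!: divide_pos_pos)
  also have "4 * gap (t - s) (x - y) / (l / ?d)\<^sup>2 = 4 * ?d\<^sup>2 * gap (t - s) (x - y) / l\<^sup>2"
    using d assms by (simp add: power_divide)
  finally show ?thesis by simp
qed

lemma expectation_prod_pair_noise:
  fixes f :: "real \<times> real \<Rightarrow> real"
  assumes HK: "H \<in> L2_pairs" "K \<in> L2_pairs"
    and [measurable]: "f \<in> borel_measurable (borel \<Otimes>\<^sub>M borel)" and bound: "\<And>x. \<bar>f x\<bar> \<le> 1"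
  shows "(LINT \<omega>|M. (\<Prod>i\<in>UNIV. f (pair_noise i H \<omega>, pair_noise i K \<omega>)))
    = (\<Prod>i\<in>UNIV. (LINT \<omega>|M. f (pair_noise i H \<omega>, pair_noise i K \<omega>)))"
proof (rule indep_vars_lebesgue_integral)
  show "indep_vars (\<lambda>_. borel) (\<lambda>i \<omega>. f (pair_noise i H \<omega>, pair_noise i K \<omega>)) UNIV"
    using indep_vars_compose2[OF indep_pair_noise[OF HK], where Y = "\<lambda>_. f" and N = "\<lambda>_. borel"] by simp
  note [measurable] = pair_noise_measurable[OF HK(1)] pair_noise_measurable[OF HK(2)]
  show "integrable M (\<lambda>\<omega>. f (pair_noise i H \<omega>, pair_noise i K \<omega>))" for i
    using bound by (intro integrable_const_bound[where B = 1]) auto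
qed simp

lemma exp_sq_norm_eq_prod: "exp (- (l * (norm v)\<^sup>2 / 2)) = (\<Prod>i\<in>UNIV. exp (- (l * (v $ i)\<^sup>2 / 2)))" for v :: "real ^ 'n"
proof -
  have "(norm v)\<^sup>2 = (\<Sum>i\<in>UNIV. (v $ i)\<^sup>2)"
    unfolding power2_norm_eq_inner inner_vec_def inner_real_def by (simp only: power2_eq_square)
  then have "- (l * (norm v)\<^sup>2 / 2) = (\<Sum>i\<in>UNIV. - (l * (v $ i)\<^sup>2 / 2))"
    by (simp only: sum_negf sum_divide_distrib sum_distrib_left)
  then show ?thesis by (simp only: exp_sum[OF finite_class.finite_UNIV])
qed

lemma string_repr_all:
  "0 \<le> t \<Longrightarrow> AE \<omega> in M. \<forall>i. U t x \<omega> $ i = pair_noise i (string_kernel t x) \<omega>"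
  using AE_finite_allI[OF finite_class.finite_UNIV string_repr[of t x]] by simp

lemma expectation_exp_sq_pair_noise:
  assumes "H \<in> L2_pairs" "0 \<le> l"
  shows "(LINT \<omega>|M. exp (- (l * (pair_noise i H \<omega>)\<^sup>2 / 2))) = 1 / sqrt (1 + l * pair_inner H H)"
  using assms by (intro integral_exp_sq_gaussian pair_noise_measurable pair_noise_char pair_inner_self_nonneg)

lemma expectation_exp_sq_norm:
  assumes t: "0 \<le> t" and l: "0 \<le> l"
  shows "(LINT \<omega>|M. exp (- (l * (norm (U t x \<omega>))\<^sup>2 / 2))) = (1 / sqrt (1 + l * gap t x)) ^ CARD('d)"
proof -
  let ?H = "string_kernel t x"
  note H = string_kernel_L2[OF t, of x]
  note [measurable] = U_measurable[OF t] pair_noise_measurable[OF H]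
  have "(LINT \<omega>|M. exp (- (l * (norm (U t x \<omega>))\<^sup>2 / 2)))
     = (LINT \<omega>|M. (\<Prod>i\<in>UNIV. exp (- (l * (fst (pair_noise i ?H \<omega>, pair_noise i ?H \<omega>))\<^sup>2 / 2))))"
  proof (rule integral_cong_AE)
    show "AE \<omega> in M. exp (- (l * (norm (U t x \<omega>))\<^sup>2 / 2)) = (\<Prod>i\<in>UNIV. exp (- (l * (fst (pair_noise i ?H \<omega>, pair_noise i ?H \<omega>))\<^sup>2 / 2)))"
      using string_repr_all[OF t, of x] by eventually_elim (simp add: exp_sq_norm_eq_prod)
  qed auto
  also have "\<dots> = (\<Prod>i\<in>(UNIV :: 'd set). (LINT \<omega>|M. exp (- (l * (fst (pair_noise i ?H \<omega>, pair_noise i ?H \<omega>))\<^sup>2 / 2))))"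
    using l by (intro expectation_prod_pair_noise[where f = "\<lambda>p. exp (- (l * (fst p)\<^sup>2 / 2))", OF H H]) auto
  also have "\<dots> = (1 / sqrt (1 + l * gap t x)) ^ CARD('d)"
    using expectation_exp_sq_pair_noise[OF H l] pair_inner_string_kernel[OF t, of x] by simp
  finally show ?thesis .
qed

text \<open>An exponential Markov inequality with l = 1 / r^2: on the event the integrand is at
  least exp (- 1/2), and the product of d one-dimensional transforms supplies the power d.\<close>

lemma small_ball:
  assumes t: "0 \<le> t" and r: "0 < r" and g: "0 < gap t x"
  shows "prob {\<omega> \<in> space M. norm (U t x \<omega>) \<le> r} \<le> exp (1 / 2) * (r / sqrt (gap t x)) ^ CARD('d)"
proof -
  note [measurable] = U_measurable[OF t]
  define l where "l = 1 / r\<^sup>2"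
  have l: "0 \<le> l" by (simp add: l_def)
  have int: "integrable M (\<lambda>\<omega>. exp (- (l * (norm (U t x \<omega>))\<^sup>2 / 2)))"
    using l by (intro integrable_const_bound[where B = 1]) auto
  have "prob {\<omega> \<in> space M. norm (U t x \<omega>) \<le> r} \<le> prob {\<omega> \<in> space M. exp (- (1 / 2)) \<le> exp (- (l * (norm (U t x \<omega>))\<^sup>2 / 2))}"
  proof (intro finite_measure_mono subsetI CollectI conjI)
    fix \<omega> assume "\<omega> \<in> {\<omega> \<in> space M. norm (U t x \<omega>) \<le> r}"
    then have "(norm (U t x \<omega>))\<^sup>2 \<le> r\<^sup>2" by (intro power_mono) auto
    then have "l * (norm (U t x \<omega>))\<^sup>2 \<le> 1" using r by (simp add: l_def)
    then show "exp (- (1 / 2)) \<le> exp (- (l * (norm (U t x \<omega>))\<^sup>2 / 2))" by simp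
  qed auto
  also have "\<dots> \<le> (LINT \<omega>|M. exp (- (l * (norm (U t x \<omega>))\<^sup>2 / 2))) / exp (- (1 / 2))"
    by (intro integral_Markov_inequality_measure[where A = "space M"] int) auto
  also have "\<dots> = exp (1 / 2) * (1 / sqrt (1 + l * gap t x)) ^ CARD('d)"
  proof -
    have e: "exp (- (1 / 2)) = 1 / exp (1 / 2 :: real)" by (rule exp_minus[unfolded inverse_eq_divide])
    have "y / exp (- (1 / 2)) = exp (1 / 2) * y" for y :: real unfolding e by simp
    then show ?thesis unfolding expectation_exp_sq_norm[OF t l] .
  qed
  also have "\<dots> \<le> exp (1 / 2) * (r / sqrt (gap t x)) ^ CARD('d)"
  proof (intro mult_left_mono power_mono)
    have "1 / sqrt (1 + l * gap t x) \<le> 1 / sqrt (l * gap t x)"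
      using g r by (intro divide_left_mono) (auto simp: l_def intro!: mult_pos_pos add_pos_pos)
    also have "sqrt (l * gap t x) = sqrt (gap t x) / r"
      using r by (simp add: l_def real_sqrt_divide)
    finally show "1 / sqrt (1 + l * gap t x) \<le> r / sqrt (gap t x)" by simp
  qed (use l g in auto)
  finally show ?thesis .
qed

text \<open>Independence of the components gives products of d factors from [0, 1]. Such products
  differ by at most the sum of the differences of their factors, whence the factor d.\<close>

lemma covariance_exp_sq_norm:
  assumes t: "0 \<le> t" "0 \<le> s" and l: "0 \<le> l" "0 \<le> m"
  shows "\<bar>(LINT \<omega>|M. exp (- (l * (norm (U t x \<omega>))\<^sup>2 / 2)) * exp (- (m * (norm (U s y \<omega>))\<^sup>2 / 2)))
      - (1 / sqrt (1 + l * gap t x)) ^ CARD('d) * (1 / sqrt (1 + m * gap s y)) ^ CARD('d)\<bar>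
    \<le> CARD('d) * (sqrt l * sqrt m * \<bar>pair_inner (string_kernel t x) (string_kernel s y)\<bar>)"
proof -
  let ?H = "string_kernel t x" and ?K = "string_kernel s y"
  note H = string_kernel_L2[OF t(1), of x] and K = string_kernel_L2[OF t(2), of y]
  note [measurable] = U_measurable[OF t(1)] U_measurable[OF t(2)] pair_noise_measurable[OF H] pair_noise_measurable[OF K]
  define e where "e i = (LINT \<omega>|M. exp (- (l * (pair_noise i ?H \<omega>)\<^sup>2 / 2)) * exp (- (m * (pair_noise i ?K \<omega>)\<^sup>2 / 2)))" for i :: 'd
  define e' where "e' = 1 / sqrt (1 + l * gap t x) * (1 / sqrt (1 + m * gap s y))"
  have e01: "0 \<le> e i" "e i \<le> 1" for i
  proof -
    show "0 \<le> e i" unfolding e_def by (intro integral_nonneg_AE) auto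
    have "e i \<le> (LINT \<omega>|M. 1)" unfolding e_def using l
      by (intro integral_mono integrable_const_bound[where B = 1]) (auto simp: abs_mult intro!: mult_le_one)
    then show "e i \<le> 1" by (simp add: prob_space)
  qed
  have e'01: "0 \<le> e'" "e' \<le> 1"
  proof -
    have *: "1 / sqrt (1 + u) \<le> 1" if "0 \<le> u" for u :: real using that by simp
    have nn: "0 \<le> l * gap t x" "0 \<le> m * gap s y" using l gap_nonneg by auto
    show "0 \<le> e'" using nn by (auto simp: e'_def)
    show "e' \<le> 1" unfolding e'_def using nn by (intro mult_le_one * divide_nonneg_nonneg real_sqrt_ge_zero add_nonneg_nonneg zero_le_one)
  qed
  have "(LINT \<omega>|M. exp (- (l * (norm (U t x \<omega>))\<^sup>2 / 2)) * exp (- (m * (norm (U s y \<omega>))\<^sup>2 / 2)))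
     = (LINT \<omega>|M. (\<Prod>i\<in>UNIV. (\<lambda>p. exp (- (l * (fst p)\<^sup>2 / 2)) * exp (- (m * (snd p)\<^sup>2 / 2))) (pair_noise i ?H \<omega>, pair_noise i ?K \<omega>)))"
  proof (rule integral_cong_AE)
    show "AE \<omega> in M. exp (- (l * (norm (U t x \<omega>))\<^sup>2 / 2)) * exp (- (m * (norm (U s y \<omega>))\<^sup>2 / 2)) =
       (\<Prod>i\<in>UNIV. (\<lambda>p. exp (- (l * (fst p)\<^sup>2 / 2)) * exp (- (m * (snd p)\<^sup>2 / 2))) (pair_noise i ?H \<omega>, pair_noise i ?K \<omega>))"
      using string_repr_all[OF t(1), of x] string_repr_all[OF t(2), of y]
      by eventually_elim (simp add: exp_sq_norm_eq_prod prod.distrib)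
  qed auto
  also have "\<dots> = (\<Prod>i\<in>(UNIV :: 'd set). (LINT \<omega>|M. (\<lambda>p. exp (- (l * (fst p)\<^sup>2 / 2)) * exp (- (m * (snd p)\<^sup>2 / 2))) (pair_noise i ?H \<omega>, pair_noise i ?K \<omega>)))"
    using l by (intro expectation_prod_pair_noise[OF H K]) (auto simp: abs_mult intro!: mult_le_one)
  also have "\<dots> = (\<Prod>i\<in>UNIV. e i)" by (simp add: e_def)
  finally have 1: "(LINT \<omega>|M. exp (- (l * (norm (U t x \<omega>))\<^sup>2 / 2)) * exp (- (m * (norm (U s y \<omega>))\<^sup>2 / 2))) = (\<Prod>i\<in>UNIV. e i)" .
  have "\<bar>e i - e'\<bar> \<le> sqrt l * sqrt m * \<bar>pair_inner ?H ?K\<bar>" for i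
    unfolding e_def e'_def pair_inner_string_kernel[OF t(1), symmetric] pair_inner_string_kernel[OF t(2), symmetric]
  proof (rule covariance_exp_sq_gaussian)
    fix a b :: real
    note [measurable] = pair_noise_measurable[OF pair_lin_L2[OF H K, of a b], of i]
    have "distr M borel (\<lambda>\<omega>. a * pair_noise i ?H \<omega> + b * pair_noise i ?K \<omega>) = distr M borel (pair_noise i (pair_lin a ?H b ?K))"
      using pair_noise_lin[OF H K, of i a b] by (intro distr_cong_AE) (auto elim: eventually_mono)
    then show "char (distr M borel (\<lambda>\<omega>. a * pair_noise i ?H \<omega> + b * pair_noise i ?K \<omega>)) 1
       = complex_of_real (exp (- (a\<^sup>2 * pair_inner ?H ?H + 2 * a * b * pair_inner ?H ?K + b\<^sup>2 * pair_inner ?K ?K) / 2))"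
      using pair_noise_char[OF pair_lin_L2[OF H K, of a b], of i 1] pair_inner_lin_self[OF H K, of a b] by simp
    show "0 \<le> a\<^sup>2 * pair_inner ?H ?H + 2 * a * b * pair_inner ?H ?K + b\<^sup>2 * pair_inner ?K ?K"
      unfolding pair_inner_lin_self[OF H K, symmetric] by (rule pair_inner_self_nonneg)
  qed (use l in auto)
  then have "norm ((\<Prod>i\<in>UNIV. e i) - (\<Prod>i\<in>(UNIV :: 'd set). e')) \<le> (\<Sum>i\<in>(UNIV :: 'd set). sqrt l * sqrt m * \<bar>pair_inner ?H ?K\<bar>)"
    using e01 e'01 by (intro order_trans[OF norm_prod_diff] sum_mono) auto
  then show ?thesis unfolding 1 by (simp add: e'_def power_mult_distrib power_divide)
qed

text \<open>In time alone a component is, up to a constant, fractional Brownian motion with Hurst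
  index 1/4. Polarization gives its covariance, and sqrt t - sqrt (t - s) \<le> sqrt s bounds it by
  a quantity that does not grow with t.\<close>

lemma pair_inner_string_kernel_0:
  assumes "0 \<le> s" "s \<le> t"
  shows "\<bar>pair_inner (string_kernel t 0) (string_kernel s 0)\<bar> \<le> sqrt s"
proof -
  define c where "c = 1 / sqrt pi"
  have c: "0 \<le> c" "c \<le> 1" using pi_gt3 by (auto simp: c_def)
  have g: "gap a 0 = c * sqrt a" if "0 \<le> a" for a using that by (simp add: gap_0 c_def real_sqrt_divide)
  let ?p = "pair_inner (string_kernel t 0) (string_kernel s 0)"
  have "gap (t - s) (0 - 0) = gap t 0 - 2 * ?p + gap s 0"
    unfolding pair_inner_string_kernel_diff[OF assms, symmetric]
    using assms by (subst pair_inner_lin_self) (auto simp: string_kernel_L2 pair_inner_string_kernel)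
  then have p: "?p = c * ((sqrt t + sqrt s - sqrt (t - s)) / 2)"
    using assms by (simp add: g algebra_simps)
  have "sqrt t \<le> sqrt (t - s) + sqrt s"
    using sqrt_add_le_add_sqrt[of "t - s" s] assms by simp
  moreover have "sqrt (t - s) \<le> sqrt t" "0 \<le> sqrt s" using assms by simp_all
  moreover have "0 \<le> (a + c - b) / 2 \<and> (a + c - b) / 2 \<le> c" if "a \<le> b + c" "b \<le> a" "0 \<le> c" for a b c :: real
    using that by (simp add: field_simps)
  ultimately have "0 \<le> (sqrt t + sqrt s - sqrt (t - s)) / 2 \<and> (sqrt t + sqrt s - sqrt (t - s)) / 2 \<le> sqrt s"
    by blast
  then have "0 \<le> ?p" "?p \<le> 1 * sqrt s"
    unfolding p using c assms by (intro mult_nonneg_nonneg mult_mono; auto)+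
  then show ?thesis by simp
qed

end

text \<open>Chebyshev's inequality for the averages of \<open>Z\<close> replaces a zero-one law.\<close>

lemma (in prob_space) frequently_above:
  fixes Z :: "nat \<Rightarrow> 'a \<Rightarrow> real"
  assumes [measurable]: "\<And>n. Z n \<in> borel_measurable M"
    and Z01: "\<And>n \<omega>. 0 \<le> Z n \<omega>" "\<And>n \<omega>. Z n \<omega> \<le> 1"
    and mean: "\<And>n. (LINT \<omega>|M. Z n \<omega>) = p"
    and cov: "\<And>n m. m < n \<Longrightarrow> \<bar>(LINT \<omega>|M. Z n \<omega> * Z m \<omega>) - p\<^sup>2\<bar> \<le> C * ((1/2) ^ n * (1/2) ^ m)"
    and "0 \<le> q" "q < p"
  shows "AE \<omega> in M. \<exists>\<^sub>F n in sequentially. q < Z n \<omega>"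
proof -
  have C: "0 \<le> C"
  proof -
    have "0 \<le> C * ((1/2) ^ 1 * (1/2) ^ 0)" by (rule order_trans[OF abs_ge_zero cov]) simp
    then show ?thesis by simp
  qed
  have int: "integrable M (Z n)" for n using Z01 by (intro integrable_const_bound[where B = 1]) auto
  have int2: "integrable M (\<lambda>\<omega>. Z n \<omega> * Z m \<omega>)" for n m
    using Z01 by (intro integrable_const_bound[where B = 1]) (auto simp: abs_mult intro!: mult_le_one)
  define D where "D n \<omega> = Z n \<omega> - p" for n \<omega>
  have D_meas [measurable]: "D n \<in> borel_measurable M" for n unfolding D_def by measurable
  have DD: "D n \<omega> * D m \<omega> = Z n \<omega> * Z m \<omega> - p * Z n \<omega> - p * Z m \<omega> + p\<^sup>2" for n m \<omega>
    by (simp add: D_def power2_eq_square algebra_simps)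
  have intD: "integrable M (\<lambda>\<omega>. D n \<omega> * D m \<omega>)" for n m
    unfolding DD using int int2 by simp
  have eD: "(LINT \<omega>|M. D n \<omega> * D m \<omega>) = (LINT \<omega>|M. Z n \<omega> * Z m \<omega>) - p\<^sup>2" for n m
    unfolding DD using int int2 by (simp add: mean prob_space power2_eq_square)
  \<comment> \<open>A diagonal term is at most 1 because \<open>Z\<close> lies in [0, 1], while the
    off-diagonal terms are summable.\<close>
  have le: "(LINT \<omega>|M. D n \<omega> * D m \<omega>) \<le> (if n = m then 1 else 0) + C * ((1/2) ^ n * (1/2) ^ m)" for n m
  proof (cases n m rule: linorder_cases)
    case less
    then show ?thesis using cov[of n m] unfolding eD by (simp add: mult.commute)
  next
    case equal
    have "(LINT \<omega>|M. Z n \<omega> * Z m \<omega>) \<le> (LINT \<omega>|M. 1)"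
      using Z01 by (intro integral_mono int2) (auto intro!: mult_le_one)
    then have "(LINT \<omega>|M. Z n \<omega> * Z m \<omega>) \<le> 1" by (simp add: prob_space)
    moreover have "0 \<le> C * ((1/2) ^ n * (1/2) ^ m)" using C by simp
    ultimately have "(LINT \<omega>|M. Z n \<omega> * Z m \<omega>) - p\<^sup>2 \<le> 1 + C * ((1/2) ^ n * (1/2) ^ m)"
      using zero_le_power2[of p] by (intro order_trans[OF diff_right_mono add_increasing2]) auto
    then show ?thesis unfolding eD using equal by simp
  next
    case greater
    then show ?thesis using cov[of m n] unfolding eD by (simp add: mult.commute)
  qed
  have geo: "(\<Sum>n<N. (1/2::real) ^ n) \<le> 2" for N
    using sum_le_suminf[of "\<lambda>n. (1/2::real) ^ n" "{..<N}"] by (simp add: suminf_geometric)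
  have second: "(LINT \<omega>|M. (\<Sum>n<N. D n \<omega>)\<^sup>2) \<le> N + 4 * C" for N
  proof -
    have "(LINT \<omega>|M. (\<Sum>n<N. D n \<omega>)\<^sup>2) = (\<Sum>n<N. \<Sum>m<N. (LINT \<omega>|M. D n \<omega> * D m \<omega>))"
      unfolding power2_eq_square sum_product using intD by (subst Bochner_Integration.integral_sum) auto
    also have "\<dots> \<le> (\<Sum>n<N. \<Sum>m<N. (if n = m then 1 else 0) + C * ((1/2) ^ n * (1/2) ^ m))"
      by (intro sum_mono le)
    also have "\<dots> = N + C * ((\<Sum>n<N. (1/2) ^ n) * (\<Sum>m<N. (1/2) ^ m))"
    proof -
      have "(\<Sum>n<N. \<Sum>m<N. C * ((1/2) ^ n * (1/2) ^ m)) = C * ((\<Sum>n<N. (1/2) ^ n) * (\<Sum>m<N. (1/2) ^ m))"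
        unfolding sum_product by (simp only: sum_distrib_left)
      then show ?thesis by (simp add: sum.distrib)
    qed
    also have "\<dots> \<le> N + C * (2 * 2)"
      using C geo by (intro add_left_mono mult_left_mono mult_mono) (auto intro: sum_nonneg)
    finally show ?thesis by simp
  qed
  have null: "prob {\<omega> \<in> space M. \<forall>n\<ge>k. Z n \<omega> \<le> q} = 0" for k
  proof -
    define B where "B = {\<omega> \<in> space M. \<forall>n\<ge>k. Z n \<omega> \<le> q}"
    have [measurable]: "B \<in> sets M" unfolding B_def by measurable
    \<comment> \<open>Half the distance from q to p: one half becomes the deviation N e, the other
      absorbs the first k terms, about which nothing is known.\<close>
    define e where "e = (p - q) / 2"
    have e: "0 < e" using \<open>q < p\<close> by (simp add: e_def)
    have bound: "prob B \<le> (N + 4 * C) / (N * e)\<^sup>2" if N: "k / e \<le> real N" "0 < N" for N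
    proof -
      have "prob B \<le> prob {\<omega> \<in> space M. (N * e)\<^sup>2 \<le> (\<Sum>n<N. D n \<omega>)\<^sup>2}"
      proof (intro finite_measure_mono subsetI CollectI conjI)
        fix \<omega> assume \<omega>: "\<omega> \<in> B"
        have "(\<Sum>n<N. Z n \<omega>) \<le> (\<Sum>n<N. (if n < k then 1 else 0) + q)"
          using \<omega> Z01 \<open>0 \<le> q\<close> by (intro sum_mono) (auto simp: B_def intro: add_increasing2)
        also have "\<dots> \<le> k + N * q"
        proof -
          have "(\<Sum>n<N. (if n < k then 1 else 0 :: real)) = real (card ({..<N} \<inter> {..<k}))"
            by (simp add: sum.If_cases Int_def)
          also have "card ({..<N} \<inter> {..<k}) \<le> card {..<k}" by (intro card_mono) auto
          finally show ?thesis by (simp add: sum.distrib)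
        qed
        finally have "(\<Sum>n<N. Z n \<omega>) \<le> k + N * q" .
        then have "(\<Sum>n<N. D n \<omega>) \<le> k - 2 * (N * e)"
        proof -
          have "2 * (N * e) = N * p - N * q" by (simp add: e_def right_diff_distrib field_simps)
          with \<open>(\<Sum>n<N. Z n \<omega>) \<le> k + N * q\<close> show ?thesis by (simp add: D_def sum_subtractf)
        qed
        moreover have "k \<le> N * e" using N e by (simp add: field_simps)
        ultimately have "\<bar>N * e\<bar> \<le> \<bar>\<Sum>n<N. D n \<omega>\<bar>" using e N by (simp add: abs_mult)
        then show "(N * e)\<^sup>2 \<le> (\<Sum>n<N. D n \<omega>)\<^sup>2" by (simp only: abs_le_square_iff)
      qed (auto simp: B_def)
      also have "\<dots> \<le> (LINT \<omega>|M. (\<Sum>n<N. D n \<omega>)\<^sup>2) / (N * e)\<^sup>2"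
      proof (intro integral_Markov_inequality_measure[where A = "space M"])
        show "integrable M (\<lambda>\<omega>. (\<Sum>n<N. D n \<omega>)\<^sup>2)"
          unfolding power2_eq_square sum_product by (intro Bochner_Integration.integrable_sum intD)
      qed (use N e in auto)
      also have "\<dots> \<le> (N + 4 * C) / (N * e)\<^sup>2"
        by (intro divide_right_mono second) simp
      finally show ?thesis .
    qed
    \<comment> \<open>The second moment grows linearly in N, the squared deviation
      quadratically.\<close>
    have "((\<lambda>N. (N + 4 * C) / (N * e)\<^sup>2) \<longlongrightarrow> 0) at_top"
      using e by real_asymp
    from filterlim_compose[OF this filterlim_real_sequentially]
    have "(\<lambda>N. (real N + 4 * C) / (real N * e)\<^sup>2) \<longlonglongrightarrow> 0" .
    moreover have "\<forall>\<^sub>F N in sequentially. prob B \<le> (real N + 4 * C) / (real N * e)\<^sup>2"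
      using eventually_gt_at_top[of 0] eventually_ge_at_top[of "nat \<lceil>k / e\<rceil>"]
      by eventually_elim (intro bound; linarith)
    ultimately have "prob B \<le> 0"
      by (intro tendsto_lowerbound) auto
    then show ?thesis using measure_nonneg[of M B] unfolding B_def by linarith
  qed
  have "AE \<omega> in M. \<not> (\<forall>n\<ge>k. Z n \<omega> \<le> q)" for k
    using null[of k] by (subst (asm) prob_eq_0) (auto elim: eventually_mono)
  then have "AE \<omega> in M. \<forall>k. \<not> (\<forall>n\<ge>k. Z n \<omega> \<le> q)"
    by (simp add: AE_all_countable)
  then show ?thesis
    by eventually_elim (auto simp: frequently_sequentially not_le)
qed

text \<open>The bound sqrt (1 + l / sqrt pi) \<le> 1 + l reduces the claim to an exponential against
  a polynomial of degree d.\<close>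

lemma exists_exp_less_power:
  assumes "0 < e"
  shows "\<exists>l>0. exp (- (l * e)) < (1 / sqrt (1 + l / sqrt pi)) ^ d"
proof -
  have "filterlim (\<lambda>l. exp (l * e) / (1 + l) ^ d) at_top at_top"
    using assms by real_asymp
  then have "\<forall>\<^sub>F l in at_top. 1 < exp (l * e) / (1 + l) ^ d"
    by (simp add: filterlim_at_top_dense)
  from eventually_conj[OF eventually_gt_at_top[of "0::real"] this]
  have "\<exists>l. 0 < l \<and> 1 < exp (l * e) / (1 + l) ^ d" by (rule eventually_happens'[rotated]) simp
  then obtain l where l: "0 < l" "1 < exp (l * e) / (1 + l) ^ d" by blast
  have "sqrt (1 + l / sqrt pi) \<le> sqrt ((1 + l)\<^sup>2)"
  proof (rule real_sqrt_le_mono)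
    have "l / sqrt pi \<le> l / 1" using l pi_gt3 by (intro divide_left_mono) auto
    moreover have "(1 + l)\<^sup>2 = 1 + l + (l + l * l)" by (simp add: power2_eq_square algebra_simps)
    moreover have "0 \<le> l + l * l" using l by simp
    ultimately show "1 + l / sqrt pi \<le> (1 + l)\<^sup>2" by simp
  qed
  then have "sqrt (1 + l / sqrt pi) \<le> 1 + l" using l by simp
  then have "1 / (1 + l) \<le> 1 / sqrt (1 + l / sqrt pi)"
    using l by (intro divide_left_mono) (auto intro!: mult_pos_pos add_pos_pos)
  then have "(1 / (1 + l)) ^ d \<le> (1 / sqrt (1 + l / sqrt pi)) ^ d"
    using l by (intro power_mono) auto
  moreover have "exp (- (l * e)) < (1 / (1 + l)) ^ d"
    using l by (simp add: exp_minus power_one_over field_simps)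
  ultimately show ?thesis using l by (intro exI[of _ l]) auto
qed

section \<open>Small values of the string along sparse times\<close>

context stationary_pinned_string
begin

text \<open>With b = 2^(n^2) and t = b^4, dividing the parameter by b^2 = sqrt t makes the mean
  independent of n. The square in the exponent makes the times sparse enough for covariances of
  order 2^(-(n + m)).\<close>

lemma frequently_small:
  assumes "0 < \<epsilon>"
  shows "AE \<omega> in M. \<exists>\<^sub>F n in sequentially. norm (U ((2 ^ n\<^sup>2) ^ 4) 0 \<omega>) < \<epsilon> * 2 ^ n\<^sup>2"
proof -
  define b :: "nat \<Rightarrow> real" where "b n = 2 ^ n\<^sup>2" for n
  have b: "0 < b n" for n by (simp add: b_def)
  have sqrt_b: "sqrt (b n ^ 4) = (b n)\<^sup>2" for n
    using real_sqrt_abs[of "(b n)\<^sup>2"] b by (simp flip: power_mult)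
  have gap_b: "gap (b n ^ 4) 0 = (b n)\<^sup>2 / sqrt pi" for n
    using b[of n] by (simp add: gap_0 real_sqrt_divide sqrt_b)
  obtain l where l: "0 < l" "exp (- (l * (\<epsilon>\<^sup>2 / 2))) < (1 / sqrt (1 + l / sqrt pi)) ^ CARD('d)"
    using exists_exp_less_power[of "\<epsilon>\<^sup>2 / 2" "CARD('d)"] assms by auto
  define p where "p = (1 / sqrt (1 + l / sqrt pi)) ^ CARD('d)"
  define Z where "Z n \<omega> = exp (- (l / (b n)\<^sup>2 * (norm (U (b n ^ 4) 0 \<omega>))\<^sup>2 / 2))" for n \<omega>
  have gl: "1 + l / (b n)\<^sup>2 * gap (b n ^ 4) 0 = 1 + l / sqrt pi" for n
    using b[of n] by (simp add: gap_b)
  have "AE \<omega> in M. \<exists>\<^sub>F n in sequentially. exp (- (l * (\<epsilon>\<^sup>2 / 2))) < Z n \<omega>"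
  proof (rule frequently_above)
    show "Z n \<in> borel_measurable M" for n
      unfolding Z_def using U_measurable[of "b n ^ 4" 0] b[of n] by measurable
    show "0 \<le> Z n \<omega>" "Z n \<omega> \<le> 1" for n \<omega>
      using l by (auto simp: Z_def)
    show "(LINT \<omega>|M. Z n \<omega>) = p" for n
      unfolding Z_def p_def gl[of n, symmetric] using l b[of n] by (intro expectation_exp_sq_norm) auto
    show "\<bar>(LINT \<omega>|M. Z n \<omega> * Z m \<omega>) - p\<^sup>2\<bar> \<le> (CARD('d) * l) * ((1/2) ^ n * (1/2) ^ m)" if "m < n" for n m
    proof -
      have "\<bar>(LINT \<omega>|M. Z n \<omega> * Z m \<omega>) - p * p\<bar>
          \<le> CARD('d) * (sqrt (l / (b n)\<^sup>2) * sqrt (l / (b m)\<^sup>2) * \<bar>pair_inner (string_kernel (b n ^ 4) 0) (string_kernel (b m ^ 4) 0)\<bar>)"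
        using covariance_exp_sq_norm[of "b n ^ 4" "b m ^ 4" "l / (b n)\<^sup>2" "l / (b m)\<^sup>2" 0 0] l b[of n] b[of m]
        unfolding gl p_def[symmetric] Z_def by simp
      also have "\<dots> \<le> CARD('d) * (sqrt (l / (b n)\<^sup>2) * sqrt (l / (b m)\<^sup>2) * (b m)\<^sup>2)"
      proof (intro mult_left_mono)
        have "b m \<le> b n" unfolding b_def using that by (intro power_increasing) (auto intro: power_mono)
        then show "\<bar>pair_inner (string_kernel (b n ^ 4) 0) (string_kernel (b m ^ 4) 0)\<bar> \<le> (b m)\<^sup>2"
          using pair_inner_string_kernel_0[of "b m ^ 4" "b n ^ 4"] b[of m] b[of n] by (simp add: sqrt_b power_mono)
      qed (use l in auto)
      also have "sqrt (l / (b n)\<^sup>2) * sqrt (l / (b m)\<^sup>2) * (b m)\<^sup>2 = l * (b m / b n)"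
        using b[of n] b[of m] l by (simp add: real_sqrt_divide power2_eq_square)
      also have "b m / b n \<le> (1/2) ^ n * (1/2) ^ m"
      proof -
        have "m\<^sup>2 + (n + m) \<le> n\<^sup>2"
        proof -
          \<comment> \<open>For m < n this is (n - m) (n + m) \<ge> n + m, checked by writing n = m
            + k + 1.\<close>
          obtain k where "n = m + Suc k" using \<open>m < n\<close> by (metis less_imp_Suc_add add_Suc_right)
          then show ?thesis by (simp add: power2_eq_square algebra_simps)
        qed
        then have "b m * 2 ^ (n + m) \<le> b n"
          unfolding b_def power_add[symmetric] by (intro power_increasing) auto
        then show ?thesis using b[of n] by (simp add: power_one_over field_simps power_add)
      qed
      finally show ?thesis using l by (simp add: power2_eq_square mult.assoc mult_left_mono)
    qed
    show "exp (- (l * (\<epsilon>\<^sup>2 / 2))) < p" using l by (simp add: p_def)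
  qed simp
  then show ?thesis
  proof eventually_elim
    case (elim \<omega>)
    show ?case
      using elim
    proof (rule frequently_elim1)
      fix n assume "exp (- (l * (\<epsilon>\<^sup>2 / 2))) < Z n \<omega>"
      then have "l / (b n)\<^sup>2 * (norm (U (b n ^ 4) 0 \<omega>))\<^sup>2 / 2 < l * (\<epsilon>\<^sup>2 / 2)"
        by (simp add: Z_def)
      then have "(norm (U (b n ^ 4) 0 \<omega>))\<^sup>2 < (\<epsilon> * b n)\<^sup>2"
        using l b[of n] by (simp add: field_simps)
      then have "norm (U (b n ^ 4) 0 \<omega>) < \<epsilon> * b n"
        by (rule power2_less_imp_less) (use assms b[of n] in simp)
      then show "norm (U ((2 ^ n\<^sup>2) ^ 4) 0 \<omega>) < \<epsilon> * 2 ^ n\<^sup>2"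
        by (simp add: b_def)
    qed
  qed
qed

end

section \<open>Chaining on parabolic grids\<close>

text \<open>U scales like t^(1/4) and |x|^(1/2), so with \<delta> in units of U a cell has sides
  \<delta>^4 and \<delta>^2. Each level divides the time step by 4 and the space step of
  \<open>grid_space\<close> by 2, which keeps the cells parabolic: their variance scale is
  \<delta>^2 / 2^m.\<close>

definition grid_time :: "real \<Rightarrow> nat \<Rightarrow> int \<Rightarrow> real" where
  "grid_time \<delta> m i = of_int i * \<delta> ^ 4 / 4 ^ m"

definition grid_space :: "real \<Rightarrow> nat \<Rightarrow> int \<Rightarrow> real" where
  "grid_space \<delta> m k = of_int k * \<delta>\<^sup>2 / 2 ^ m"

text \<open>Room for the lower left corners of all cells that meet t + x^2 \<le> 16 L^4 with t \<ge>
  0: there |x| \<le> 4 L^2, and rounding down moves x by at most \<delta>^2, which is at most L^2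
  when \<delta> \<le> L.\<close>

definition grid_cells :: "real \<Rightarrow> real \<Rightarrow> nat \<Rightarrow> (int \<times> int) set" where
  "grid_cells L \<delta> m = {i. 0 \<le> i \<and> grid_time \<delta> m i \<le> 16 * L ^ 4} \<times> {k. \<bar>grid_space \<delta> m k\<bar> \<le> 5 * L\<^sup>2}"

text \<open>The exponent is 6 = 4 + 2, and 187 = 17 * 11 comes from a + 1 and 2 b + 1, where L /
  \<delta> \<ge> 1 absorbs the 1.\<close>

lemma card_grid_cells:
  assumes \<delta>: "0 < \<delta>" "\<delta> \<le> L"
  shows "finite (grid_cells L \<delta> m)" "card (grid_cells L \<delta> m) \<le> 187 * 8 ^ m * (L / \<delta>) ^ 6"
proof -
  define a where "a = 16 * 4 ^ m * (L / \<delta>) ^ 4"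
  define b where "b = 5 * 2 ^ m * (L / \<delta>)\<^sup>2"
  have Ld: "1 \<le> L / \<delta>" using \<delta> by simp
  have a: "1 \<le> 4 ^ m * (L / \<delta>) ^ 4"
    using mult_mono[of 1 "4 ^ m :: real" 1 "(L / \<delta>) ^ 4"] one_le_power[OF Ld, of 4] by simp
  have b: "1 \<le> 2 ^ m * (L / \<delta>)\<^sup>2"
    using mult_mono[of 1 "2 ^ m :: real" 1 "(L / \<delta>)\<^sup>2"] one_le_power[OF Ld, of 2] by simp
  have T: "{i. 0 \<le> i \<and> grid_time \<delta> m i \<le> 16 * L ^ 4} \<subseteq> {0..\<lfloor>a\<rfloor>}"
  proof
    fix i assume "i \<in> {i. 0 \<le> i \<and> grid_time \<delta> m i \<le> 16 * L ^ 4}"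
    then have "0 \<le> i" "of_int i \<le> a" using \<delta> by (auto simp: grid_time_def a_def field_simps)
    then show "i \<in> {0..\<lfloor>a\<rfloor>}" by (auto simp: le_floor_iff)
  qed
  have X: "{k. \<bar>grid_space \<delta> m k\<bar> \<le> 5 * L\<^sup>2} \<subseteq> {-\<lfloor>b\<rfloor>..\<lfloor>b\<rfloor>}"
  proof
    fix k assume "k \<in> {k. \<bar>grid_space \<delta> m k\<bar> \<le> 5 * L\<^sup>2}"
    then have "\<bar>of_int k\<bar> \<le> b" using \<delta> by (simp add: grid_space_def b_def abs_mult field_simps)
    then have "of_int \<bar>k\<bar> \<le> b" by simp
    then have "\<bar>k\<bar> \<le> \<lfloor>b\<rfloor>" by (subst le_floor_iff)
    then show "k \<in> {-\<lfloor>b\<rfloor>..\<lfloor>b\<rfloor>}" by auto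
  qed
  show "finite (grid_cells L \<delta> m)"
    unfolding grid_cells_def using finite_subset[OF T] finite_subset[OF X] by auto
  have "real (card (grid_cells L \<delta> m)) \<le> real (card {0..\<lfloor>a\<rfloor>}) * real (card {-\<lfloor>b\<rfloor>..\<lfloor>b\<rfloor>})"
    unfolding grid_cells_def card_cartesian_product of_nat_mult
    by (intro mult_mono of_nat_mono card_mono T X) auto
  also have "\<dots> \<le> (17 * (4 ^ m * (L / \<delta>) ^ 4)) * (11 * (2 ^ m * (L / \<delta>)\<^sup>2))"
  proof (rule mult_mono)
    have "0 \<le> \<lfloor>a\<rfloor>" using a by (simp add: a_def)
    then have "real (card {0..\<lfloor>a\<rfloor>}) = of_int \<lfloor>a\<rfloor> + 1" by simp
    also have "\<dots> \<le> a + 1" by simp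
    also have "a + 1 \<le> 17 * (4 ^ m * (L / \<delta>) ^ 4)" using a by (simp add: a_def)
    finally show "real (card {0..\<lfloor>a\<rfloor>}) \<le> 17 * (4 ^ m * (L / \<delta>) ^ 4)" .
    have "0 \<le> \<lfloor>b\<rfloor>" using b by (simp add: b_def)
    then have "real (card {-\<lfloor>b\<rfloor>..\<lfloor>b\<rfloor>}) = 2 * of_int \<lfloor>b\<rfloor> + 1" by simp
    also have "\<dots> \<le> 2 * b + 1" by simp
    also have "2 * b + 1 \<le> 11 * (2 ^ m * (L / \<delta>)\<^sup>2)" using b by (simp add: b_def)
    finally show "real (card {-\<lfloor>b\<rfloor>..\<lfloor>b\<rfloor>}) \<le> 11 * (2 ^ m * (L / \<delta>)\<^sup>2)" .
  qed (use a in auto)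
  also have "\<dots> = 187 * (4 ^ m * 2 ^ m) * ((L / \<delta>) ^ 4 * (L / \<delta>)\<^sup>2)" by (simp add: mult_ac)
  also have "\<dots> = 187 * 8 ^ m * (L / \<delta>) ^ 6"
    by (simp add: power_mult_distrib[symmetric] power_add[symmetric])
  finally show "card (grid_cells L \<delta> m) \<le> 187 * 8 ^ m * (L / \<delta>) ^ 6" .
qed

lemma grid_time_floor:
  assumes "0 < \<delta>"
  shows "grid_time \<delta> m \<lfloor>t * 4 ^ m / \<delta> ^ 4\<rfloor> \<le> t" "t - \<delta> ^ 4 / 4 ^ m \<le> grid_time \<delta> m \<lfloor>t * 4 ^ m / \<delta> ^ 4\<rfloor>"
proof -
  have "of_int \<lfloor>t * 4 ^ m / \<delta> ^ 4\<rfloor> * (\<delta> ^ 4 / 4 ^ m) \<le> t * 4 ^ m / \<delta> ^ 4 * (\<delta> ^ 4 / 4 ^ m)"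
    using assms by (intro mult_right_mono) auto
  then show "grid_time \<delta> m \<lfloor>t * 4 ^ m / \<delta> ^ 4\<rfloor> \<le> t" using assms by (simp add: grid_time_def)
  have "(t * 4 ^ m / \<delta> ^ 4 - 1) * (\<delta> ^ 4 / 4 ^ m) \<le> of_int \<lfloor>t * 4 ^ m / \<delta> ^ 4\<rfloor> * (\<delta> ^ 4 / 4 ^ m)"
    using assms by (intro mult_right_mono) (auto simp: less_imp_le)
  then show "t - \<delta> ^ 4 / 4 ^ m \<le> grid_time \<delta> m \<lfloor>t * 4 ^ m / \<delta> ^ 4\<rfloor>"
    using assms by (simp add: grid_time_def left_diff_distrib diff_divide_distrib)
qed

lemma grid_space_floor:
  assumes "0 < \<delta>"
  shows "grid_space \<delta> m \<lfloor>x * 2 ^ m / \<delta>\<^sup>2\<rfloor> \<le> x" "x - \<delta>\<^sup>2 / 2 ^ m \<le> grid_space \<delta> m \<lfloor>x * 2 ^ m / \<delta>\<^sup>2\<rfloor>"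
proof -
  have "of_int \<lfloor>x * 2 ^ m / \<delta>\<^sup>2\<rfloor> * (\<delta>\<^sup>2 / 2 ^ m) \<le> x * 2 ^ m / \<delta>\<^sup>2 * (\<delta>\<^sup>2 / 2 ^ m)"
    using assms by (intro mult_right_mono) auto
  then show "grid_space \<delta> m \<lfloor>x * 2 ^ m / \<delta>\<^sup>2\<rfloor> \<le> x" using assms by (simp add: grid_space_def)
  have "(x * 2 ^ m / \<delta>\<^sup>2 - 1) * (\<delta>\<^sup>2 / 2 ^ m) \<le> of_int \<lfloor>x * 2 ^ m / \<delta>\<^sup>2\<rfloor> * (\<delta>\<^sup>2 / 2 ^ m)"
    using assms by (intro mult_right_mono) (auto simp: less_imp_le)
  then show "x - \<delta>\<^sup>2 / 2 ^ m \<le> grid_space \<delta> m \<lfloor>x * 2 ^ m / \<delta>\<^sup>2\<rfloor>"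
    using assms by (simp add: grid_space_def left_diff_distrib diff_divide_distrib)
qed

text \<open>The grids are nested: the coarser rounding of a point is determined by its finer index,
  so a chaining step is labelled by one cell of level m + 1.\<close>

lemma grid_floor_parent:
  fixes t x \<delta> :: real
  shows
  "\<lfloor>t * 4 ^ m / \<delta> ^ 4\<rfloor> = \<lfloor>t * 4 ^ Suc m / \<delta> ^ 4\<rfloor> div 4"
  "\<lfloor>x * 2 ^ m / \<delta>\<^sup>2\<rfloor> = \<lfloor>x * 2 ^ Suc m / \<delta>\<^sup>2\<rfloor> div 2"
  using floor_divide_real_eq_div[of 4 "t * 4 ^ Suc m / \<delta> ^ 4"] floor_divide_real_eq_div[of 2 "x * 2 ^ Suc m / \<delta>\<^sup>2"]
  by simp_all

text \<open>The roundings of (t, x) converge to it, so continuity writes the difference as a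
  telescoping sum; 10 is the sum of the geometric series with ratio 9/10. Uncountably many points
  are thus controlled by countably many increments.\<close>

lemma grid_chaining:
  fixes u :: "real \<Rightarrow> real \<Rightarrow> 'a::real_normed_vector"
  assumes \<delta>: "0 < \<delta>" and t: "0 \<le> t" and cont: "continuous_on ({0..} \<times> UNIV) (\<lambda>(t, x). u t x)"
    and step: "\<And>m. norm (u (grid_time \<delta> (Suc m) \<lfloor>t * 4 ^ Suc m / \<delta> ^ 4\<rfloor>) (grid_space \<delta> (Suc m) \<lfloor>x * 2 ^ Suc m / \<delta>\<^sup>2\<rfloor>)
        - u (grid_time \<delta> m \<lfloor>t * 4 ^ m / \<delta> ^ 4\<rfloor>) (grid_space \<delta> m \<lfloor>x * 2 ^ m / \<delta>\<^sup>2\<rfloor>)) \<le> \<theta> * (9 / 10) ^ m"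
  shows "norm (u t x - u (grid_time \<delta> 0 \<lfloor>t / \<delta> ^ 4\<rfloor>) (grid_space \<delta> 0 \<lfloor>x / \<delta>\<^sup>2\<rfloor>)) \<le> 10 * \<theta>"
proof -
  define T where "T m = grid_time \<delta> m \<lfloor>t * 4 ^ m / \<delta> ^ 4\<rfloor>" for m
  define X where "X m = grid_space \<delta> m \<lfloor>x * 2 ^ m / \<delta>\<^sup>2\<rfloor>" for m
  define v where "v m = u (T m) (X m)" for m
  have \<theta>: "0 \<le> \<theta>" using order_trans[OF norm_ge_zero step[of 0]] by simp
  \<comment> \<open>Continuity is known for nonnegative times only, so the approximating times must
    stay there.\<close>
  have T0: "0 \<le> T m" for m
    using t \<delta> by (simp add: T_def grid_time_def)
  have T_lim: "T \<longlonglongrightarrow> t"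
  proof (rule tendsto_sandwich)
    show "(\<lambda>m. t - \<delta> ^ 4 / 4 ^ m) \<longlonglongrightarrow> t" by real_asymp
  qed (use grid_time_floor[OF \<delta>] in \<open>auto simp: T_def\<close>)
  have X_lim: "X \<longlonglongrightarrow> x"
  proof (rule tendsto_sandwich)
    show "(\<lambda>m. x - \<delta>\<^sup>2 / 2 ^ m) \<longlonglongrightarrow> x" by real_asymp
  qed (use grid_space_floor[OF \<delta>] in \<open>auto simp: X_def\<close>)
  have "(\<lambda>m. (T m, X m)) \<longlonglongrightarrow> (t, x)" using T_lim X_lim by (rule tendsto_Pair)
  then have v_lim: "v \<longlonglongrightarrow> u t x"
    using continuous_on_tendsto_compose[OF cont, of "\<lambda>m. (T m, X m)" "(t, x)" sequentially] T0 t by (simp add: v_def[abs_def])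
  have geo: "(\<Sum>m<N. (9 / 10 :: real) ^ m) \<le> 10" for N
    using sum_le_suminf[of "\<lambda>m. (9 / 10 :: real) ^ m" "{..<N}"] by (simp add: suminf_geometric)
  have "norm (v N - v 0) \<le> 10 * \<theta>" for N
  proof -
    have "norm (v N - v 0) = norm (\<Sum>m<N. v (Suc m) - v m)" by (simp add: sum_lessThan_telescope)
    also have "\<dots> \<le> (\<Sum>m<N. \<theta> * (9 / 10) ^ m)"
      using step by (intro sum_norm_le) (simp add: v_def T_def X_def)
    also have "\<dots> = \<theta> * (\<Sum>m<N. (9 / 10) ^ m)" by (simp add: sum_distrib_left)
    also have "\<dots> \<le> \<theta> * 10" using geo \<theta> by (intro mult_left_mono)
    finally show ?thesis by (simp add: mult.commute)
  qed
  moreover have "(\<lambda>N. norm (v N - v 0)) \<longlonglongrightarrow> norm (u t x - v 0)"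
    by (intro tendsto_intros v_lim)
  ultimately have "norm (u t x - v 0) \<le> 10 * \<theta>"
    by (intro LIMSEQ_le_const2) auto
  then show ?thesis by (simp add: v_def T_def X_def)
qed

lemma grid_cells_floor:
  assumes \<delta>: "0 < \<delta>" "\<delta> \<le> L" and t: "0 \<le> t" "t + x\<^sup>2 \<le> 16 * L ^ 4"
  shows "(\<lfloor>t * 4 ^ m / \<delta> ^ 4\<rfloor>, \<lfloor>x * 2 ^ m / \<delta>\<^sup>2\<rfloor>) \<in> grid_cells L \<delta> m"
proof -
  have "0 \<le> \<lfloor>t * 4 ^ m / \<delta> ^ 4\<rfloor>" using \<delta> t by simp
  moreover have "grid_time \<delta> m \<lfloor>t * 4 ^ m / \<delta> ^ 4\<rfloor> \<le> 16 * L ^ 4"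
    using grid_time_floor(1)[OF \<delta>(1), of m t] t zero_le_power2[of x] by linarith
  moreover have "\<bar>grid_space \<delta> m \<lfloor>x * 2 ^ m / \<delta>\<^sup>2\<rfloor>\<bar> \<le> 5 * L\<^sup>2"
  proof -
    have "x\<^sup>2 \<le> (4 * L\<^sup>2)\<^sup>2" using t by (simp add: power_mult_distrib flip: power_mult)
    then have "\<bar>x\<bar> \<le> \<bar>4 * L\<^sup>2\<bar>" by (rule abs_le_square_iff[THEN iffD2])
    then have "\<bar>x\<bar> \<le> 4 * L\<^sup>2" by simp
    moreover have "\<delta>\<^sup>2 / 2 ^ m \<le> \<delta>\<^sup>2 / 1" by (intro divide_left_mono) auto
    moreover have "\<delta>\<^sup>2 \<le> L\<^sup>2" using \<delta> by (intro power_mono) auto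
    ultimately show ?thesis
      using grid_space_floor[OF \<delta>(1), where m = m and x = x] by (auto simp: abs_le_iff)
  qed
  ultimately show ?thesis by (simp add: grid_cells_def)
qed

text \<open>The lags are remainders times the finer mesh. With remainders below 4 and 2, the root of
  the time lag and the space lag are both at most \<delta>^2 / 2^m.\<close>

lemma grid_gap_upper:
  assumes "0 < \<delta>"
  shows "grid_time \<delta> m (i div 4) \<le> grid_time \<delta> (Suc m) i"
    "gap (grid_time \<delta> (Suc m) i - grid_time \<delta> m (i div 4)) (grid_space \<delta> (Suc m) k - grid_space \<delta> m (k div 2)) \<le> 2 * (\<delta>\<^sup>2 / 2 ^ m)"
proof -
  have "grid_time \<delta> (Suc m) i - grid_time \<delta> m (i div 4) = (of_int i - 4 * of_int (i div 4)) * (\<delta> ^ 4 / 4 ^ Suc m)"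
    by (simp add: grid_time_def field_simps)
  also have "of_int i - 4 * of_int (i div 4) = (of_int (i mod 4) :: real)"
    by (simp add: minus_mult_div_eq_mod[symmetric])
  finally have t: "grid_time \<delta> (Suc m) i - grid_time \<delta> m (i div 4) = of_int (i mod 4) * (\<delta> ^ 4 / 4 ^ Suc m)" .
  have "grid_space \<delta> (Suc m) k - grid_space \<delta> m (k div 2) = (of_int k - 2 * of_int (k div 2)) * (\<delta>\<^sup>2 / 2 ^ Suc m)"
    by (simp add: grid_space_def field_simps)
  also have "of_int k - 2 * of_int (k div 2) = (of_int (k mod 2) :: real)"
    by (simp add: minus_mult_div_eq_mod[symmetric])
  finally have x: "grid_space \<delta> (Suc m) k - grid_space \<delta> m (k div 2) = of_int (k mod 2) * (\<delta>\<^sup>2 / 2 ^ Suc m)" .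
  have t0: "0 \<le> grid_time \<delta> (Suc m) i - grid_time \<delta> m (i div 4)"
    unfolding t using assms by simp
  then show "grid_time \<delta> m (i div 4) \<le> grid_time \<delta> (Suc m) i" by simp
  have "of_int (i mod 4) * (\<delta> ^ 4 / 4 ^ Suc m) \<le> 4 * (\<delta> ^ 4 / 4 ^ Suc m)"
    using assms pos_mod_bound[of 4 i] by (intro mult_right_mono) auto
  also have "\<dots> = (\<delta>\<^sup>2 / 2 ^ m)\<^sup>2"
  proof -
    have "(4::real) ^ m = (2 ^ m)\<^sup>2" by (simp add: power2_eq_square flip: power_mult_distrib)
    then show ?thesis by (simp add: power_divide flip: power_mult)
  qed
  finally have "sqrt (grid_time \<delta> (Suc m) i - grid_time \<delta> m (i div 4)) \<le> \<delta>\<^sup>2 / 2 ^ m"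
    unfolding t using assms by (intro real_le_lsqrt) auto
  moreover have "of_int (k mod 2) * (\<delta>\<^sup>2 / 2 ^ Suc m) \<le> 2 * (\<delta>\<^sup>2 / 2 ^ Suc m)"
    using assms pos_mod_bound[of 2 k] by (intro mult_right_mono) auto
  moreover have "\<bar>of_int (k mod 2) * (\<delta>\<^sup>2 / 2 ^ Suc m)\<bar> = of_int (k mod 2) * (\<delta>\<^sup>2 / 2 ^ Suc m)"
    using assms by simp
  ultimately show "gap (grid_time \<delta> (Suc m) i - grid_time \<delta> m (i div 4)) (grid_space \<delta> (Suc m) k - grid_space \<delta> m (k div 2)) \<le> 2 * (\<delta>\<^sup>2 / 2 ^ m)"
    using gap_upper[OF t0, of "grid_space \<delta> (Suc m) k - grid_space \<delta> m (k div 2)"] unfolding x by simp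
qed

section \<open>Probabilities of the bad events on a shell\<close>

context stationary_pinned_string
begin

text \<open>Any ratio between \<open>1 / sqrt 2\<close> and 1 would do instead of 9/10: the typical size of an increment
  at level \<open>m\<close> is of order \<open>\<delta> * 2 powr (- m / 2)\<close>, and its 80th moment outweighs the number
  \<open>8 ^ m\<close> of cells.\<close>

definition step_event :: "real \<Rightarrow> real \<Rightarrow> nat \<Rightarrow> int \<times> int \<Rightarrow> 'w set" where
  "step_event \<delta> \<theta> m = (\<lambda>(i, k). {\<omega> \<in> space M. \<theta> * (9 / 10) ^ m \<le>
      norm (U (grid_time \<delta> (Suc m) i) (grid_space \<delta> (Suc m) k) \<omega>
        - U (grid_time \<delta> m (i div 4)) (grid_space \<delta> m (k div 2)) \<omega>)})"

text \<open>The threshold is 10 + 1 times \<theta>: chaining changes the value by at most 10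
  \<theta>, which leaves \<theta> at the point itself.\<close>

definition base_event :: "real \<Rightarrow> real \<Rightarrow> int \<times> int \<Rightarrow> 'w set" where
  "base_event \<delta> \<theta> = (\<lambda>(i, k).
     {\<omega> \<in> space M. norm (U (grid_time \<delta> 0 i) (grid_space \<delta> 0 k) \<omega>) \<le> 11 * \<theta>})"

definition step_bad :: "real \<Rightarrow> real \<Rightarrow> real \<Rightarrow> nat \<Rightarrow> 'w set" where
  "step_bad L \<delta> \<theta> m = (\<Union>p\<in>grid_cells L \<delta> (Suc m). step_event \<delta> \<theta> m p)"

text \<open>Near the pinned point the variance is too small for a useful small ball estimate. The
  condition keeps the corners whose variance is at least of order L^2; for \<delta> \<le> L / 2 the
  points of the shell satisfy it even after rounding down.\<close>

definition far_cells :: "real \<Rightarrow> real \<Rightarrow> (int \<times> int) set" where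
  "far_cells L \<delta> = grid_cells L \<delta> 0 \<inter>
     {(i, k). L\<^sup>2 / 4 \<le> sqrt (grid_time \<delta> 0 i) + \<bar>grid_space \<delta> 0 k\<bar>}"

definition base_bad :: "real \<Rightarrow> real \<Rightarrow> real \<Rightarrow> 'w set" where
  "base_bad L \<delta> \<theta> = (\<Union>p\<in>far_cells L \<delta>. base_event \<delta> \<theta> p)"

text \<open>80 = 2 * 40 is the moment used, 8 = 4 * 2 joins the factors of
  \<open>increment_tail\<close> and \<open>grid_gap_upper\<close>, and 1496 = 187 * 8 comes from
  counting cells at level m + 1.\<close>

definition step_const :: real where
  "step_const = real (CARD('d)) * (2 * (fact 80 / (2 ^ 40 * fact 40)) * (8 * (real (CARD('d)))\<^sup>2) ^ 40) * 1496"

text \<open>220 = 11 * 20, with 20 from the lower bound L / 20 for the standard deviation; exp (1/2)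
  belongs to the small ball estimate and 187 to the cell count.\<close>

definition base_const :: real where
  "base_const = exp (1 / 2) * 220 ^ CARD('d) * 187"

lemma grid_time_nonneg: "0 < \<delta> \<Longrightarrow> 0 \<le> i \<Longrightarrow> 0 \<le> grid_time \<delta> m i"
  by (simp add: grid_time_def)

lemma step_event_sets:
  assumes "0 < \<delta>" "p \<in> grid_cells L \<delta> (Suc m)" shows "step_event \<delta> \<theta> m p \<in> events"
proof -
  obtain i k where p: "p = (i, k)" "0 \<le> i" using assms(2) by (cases p) (auto simp: grid_cells_def)
  have 1: "0 \<le> grid_time \<delta> (Suc m) i" "0 \<le> grid_time \<delta> m (i div 4)"
    using assms p by (auto intro!: grid_time_nonneg)
  note [measurable] = U_measurable[OF 1(1)] U_measurable[OF 1(2)]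
  show ?thesis unfolding step_event_def p by simp
qed

lemma base_event_sets:
  assumes "0 < \<delta>" "p \<in> grid_cells L \<delta> 0" shows "base_event \<delta> \<theta> p \<in> events"
proof -
  obtain i k where p: "p = (i, k)" "0 \<le> i" using assms(2) by (cases p) (auto simp: grid_cells_def)
  note [measurable] = U_measurable[OF grid_time_nonneg[OF assms(1) p(2)]]
  show ?thesis unfolding base_event_def p by simp
qed

lemma step_bad_sets: "0 < \<delta> \<Longrightarrow> \<delta> \<le> L \<Longrightarrow> step_bad L \<delta> \<theta> m \<in> events"
  unfolding step_bad_def by (intro sets.finite_UN card_grid_cells step_event_sets)

lemma base_bad_sets: "0 < \<delta> \<Longrightarrow> \<delta> \<le> L \<Longrightarrow> base_bad L \<delta> \<theta> \<in> events"
  unfolding base_bad_def far_cells_def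
  by (intro sets.finite_UN finite_Int disjI1 card_grid_cells) (auto intro: base_event_sets)

text \<open>The number of cells grows like 8^m, while the probability for a single cell is at most
  of order 16^(-m).\<close>

lemma prob_step_bad:
  assumes \<delta>: "0 < \<delta>" "\<delta> \<le> L" and \<theta>: "0 < \<theta>"
  shows "prob (step_bad L \<delta> \<theta> m) \<le> step_const * (L / \<delta>) ^ 6 * (\<delta> / \<theta>) ^ 80 * (1 / 2) ^ m"
proof -
  let ?d = "real (CARD('d))"
  let ?C = "2 * (fact 80 / (2 ^ 40 * fact 40)) :: real"
  define K where "K = ?d * (?C * ((8 * ?d\<^sup>2) ^ 40 * (\<delta> / \<theta>) ^ 80 * (1 / 16) ^ m))"
  have A: "prob (step_event \<delta> \<theta> m p) \<le> K" if p_in: "p \<in> grid_cells L \<delta> (Suc m)" for p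
  proof -
    obtain i k where p: "p = (i, k)" "0 \<le> i" using p_in by (cases p) (auto simp: grid_cells_def)
    let ?g = "gap (grid_time \<delta> (Suc m) i - grid_time \<delta> m (i div 4))
      (grid_space \<delta> (Suc m) k - grid_space \<delta> m (k div 2))"
    have "prob (step_event \<delta> \<theta> m p) \<le> ?d * (2 * (fact (2 * 40) / (2 ^ 40 * fact 40)) * (4 * ?d\<^sup>2 * ?g / (\<theta> * (9 / 10) ^ m)\<^sup>2) ^ 40)"
      unfolding step_event_def p prod.case
      using \<delta> \<theta> p grid_gap_upper(1)[OF \<delta>(1), of m i] by (intro increment_tail grid_time_nonneg) auto
    also have "\<dots> \<le> ?d * (2 * (fact (2 * 40) / (2 ^ 40 * fact 40)) * ((8 * ?d\<^sup>2) ^ 40 * (\<delta> / \<theta>) ^ 80 * (1 / 16) ^ m))"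
    proof (intro mult_left_mono)
      have "4 * ?d\<^sup>2 * ?g / (\<theta> * (9 / 10) ^ m)\<^sup>2
          \<le> 4 * ?d\<^sup>2 * (2 * (\<delta>\<^sup>2 / 2 ^ m)) / (\<theta> * (9 / 10) ^ m)\<^sup>2"
        by (intro divide_right_mono mult_left_mono grid_gap_upper \<delta>) auto
      also have "\<dots> = 8 * ?d\<^sup>2 * (\<delta> / \<theta>)\<^sup>2 * (50 / 81) ^ m"
      proof -
        \<comment> \<open>50 / 81 is (1/2) / (9/10)^2, the decay of the variance per level against
          that of the squared threshold.\<close>
        have "((9 / 10 :: real) ^ m)\<^sup>2 * 2 ^ m * (50 / 81) ^ m = 1"
          by (simp add: power2_eq_square flip: power_mult_distrib)
        then have "1 / (2 ^ m * ((9 / 10 :: real) ^ m)\<^sup>2) = (50 / 81) ^ m"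
          by (simp add: field_simps)
        moreover have "4 * D * (2 * (E / P)) / (T * c)\<^sup>2 = 8 * D * (E / T\<^sup>2) * (1 / (P * c\<^sup>2))" for D E P T c :: real
          by (simp add: power_mult_distrib mult_ac)
        ultimately show ?thesis by (simp only: power_divide[of \<delta> \<theta>])
      qed
      finally have "(4 * ?d\<^sup>2 * ?g / (\<theta> * (9 / 10) ^ m)\<^sup>2) ^ 40
         \<le> (8 * ?d\<^sup>2 * (\<delta> / \<theta>)\<^sup>2 * (50 / 81) ^ m) ^ 40"
        using \<theta> by (intro power_mono divide_nonneg_nonneg mult_nonneg_nonneg gap_nonneg) auto
      also have "\<dots> = (8 * ?d\<^sup>2) ^ 40 * (\<delta> / \<theta>) ^ 80 * ((50 / 81) ^ 40) ^ m"
        by (simp add: power_mult_distrib mult.commute flip: power_mult)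
      also have "\<dots> \<le> (8 * ?d\<^sup>2) ^ 40 * (\<delta> / \<theta>) ^ 80 * (1 / 16) ^ m"
      proof (intro mult_left_mono power_mono)
        \<comment> \<open>A sixth power would do for this ratio. The exponent 40 is chosen for the
          prefactor, since (\<delta> / \<theta>)^80 has to beat the cell count (L /
          \<delta>)^6.\<close>
        show "(50 / 81 :: real) ^ 40 \<le> 1 / 16"
          by (simp add: power_divide)
      qed (use \<delta> \<theta> in auto)
      finally show "(4 * ?d\<^sup>2 * ?g / (\<theta> * (9 / 10) ^ m)\<^sup>2) ^ 40
         \<le> (8 * ?d\<^sup>2) ^ 40 * (\<delta> / \<theta>) ^ 80 * (1 / 16) ^ m" .
    qed auto
    finally show ?thesis by (simp add: K_def)
  qed
  have K: "0 \<le> K" using \<delta> \<theta> by (simp add: K_def)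
  have "prob (step_bad L \<delta> \<theta> m) \<le> (\<Sum>p\<in>grid_cells L \<delta> (Suc m). prob (step_event \<delta> \<theta> m p))"
    unfolding step_bad_def using step_event_sets[OF \<delta>(1)] card_grid_cells(1)[OF \<delta>]
    by (intro finite_measure_subadditive_finite) auto
  also have "\<dots> \<le> of_nat (card (grid_cells L \<delta> (Suc m))) * K"
    by (intro sum_bounded_above A)
  also have "\<dots> \<le> (187 * 8 ^ Suc m * (L / \<delta>) ^ 6) * K"
    using card_grid_cells(2)[OF \<delta>] K by (intro mult_right_mono)
  also have "\<dots> = step_const * (L / \<delta>) ^ 6 * (\<delta> / \<theta>) ^ 80 * (8 ^ m * (1 / 16) ^ m)"
    by (simp add: K_def step_const_def mult_ac)
  also have "8 ^ m * (1 / 16) ^ m = (1 / 2 :: real) ^ m"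
    by (simp flip: power_mult_distrib)
  finally show ?thesis .
qed

lemma prob_base_bad:
  assumes \<delta>: "0 < \<delta>" "\<delta> \<le> L" and \<theta>: "0 < \<theta>" "\<theta> \<le> L" and d: "7 \<le> CARD('d)"
  shows "prob (base_bad L \<delta> \<theta>) \<le> base_const * (L / \<delta>) ^ 6 * (\<theta> / L) ^ 7"
proof -
  have L: "0 < L" using \<delta> by simp
  define K where "K = exp (1 / 2) * (220 ^ CARD('d) * (\<theta> / L) ^ 7)"
  have A: "prob (base_event \<delta> \<theta> p) \<le> K" if p_in: "p \<in> far_cells L \<delta>" for p
  proof -
    obtain i k where p: "p = (i, k)" "0 \<le> i" and far: "L\<^sup>2 / 4 \<le> sqrt (grid_time \<delta> 0 i) + \<bar>grid_space \<delta> 0 k\<bar>"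
      using p_in by (cases p) (auto simp: grid_cells_def far_cells_def)
    have t: "0 \<le> grid_time \<delta> 0 i" using p \<delta> by (intro grid_time_nonneg)
    let ?g = "gap (grid_time \<delta> 0 i) (grid_space \<delta> 0 k)"
    \<comment> \<open>The bound L^2 / 4 from \<open>far_cells\<close> and the factor 1 / 100 of
      \<open>gap_lower\<close> combine to (L / 20)^2.\<close>
    have "(L / 20)\<^sup>2 = L\<^sup>2 / 4 / 100" by (simp add: power_divide)
    also have "\<dots> \<le> (sqrt (grid_time \<delta> 0 i) + \<bar>grid_space \<delta> 0 k\<bar>) / 100"
      using far by (intro divide_right_mono) auto
    also have "\<dots> \<le> ?g" by (rule gap_lower[OF t])
    finally have "(L / 20)\<^sup>2 \<le> ?g" .
    then have g: "L / 20 \<le> sqrt ?g" by (rule real_le_rsqrt)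
    have g0: "0 < ?g" using \<open>(L / 20)\<^sup>2 \<le> ?g\<close> L by (smt (verit) divide_pos_pos zero_less_power)
    have "prob (base_event \<delta> \<theta> p) \<le> exp (1 / 2) * (11 * \<theta> / sqrt ?g) ^ CARD('d)"
      unfolding base_event_def p prod.case using \<theta> by (intro small_ball t g0) auto
    also have "\<dots> \<le> exp (1 / 2) * (11 * \<theta> / (L / 20)) ^ CARD('d)"
      using \<theta> g L g0 by (intro mult_left_mono power_mono divide_left_mono) auto
    also have "11 * \<theta> / (L / 20) = 220 * (\<theta> / L)" by simp
    \<comment> \<open>Here d \<ge> 7 enters: since \<theta> / L \<le> 1, the power d may be lowered
      to 7, which still exceeds the exponent 6 of the cell count.\<close>
    also have "exp (1 / 2) * (220 * (\<theta> / L)) ^ CARD('d) \<le> K"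
      unfolding K_def power_mult_distrib using \<theta> L d by (intro mult_left_mono power_decreasing) auto
    finally show ?thesis .
  qed
  have K: "0 \<le> K" using L \<theta> by (simp add: K_def)
  have fin: "finite (far_cells L \<delta>)" using card_grid_cells(1)[OF \<delta>] by (simp add: far_cells_def)
  have "prob (base_bad L \<delta> \<theta>) \<le> (\<Sum>p\<in>far_cells L \<delta>. prob (base_event \<delta> \<theta> p))"
    unfolding base_bad_def using base_event_sets[OF \<delta>(1)] fin
    by (intro finite_measure_subadditive_finite) (auto simp: far_cells_def)
  also have "\<dots> \<le> of_nat (card (far_cells L \<delta>)) * K"
    by (intro sum_bounded_above A)
  also have "\<dots> \<le> (187 * 8 ^ 0 * (L / \<delta>) ^ 6) * K"
  proof (intro mult_right_mono K)
    have "card (far_cells L \<delta>) \<le> card (grid_cells L \<delta> 0)" using card_grid_cells(1)[OF \<delta>] by (intro card_mono) (auto simp: far_cells_def)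
    then show "real (card (far_cells L \<delta>)) \<le> 187 * 8 ^ 0 * (L / \<delta>) ^ 6"
      using card_grid_cells(2)[OF \<delta>, of 0] by (meson of_nat_mono order_trans)
  qed
  finally show ?thesis by (simp add: K_def base_const_def mult_ac)
qed

text \<open>Off the bad events the base corner has norm above 11 \<theta>, and the value at the
  point is within 10 \<theta> of it. The hypothesis \<delta> \<le> L / 2 ensures that rounding down
  does not lead out of \<open>far_cells\<close>.\<close>

lemma good_lower_bound:
  assumes \<delta>: "0 < \<delta>" "\<delta> \<le> L / 2" and \<theta>: "0 < \<theta>" and \<omega>: "\<omega> \<in> space M"
    and good: "\<And>m. \<omega> \<notin> step_bad L \<delta> \<theta> m" "\<omega> \<notin> base_bad L \<delta> \<theta>"
    and t: "0 \<le> t" "L ^ 4 \<le> t + x\<^sup>2" "t + x\<^sup>2 \<le> 16 * L ^ 4"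
  shows "\<theta> \<le> norm (U t x \<omega>)"
proof -
  have \<delta>L: "\<delta> \<le> L" using \<delta> by simp
  have L: "0 < L" using \<delta> by simp
  note cell = grid_cells_floor[OF \<delta>(1) \<delta>L t(1,3)]
  let ?i = "\<lfloor>t / \<delta> ^ 4\<rfloor>" and ?k = "\<lfloor>x / \<delta>\<^sup>2\<rfloor>"
  have close: "norm (U t x \<omega> - U (grid_time \<delta> 0 ?i) (grid_space \<delta> 0 ?k) \<omega>) \<le> 10 * \<theta>"
  proof (rule grid_chaining[OF \<delta>(1) t(1), where u = "\<lambda>t x. U t x \<omega>"])
    show "continuous_on ({0..} \<times> UNIV) (\<lambda>(t, x). U t x \<omega>)" by (rule U_continuous[OF \<omega>])
    fix m
    have "\<not> \<theta> * (9 / 10) ^ m \<le> norm (U (grid_time \<delta> (Suc m) \<lfloor>t * 4 ^ Suc m / \<delta> ^ 4\<rfloor>) (grid_space \<delta> (Suc m) \<lfloor>x * 2 ^ Suc m / \<delta>\<^sup>2\<rfloor>) \<omega>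
        - U (grid_time \<delta> m (\<lfloor>t * 4 ^ Suc m / \<delta> ^ 4\<rfloor> div 4)) (grid_space \<delta> m (\<lfloor>x * 2 ^ Suc m / \<delta>\<^sup>2\<rfloor> div 2)) \<omega>)"
      using good(1)[of m] cell[of "Suc m"] \<omega> unfolding step_bad_def step_event_def by blast
    then show "norm (U (grid_time \<delta> (Suc m) \<lfloor>t * 4 ^ Suc m / \<delta> ^ 4\<rfloor>) (grid_space \<delta> (Suc m) \<lfloor>x * 2 ^ Suc m / \<delta>\<^sup>2\<rfloor>) \<omega>
        - U (grid_time \<delta> m \<lfloor>t * 4 ^ m / \<delta> ^ 4\<rfloor>) (grid_space \<delta> m \<lfloor>x * 2 ^ m / \<delta>\<^sup>2\<rfloor>) \<omega>) \<le> \<theta> * (9 / 10) ^ m"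
      unfolding grid_floor_parent[of _ m] by linarith
  qed
  \<comment> \<open>One of t and x^2 is at least L^4 / 2. Rounding loses at most \<delta>^4 \<le>
    L^4 / 16 of t, or \<delta>^2 \<le> L^2 / 4 of |x|.\<close>
  have far: "L\<^sup>2 / 4 \<le> sqrt (grid_time \<delta> 0 ?i) + \<bar>grid_space \<delta> 0 ?k\<bar>"
  proof (cases "L ^ 4 / 2 \<le> t")
    case True
    have "\<delta> ^ 4 \<le> (L / 2) ^ 4" using \<delta> by (intro power_mono) auto
    then have "\<delta> ^ 4 \<le> L ^ 4 / 16" by (simp add: power_divide)
    moreover have "t - \<delta> ^ 4 \<le> grid_time \<delta> 0 ?i"
      using grid_time_floor(2)[OF \<delta>(1), where m = 0 and t = t] by simp
    moreover have "L ^ 4 / 16 \<le> L ^ 4 / 2 - L ^ 4 / 16" using L by simp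
    ultimately have "L ^ 4 / 16 \<le> grid_time \<delta> 0 ?i" using True by linarith
    then have "sqrt ((L\<^sup>2 / 4)\<^sup>2) \<le> sqrt (grid_time \<delta> 0 ?i)"
      by (intro real_sqrt_le_mono) (simp add: power_divide flip: power_mult)
    then show ?thesis by (simp add: add_increasing2)
  next
    case False
    then have "L ^ 4 / 2 \<le> x\<^sup>2" using t by simp
    moreover have "(L\<^sup>2 / 2)\<^sup>2 = L ^ 4 / 4" by (simp add: power_divide flip: power_mult)
    moreover have "L ^ 4 / 4 \<le> L ^ 4 / 2" by simp
    ultimately have "(L\<^sup>2 / 2)\<^sup>2 \<le> x\<^sup>2" by linarith
    then have "\<bar>L\<^sup>2 / 2\<bar> \<le> \<bar>x\<bar>" by (rule abs_le_square_iff[THEN iffD2])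
    then have x: "L\<^sup>2 / 2 \<le> \<bar>x\<bar>" by simp
    have "\<delta>\<^sup>2 \<le> (L / 2)\<^sup>2" using \<delta> by (intro power_mono) auto
    then have "\<delta>\<^sup>2 \<le> L\<^sup>2 / 4" by (simp add: power_divide)
    moreover have "\<bar>x\<bar> - \<delta>\<^sup>2 \<le> \<bar>grid_space \<delta> 0 ?k\<bar>"
      using grid_space_floor[OF \<delta>(1), where m = 0 and x = x] by (auto simp: abs_le_iff)
    moreover have "0 \<le> sqrt (grid_time \<delta> 0 ?i)"
      using t \<delta> by (intro real_sqrt_ge_zero grid_time_nonneg) auto
    moreover have "L\<^sup>2 / 2 - L\<^sup>2 / 4 = L\<^sup>2 / 4" by simp
    ultimately show ?thesis using x by linarith
  qed
  have "\<not> norm (U (grid_time \<delta> 0 ?i) (grid_space \<delta> 0 ?k) \<omega>) \<le> 11 * \<theta>"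
    using good(2) cell[of 0] far \<omega> unfolding base_bad_def base_event_def far_cells_def by auto
  moreover have "norm (U (grid_time \<delta> 0 ?i) (grid_space \<delta> 0 ?k) \<omega>) \<le> norm (U t x \<omega>) + 10 * \<theta>"
    using close norm_triangle_ineq3[of "U t x \<omega>" "U (grid_time \<delta> 0 ?i) (grid_space \<delta> 0 ?k) \<omega>"] by linarith
  ultimately show ?thesis by linarith
qed

text \<open>With \<theta> / L = q^a and \<delta> / \<theta> = q, the base events need 7 a > 6 (a +
  1), that is a > 6, and the chaining needs a moment of order above 6 (a + 1). The choice a = 12
  with moment 80 > 78 bounds both contributions by multiples of q^2 = r^(2 n), which is summable in
  n.\<close>

lemma eventually_lower_bound:
  assumes d: "7 \<le> CARD('d)" and r: "0 < r" "r < 1"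
  shows "AE \<omega> in M. \<forall>\<^sub>F n in sequentially. \<forall>t x. 0 \<le> t \<longrightarrow> 16 ^ n \<le> t + x\<^sup>2 \<longrightarrow> t + x\<^sup>2 \<le> 16 * 16 ^ n
     \<longrightarrow> (2 * r ^ 12) ^ n \<le> norm (U t x \<omega>)"
proof -
  define L :: "nat \<Rightarrow> real" where "L n = 2 ^ n" for n
  define q where "q n = r ^ n" for n
  define \<delta> where "\<delta> n = L n * q n ^ 13" for n
  define \<theta> where "\<theta> n = L n * q n ^ 12" for n
  have L: "0 < L n" for n by (simp add: L_def)
  have q: "0 < q n" "q n \<le> 1" for n using r by (auto simp: q_def intro!: power_le_one)
  have \<delta>: "0 < \<delta> n" "\<delta> n \<le> L n" and \<theta>: "0 < \<theta> n" "\<theta> n \<le> L n" for n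
    using L[of n] q[of n] by (auto simp: \<delta>_def \<theta>_def power_le_one)
  have ratio: "L n / \<delta> n = 1 / q n ^ 13" "\<delta> n / \<theta> n = q n" "\<theta> n / L n = q n ^ 12" for n
    using L[of n] q[of n] by (simp_all add: \<delta>_def \<theta>_def field_simps flip: power_Suc)
  define S where "S n = (\<Union>m. step_bad (L n) (\<delta> n) (\<theta> n) m) \<union> base_bad (L n) (\<delta> n) (\<theta> n)" for n
  have S_sets: "S n \<in> events" for n
    unfolding S_def using step_bad_sets[OF \<delta>] base_bad_sets[OF \<delta>] by auto
  have prob_S: "prob (S n) \<le> (2 * step_const + base_const) * (r\<^sup>2) ^ n" for n
  proof -
    have step: "prob (step_bad (L n) (\<delta> n) (\<theta> n) m) \<le> step_const * q n ^ 2 * (1 / 2) ^ m" for m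
    proof -
      have "(1 / q n ^ 13) ^ 6 * q n ^ 80 = q n ^ 2"
      proof -
        have "q n ^ 80 = (q n ^ 13) ^ 6 * q n ^ 2" by (simp flip: power_mult power_add)
        moreover have "(1 / a) ^ 6 * (a ^ 6 * b) = b" if "0 < a" for a b :: real
          using that by (simp add: power_one_over)
        ultimately show ?thesis using q[of n] by (simp only: zero_less_power)
      qed
      then have "step_const * (1 / q n ^ 13) ^ 6 * q n ^ 80 = step_const * q n ^ 2" by (simp only: mult.assoc)
      then show ?thesis
        using prob_step_bad[OF \<delta>(1)[of n] \<delta>(2)[of n] \<theta>(1)[of n], of m] unfolding ratio by (simp only:)
    qed
    have "prob (\<Union>m. step_bad (L n) (\<delta> n) (\<theta> n) m) \<le> (\<Sum>m. prob (step_bad (L n) (\<delta> n) (\<theta> n) m))"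
    proof (intro finite_measure_subadditive_countably)
      show "summable (\<lambda>m. prob (step_bad (L n) (\<delta> n) (\<theta> n) m))"
        by (rule summable_comparison_test'[where g = "\<lambda>m. step_const * q n ^ 2 * (1 / 2) ^ m" and N = 0])
           (use step in \<open>auto intro!: summable_mult summable_geometric\<close>)
    qed (use step_bad_sets[OF \<delta>] in auto)
    also have "\<dots> \<le> (\<Sum>m. step_const * q n ^ 2 * (1 / 2) ^ m)"
    proof (intro suminf_le step)
      show "summable (\<lambda>m. step_const * q n ^ 2 * (1 / 2) ^ m)"
        by (intro summable_mult summable_geometric) simp
      then show "summable (\<lambda>m. prob (step_bad (L n) (\<delta> n) (\<theta> n) m))"
        by (rule summable_comparison_test'[where N = 0]) (use step in auto)
    qed
    also have "\<dots> = 2 * step_const * q n ^ 2"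
      by (subst suminf_mult) (auto simp: suminf_geometric)
    finally have 1: "prob (\<Union>m. step_bad (L n) (\<delta> n) (\<theta> n) m) \<le> 2 * step_const * q n ^ 2" .
    have "prob (base_bad (L n) (\<delta> n) (\<theta> n)) \<le> base_const * q n ^ 6"
    proof -
      have "(1 / q n ^ 13) ^ 6 * (q n ^ 12) ^ 7 = q n ^ 6"
      proof -
        have "(q n ^ 12) ^ 7 = (q n ^ 13) ^ 6 * q n ^ 6" by (simp flip: power_mult power_add)
        moreover have "(1 / a) ^ 6 * (a ^ 6 * b) = b" if "0 < a" for a b :: real
          using that by (simp add: power_one_over)
        ultimately show ?thesis using q[of n] by (simp only: zero_less_power)
      qed
      then have "base_const * (1 / q n ^ 13) ^ 6 * (q n ^ 12) ^ 7 = base_const * q n ^ 6" by (simp only: mult.assoc)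
      then show ?thesis
        using prob_base_bad[OF \<delta>(1)[of n] \<delta>(2)[of n] \<theta>(1)[of n] \<theta>(2)[of n] d] unfolding ratio by (simp only:)
    qed
    also have "\<dots> \<le> base_const * q n ^ 2"
      using q[of n] by (intro mult_left_mono power_decreasing) (auto simp: base_const_def)
    finally have 2: "prob (base_bad (L n) (\<delta> n) (\<theta> n)) \<le> base_const * q n ^ 2" .
    have "prob (S n) \<le> prob (\<Union>m. step_bad (L n) (\<delta> n) (\<theta> n) m) + prob (base_bad (L n) (\<delta> n) (\<theta> n))"
      unfolding S_def using step_bad_sets[OF \<delta>] base_bad_sets[OF \<delta>] by (intro measure_Un_le) auto
    also have "\<dots> \<le> (2 * step_const + base_const) * q n ^ 2"
      using 1 2 by (simp add: distrib_right)
    also have "q n ^ 2 = (r\<^sup>2) ^ n" by (simp add: q_def mult.commute flip: power_mult)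
    finally show ?thesis .
  qed
  have good: "AE \<omega> in M. \<forall>\<^sub>F n in sequentially. \<omega> \<in> space M - S n"
  proof (rule borel_cantelli_AE1[OF S_sets])
    have "r\<^sup>2 < 1" using r by (simp add: power_less_one_iff)
    then have "summable (\<lambda>n. (2 * step_const + base_const) * (r\<^sup>2) ^ n)"
      by (intro summable_mult summable_geometric) simp
    then show "summable (\<lambda>n. prob (S n))"
      by (rule summable_comparison_test'[where N = 0]) (use prob_S in auto)
  qed (simp add: emeasure_eq_measure)
  \<comment> \<open>Eventually \<delta> \<le> L / 2, as \<open>good_lower_bound\<close>
    requires.\<close>
  have small: "\<forall>\<^sub>F n in sequentially. q n ^ 13 < 1 / 2"
  proof -
    have "(\<lambda>n. q n ^ 13) \<longlonglongrightarrow> 0 ^ 13"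
      unfolding q_def using r by (intro tendsto_power LIMSEQ_realpow_zero) auto
    then show ?thesis by (intro order_tendstoD(2)[of _ 0]) auto
  qed
  from good show ?thesis
  proof eventually_elim
    case (elim \<omega>)
    from elim small show ?case
    proof eventually_elim
      case (elim n)
      show ?case
      proof (intro allI impI)
        fix t x :: real assume t: "0 \<le> t" "16 ^ n \<le> t + x\<^sup>2" "t + x\<^sup>2 \<le> 16 * 16 ^ n"
        have L4: "L n ^ 4 = 16 ^ n" unfolding L_def by (simp add: mult.commute[of n] power_mult flip: power_mult[of 2 n 4])
        have "\<delta> n \<le> L n / 2" using elim(2) L[of n] by (simp add: \<delta>_def)
        then have "\<theta> n \<le> norm (U t x \<omega>)"
          using elim(1) t \<delta>(1) \<theta>(1) by (intro good_lower_bound[of "\<delta> n" "L n" "\<theta> n"]) (auto simp: S_def L4)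
        moreover have "\<theta> n = (2 * r ^ 12) ^ n"
          by (simp add: \<theta>_def L_def q_def power_mult_distrib mult.commute flip: power_mult)
        ultimately show "(2 * r ^ 12) ^ n \<le> norm (U t x \<omega>)" by simp
      qed
    qed
  qed
qed

end

section \<open>From shells and sparse times to the lower limit\<close>

lemma ex_power_16_ivl:
  fixes s :: real assumes "16 ^ k \<le> s"
  shows "\<exists>n\<ge>k. 16 ^ n \<le> s \<and> s \<le> 16 * 16 ^ n"
proof -
  obtain N where N: "s < 16 ^ N" using real_arch_pow[of 16 s] by auto
  define n where "n = (LEAST n. s < (16::real) ^ n)"
  have n: "s < 16 ^ n" unfolding n_def by (rule LeastI[of _ N]) (rule N)
  have least: "16 ^ j \<le> s" if "j < n" for j
    using not_less_Least[of j "\<lambda>n. s < (16::real) ^ n"] that by (simp add: n_def)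
  have "(16::real) ^ k < 16 ^ n" using n assms by linarith
  then have "k < n" by (simp add: power_strict_increasing_iff)
  then obtain j where j: "n = Suc j" "k \<le> j" by (cases n) auto
  show ?thesis using n least[of j] j by (intro exI[of _ j]) auto
qed

lemma Liminf_real_zero:
  fixes f :: "real \<Rightarrow> real"
  assumes nonneg: "\<forall>\<^sub>F t in at_top. 0 \<le> f t" and small: "\<And>j::nat. \<exists>\<^sub>F t in at_top. f t \<le> 1 / Suc j"
  shows "Liminf at_top (\<lambda>t. ereal (f t)) = 0"
proof (rule antisym)
  show "0 \<le> Liminf at_top (\<lambda>t. ereal (f t))"
    using nonneg by (intro Liminf_bounded) (auto elim: eventually_mono)
  have le: "Liminf at_top (\<lambda>t. ereal (f t)) \<le> ereal (1 / Suc j)" for j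
  proof (rule ccontr)
    assume "\<not> ?thesis"
    then have "ereal (1 / Suc j) < Liminf at_top (\<lambda>t. ereal (f t))" by simp
    then have "\<forall>\<^sub>F t in at_top. ereal (1 / Suc j) < ereal (f t)" by (rule less_LiminfD)
    then have "\<forall>\<^sub>F t in at_top. \<not> f t \<le> 1 / Suc j" by (auto elim: eventually_mono)
    then show False using small[of j] by (simp add: frequently_def)
  qed
  show "Liminf at_top (\<lambda>t. ereal (f t)) \<le> 0"
  proof (rule LIMSEQ_le_const[of "\<lambda>j. ereal (1 / Suc j)"])
    have "(\<lambda>j. ereal (1 / real (Suc j))) \<longlonglongrightarrow> ereal 0"
      by (intro tendsto_intros LIMSEQ_Suc[OF lim_1_over_n])
    then show "(\<lambda>j. ereal (1 / real (Suc j))) \<longlonglongrightarrow> 0" by (simp add: zero_ereal_def)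
  qed (use le in auto)
qed

context stationary_pinned_string
begin

lemma Liminf_inf_string_infinity:
  assumes d: "7 \<le> CARD('d)" and \<alpha>: "0 < \<alpha>" "\<alpha> < 1 / 4"
  shows "AE \<omega> in M. Liminf at_top (\<lambda>t. ereal ((INF x. norm (U t x \<omega>)) / t powr \<alpha>)) = \<infinity>"
proof -
  \<comment> \<open>The midpoint of \<alpha> and 1/4. Below, r is solved from 2 r^12 = 16^\<beta>,
    so that the bound on the n-th shell is the \<beta>-th power of 16^n.\<close>
  define \<beta> where "\<beta> = (1 + 4 * \<alpha>) / 8"
  have \<beta>: "\<alpha> < \<beta>" "0 < \<beta>" using \<alpha> by (auto simp: \<beta>_def field_simps)
  define r where "r = 2 powr (- (1 - 4 * \<alpha>) / 24)"
  have r: "0 < r" "r < 1"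
    using \<alpha> powr_less_mono[of "- (1 - 4 * \<alpha>) / 24" 0 2] by (auto simp: r_def)
  have "r ^ 12 = r powr 12" using r by (simp add: powr_realpow flip: powr_numeral)
  also have "\<dots> = 2 powr (- (1 - 4 * \<alpha>) / 2)"
  proof -
    have "- (1 - 4 * \<alpha>) / 24 * 12 = - (1 - 4 * \<alpha>) / 2" by (simp add: field_simps)
    then show ?thesis by (simp only: r_def powr_powr)
  qed
  finally have "2 * r ^ 12 = 2 powr 1 * 2 powr (- (1 - 4 * \<alpha>) / 2)" by simp
  also have "\<dots> = 2 powr (4 * \<beta>)"
  proof -
    have "1 + - (1 - 4 * \<alpha>) / 2 = 4 * \<beta>" by (simp add: \<beta>_def field_simps)
    then show ?thesis by (simp only: powr_add[symmetric])
  qed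
  also have "\<dots> = 16 powr \<beta>"
  proof -
    have "(16::real) = 2 powr 4" by simp
    then show ?thesis by (simp only: powr_powr)
  qed
  finally have base: "2 * r ^ 12 = 16 powr \<beta>" .
  have pw: "(2 * r ^ 12) ^ n = (16 ^ n) powr \<beta>" for n
  proof -
    have "(16 powr \<beta>) ^ n = 16 powr (\<beta> * n)" by (simp add: powr_power mult.commute)
    moreover have "(16 ^ n) powr \<beta> = (16 powr real n) powr \<beta>" by (simp add: powr_realpow)
    ultimately show ?thesis unfolding base by (simp add: powr_powr mult.commute)
  qed
  show ?thesis
    using eventually_lower_bound[OF d r]
  proof eventually_elim
    case (elim \<omega>)
    then obtain k where k: "\<And>n t x. k \<le> n \<Longrightarrow> 0 \<le> t \<Longrightarrow> 16 ^ n \<le> t + x\<^sup>2 \<Longrightarrow> t + x\<^sup>2 \<le> 16 * 16 ^ n \<Longrightarrow> (16 ^ n) powr \<beta> \<le> norm (U t x \<omega>)"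
      unfolding eventually_sequentially pw by blast
    \<comment> \<open>At a fixed t the points x fall into different shells, but each of these has
      16^n \<ge> t / 16, so the bound is uniform in x.\<close>
    have lower: "(t / 16) powr \<beta> \<le> norm (U t x \<omega>)" if t: "16 ^ k \<le> t" for t x
    proof -
      have t0: "0 < t" using t by (rule less_le_trans[rotated]) simp
      have "16 ^ k \<le> t + x\<^sup>2" using t by (simp add: add_increasing2)
      then obtain n where n: "k \<le> n" "16 ^ n \<le> t + x\<^sup>2" "t + x\<^sup>2 \<le> 16 * 16 ^ n"
        using ex_power_16_ivl by blast
      have "t \<le> t + x\<^sup>2" by simp
      then have "t / 16 \<le> 16 ^ n" using n by linarith
      then have "(t / 16) powr \<beta> \<le> (16 ^ n) powr \<beta>" using t0 \<beta> by (intro powr_mono2) auto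
      also have "\<dots> \<le> norm (U t x \<omega>)" using n t0 by (intro k) auto
      finally show ?thesis .
    qed
    have ev: "\<forall>\<^sub>F t in at_top. (t / 16) powr \<beta> / t powr \<alpha> \<le> (INF x. norm (U t x \<omega>)) / t powr \<alpha>"
      using eventually_ge_at_top[of "16 ^ k"]
    proof eventually_elim
      case (elim t)
      then show ?case by (intro divide_right_mono cINF_greatest lower) auto
    qed
    have "filterlim (\<lambda>t. (t / 16) powr \<beta> / t powr \<alpha>) at_top at_top"
      using \<beta> \<alpha> by real_asymp
    then have "filterlim (\<lambda>t. (INF x. norm (U t x \<omega>)) / t powr \<alpha>) at_top at_top"
      using ev by (rule filterlim_at_top_mono)
    then have "((\<lambda>t. ereal ((INF x. norm (U t x \<omega>)) / t powr \<alpha>)) \<longlongrightarrow> \<infinity>) at_top"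
      by (simp add: tendsto_PInfty filterlim_at_top_dense)
    then show ?case by (intro lim_imp_Liminf) auto
  qed
qed

text \<open>The value at x = 0 bounds the infimum from above. The small values found there belong to
  the exponent 1/4, and t \<ge> 1 transfers them to every larger \<alpha>.\<close>

lemma Liminf_inf_string_zero:
  assumes \<alpha>: "1 / 4 \<le> \<alpha>"
  shows "AE \<omega> in M. Liminf at_top (\<lambda>t. ereal ((INF x. norm (U t x \<omega>)) / t powr \<alpha>)) = 0"
proof -
  have "AE \<omega> in M. \<forall>j::nat. \<exists>\<^sub>F n in sequentially. norm (U ((2 ^ n\<^sup>2) ^ 4) 0 \<omega>) < 1 / Suc j * 2 ^ n\<^sup>2"
    by (subst AE_all_countable) (intro allI frequently_small, simp)
  then show ?thesis
  proof eventually_elim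
    case (elim \<omega>)
    let ?f = "\<lambda>t. (INF x. norm (U t x \<omega>)) / t powr \<alpha>"
    have inf0: "0 \<le> (INF x. norm (U t x \<omega>))" for t by (rule cINF_greatest) auto
    show ?case
    proof (rule Liminf_real_zero)
      show "\<forall>\<^sub>F t in at_top. 0 \<le> ?f t" using inf0 by simp
      fix j
      \<comment> \<open>The sparse times tend to infinity, so whatever is frequent along them is
        frequent as t tends to infinity.\<close>
      have lim: "filterlim (\<lambda>n::nat. ((2::real) ^ n\<^sup>2) ^ 4) at_top sequentially"
      proof (rule filterlim_at_top_mono[OF filterlim_real_sequentially])
        have "real n \<le> (2 ^ n\<^sup>2) ^ 4" for n :: nat
        proof -
          have "real n \<le> real (n\<^sup>2 * 4)" by (simp add: power2_eq_square flip: of_nat_mult)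
          also have "\<dots> \<le> 2 ^ (n\<^sup>2 * 4)" using less_exp[of "n\<^sup>2 * 4"] by (metis less_imp_le of_nat_le_iff of_nat_numeral of_nat_power)
          finally show ?thesis by (simp add: power_mult)
        qed
        then show "\<forall>\<^sub>F n in sequentially. real n \<le> (2 ^ n\<^sup>2) ^ 4" by simp
      qed
      have "\<exists>\<^sub>F n in sequentially. ?f ((2 ^ n\<^sup>2) ^ 4) \<le> 1 / Suc j"
        using elim[rule_format, of j]
      proof (rule frequently_elim1)
        fix n :: nat
        define b :: real where "b = 2 ^ n\<^sup>2"
        assume "norm (U ((2 ^ n\<^sup>2) ^ 4) 0 \<omega>) < 1 / Suc j * 2 ^ n\<^sup>2"
        then have less: "norm (U (b ^ 4) 0 \<omega>) < 1 / Suc j * b" by (simp add: b_def)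
        have b: "1 \<le> b" by (simp add: b_def)
        have "(INF x. norm (U (b ^ 4) x \<omega>)) \<le> norm (U (b ^ 4) 0 \<omega>)"
          by (rule cINF_lower) (auto intro!: bdd_belowI[of _ 0])
        also have "\<dots> \<le> 1 / Suc j * b" using less by simp
        also have "b \<le> (b ^ 4) powr \<alpha>"
        proof -
          have "b = (b ^ 4) powr (1 / 4)" using b by (simp add: powr_powr flip: powr_numeral)
          also have "\<dots> \<le> (b ^ 4) powr \<alpha>" using b \<alpha> by (intro powr_mono) auto
          finally show ?thesis .
        qed
        finally have "(INF x. norm (U (b ^ 4) x \<omega>)) \<le> 1 / Suc j * (b ^ 4) powr \<alpha>" by (simp add: divide_right_mono)
        then show "?f ((2 ^ n\<^sup>2) ^ 4) \<le> 1 / Suc j"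
          using b unfolding b_def[symmetric] by (simp add: divide_le_eq)
      qed
      then have "\<exists>\<^sub>F t in filtermap (\<lambda>n::nat. ((2::real) ^ n\<^sup>2) ^ 4) sequentially. ?f t \<le> 1 / Suc j"
        by (simp add: frequently_def eventually_filtermap)
      then show "\<exists>\<^sub>F t in at_top. ?f t \<le> 1 / Suc j"
        using lim unfolding filterlim_def frequently_def by (meson filter_leD)
    qed
  qed
qed

end

theorem theorem1p2:
  fixes M :: "'w measure" and F :: "real \<Rightarrow> 'w measure"
    and W W' :: "'d::finite \<Rightarrow> 'w noise"
    and U :: "real \<Rightarrow> real \<Rightarrow> 'w \<Rightarrow> real ^ 'd"
    and \<alpha> :: real
  assumes "CARD('d) \<ge> 7"
    and "stationary_pinned_string M F W W' U"
    and "\<alpha> > 0"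
  shows "AE \<omega> in M.
    Liminf at_top (\<lambda>t. ereal ((INF x. norm (U t x \<omega>)) / t powr \<alpha>))
      = (if \<alpha> < 1/4 then \<infinity> else 0)"
proof -
  interpret stationary_pinned_string M F W W' U by fact
  show ?thesis
    using Liminf_inf_string_infinity[OF assms(1,3)] Liminf_inf_string_zero[of \<alpha>] by (cases "\<alpha> < 1/4") auto
qed

end
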